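(* Let $\Delta=[\boldsymbol p_1,\boldsymbol p_2,\boldsymbol p_3]\subset\mathbb R^2$ be a nondegenerate triangle with Powell–Sabin 12-split $\Delta_{12}$. For $d=1,2,3$ and each of the bases $\boldsymbol s_1$, $\boldsymbol s_2$, $\tilde{\boldsymbol s}_2$, $\boldsymbol s_3$, $\tilde{\boldsymbol s}_3$ of degree $d$ defined in the context, with elements $S_{1,d},\dots,S_{n_d,d}$ and dual points $\boldsymbol p_{j,d,k}$, consider the map $$Q_d:C^0(\Delta)\to\mathbb S_d(\Delta_{12}),\qquad Q_d(F)=\sum_{j=1}^{n_d}l_{j,d}(F)S_{j,d},$$ where the functionals $l_{j,d}:C^0(\Delta)\to\mathbb R$ are given by $$l_{j,d}(F):=\sum_{m=1}^d\frac{m^d}{d!}(-1)^{d-m}\sum_{1\le k_1<\cdots<k_m\le d}F\left(\frac{\boldsymbol p_{j,d,k_1}+\cdots+\boldsymbol p_{j,d,k_m}}m\right).$$ Then $Q_d$ is a quasi-interpolant reproducing polynomials up to degree $d$, i.e. $Q_d(F)=F$ on $\Delta$ for every bivariate polynomial $F$ of total degree at most $d$.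
   Context: **The 12-split.** $\boldsymbol p_4=\frac{\boldsymbol p_1+\boldsymbol p_2}2$, $\boldsymbol p_5=\frac{\boldsymbol p_2+\boldsymbol p_3}2$, $\boldsymbol p_6=\frac{\boldsymbol p_3+\boldsymbol p_1}2$, $\boldsymbol p_7=\frac{\boldsymbol p_4+\boldsymbol p_6}2$, $\boldsymbol p_8=\frac{\boldsymbol p_4+\boldsymbol p_5}2$, $\boldsymbol p_9=\frac{\boldsymbol p_5+\boldsymbol p_6}2$, $\boldsymbol p_{10}=\frac{\boldsymbol p_1+\boldsymbol p_2+\boldsymbol p_3}3$. The 12-split has the subtriangles (by vertex indices) $[1,6,7],[1,4,7],[2,4,8],[2,5,8],[3,5,9],[3,6,9],[6,7,10],[4,7,10],[4,8,10],[5,8,10],[5,9,10],[6,9,10]$. $\mathbb S_d(\Delta_{12})$ is the space of functions in $C^{d-1}(\Delta)$ that are polynomials of degree $\le d$ on each subtriangle. **Simplex splines.** For a multiset $\mathcal K=\{\boldsymbol k_1,\dots,\boldsymbol k_{d+3}\}$ of points $\boldsymbol p_i$, not all on one line, $d\ge1$, choose a simplex $\sigma=[\overline{\boldsymbol k}_1,\dots,\overline{\boldsymbol k}_{d+3}]\subset\mathbb R^{d+2}$ with $\boldsymbol P(\overline{\boldsymbol k}_i)=\boldsymbol k_i$, $\boldsymbol P$ the projection onto the first two coordinates, and set $Q[\mathcal K](\boldsymbol x)=\mathrm{area}(\Delta)\binom{d+2}2^{-1}\frac{\mathrm{vol}_d(\sigma\cap\boldsymbol P^{-1}(\boldsymbol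 x))}{\mathrm{vol}_{d+2}(\sigma)}$. Write $Q[ijklmn]=Q[\boldsymbol p_1^i\boldsymbol p_2^j\boldsymbol p_3^k\boldsymbol p_4^l\boldsymbol p_5^m\boldsymbol p_6^n]$ and $Q[ijklmn;o]$ if additionally $\boldsymbol p_{10}$ has multiplicity $o$ (exponents are multiplicities). **Bases** ($n_1=10$, $n_2=12$, $n_3=16$): - $\boldsymbol s_1$: $\frac14Q[200101]$, $\frac14Q[020110]$, $\frac14Q[002011]$, $\frac13Q[110100;1]$, $\frac13Q[011010;1]$, $\frac13Q[101001;1]$, $\frac13Q[100101;1]$, $\frac13Q[010110;1]$, $\frac13Q[001011;1]$, $\frac14Q[000111;1]$ (the nodal basis: $S_{j,1}(\boldsymbol p_i)=\delta_{ij}$). - $\boldsymbol s_2$: $\frac14Q[300101]$, $\frac12Q[210101]$, $\frac34Q[110111]$, $\frac12Q[120110]$, $\frac14Q[030110]$, $\frac12Q[021110]$, $\frac34Q[011111]$, $\frac12Q[012011]$, $\frac14Q[003011]$, $\frac12Q[102011]$, $\frac34Q[101111]$, $\frac12Q[201101]$. - $\tilde{\boldsymbol s}_2$: as $\boldsymbol s_2$, with entries 3, 7, 11 replaced by $\frac34Q[111101]$, $\frac34Q[111110]$, $\frac34Q[111011]$. - $\boldsymbol s_3$: $\frac14Q[400101]$, $\frac12Q[310101]$, $Q[221100]$, $\frac12Q[130110]$, $\frac14Q[040110]$, $\frac12Q[031110]$, $Q[122010]$, $\frac12Q[013011]$, $\frac14Q[004011]$, $\frac12Q[103011]$, $Q[212001]$,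 $\frac12Q[301101]$, $Q[211101]$, $Q[121110]$, $Q[112011]$, $\frac14Q[111111]$. - $\tilde{\boldsymbol s}_3$: as $\boldsymbol s_3$, with entries 13, 14, 15, 16 replaced by $\frac34Q[211101]$, $\frac34Q[121110]$, $\frac34Q[112011]$, $Q[222000]$. **Dual points.** The dual points $\boldsymbol p_{j,d,1},\dots,\boldsymbol p_{j,d,d}$ of the $j$-th basis function are the points whose indices are listed at the $j$-th position (e.g. $1,1,4$ means $\boldsymbol p_1,\boldsymbol p_1,\boldsymbol p_4$): - $\boldsymbol s_1$: $(1),(2),(3),(4),(5),(6),(7),(8),(9),(10)$. - $\boldsymbol s_2$: $(1,1),(1,4),(4,10),(2,4),(2,2),(2,5),(5,10),(3,5),(3,3),(3,6),(6,10),(1,6)$. - $\tilde{\boldsymbol s}_2$: as for $\boldsymbol s_2$, with positions 3, 7, 11 replaced by $(1,10),(2,10),(3,10)$. - $\boldsymbol s_3$: $(1,1,4')$-type list: $(1,1,1),(1,1,4),(1,2,4),(2,2,4),(2,2,2),(2,2,5),(2,3,5),(3,3,5),(3,3,3),(3,3,6),(1,3,6),(1,1,6),(1,4,6),(2,4,5),(3,5,6),(1,2,3)$ (sixteen triples in order $j=1,\dots,16$). - $\tilde{\boldsymbol s}_3$: as for $\boldsymbol s_3$, with positions 13, 14, 15 replaced by $(1,1,10),(2,2,10),(3,3,10)$, and position 16 being $(1,2,3)$. *)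

theory Defs
  imports "HOL-Analysis.Analysis" "HOL-Library.Multiset"
begin

section \<open>The Powell--Sabin 12-split\<close>

definition ps12_vertices :: "(nat \<Rightarrow> real^2) \<Rightarrow> bool" where
  "ps12_vertices p \<longleftrightarrow>
     p 4 = midpoint (p 1) (p 2) \<and> p 5 = midpoint (p 2) (p 3) \<and> p 6 = midpoint (p 3) (p 1) \<and>
     p 7 = midpoint (p 4) (p 6) \<and> p 8 = midpoint (p 4) (p 5) \<and> p 9 = midpoint (p 5) (p 6) \<and>
     p 10 = (1/3) *\<^sub>R (p 1 + p 2 + p 3)"

definition triangle :: "(nat \<Rightarrow> real^2) \<Rightarrow> (real^2) set" where
  "triangle p = convex hull {p 1, p 2, p 3}"

definition ps12_subtriangles :: "nat set set" where
  "ps12_subtriangles =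
     {{1,6,7}, {1,4,7}, {2,4,8}, {2,5,8}, {3,5,9}, {3,6,9},
      {6,7,10}, {4,7,10}, {4,8,10}, {5,8,10}, {5,9,10}, {6,9,10}}"


section \<open>The spline space\<close>

definition polys_upto :: "nat \<Rightarrow> (real^2 \<Rightarrow> real) set" where
  "polys_upto d =
     {f. \<exists>c :: nat \<Rightarrow> nat \<Rightarrow> real. \<forall>x. f x = (\<Sum>i\<le>d. \<Sum>j\<le>d - i. c i j * (x$1)^i * (x$2)^j)}"

text \<open>
  The class of r times continuously differentiable functions on a set. Derivatives are taken
  relative to the set, which is one-sided differentiability at its boundary points; the two
  functions \<open>g\<^sub>1\<close>, \<open>g\<^sub>2\<close> are the partial derivatives.
\<close>

fun Ck_on :: "nat \<Rightarrow> (real^2) set \<Rightarrow> (real^2 \<Rightarrow> real) \<Rightarrow> bool" where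
  "Ck_on 0 S f = continuous_on S f"
| "Ck_on (Suc r) S f =
     (\<exists>g\<^sub>1 g\<^sub>2. Ck_on r S g\<^sub>1 \<and> Ck_on r S g\<^sub>2 \<and>
        (\<forall>x\<in>S. (f has_derivative (\<lambda>v. g\<^sub>1 x * v$1 + g\<^sub>2 x * v$2)) (at x within S)))"

text \<open>
  Functions on the triangle are represented by functions on the whole plane of which only the
  values on the triangle matter.
\<close>

definition spline_space :: "(nat \<Rightarrow> real^2) \<Rightarrow> nat \<Rightarrow> (real^2 \<Rightarrow> real) set" where
  "spline_space p d =
     {f. Ck_on (d - 1) (triangle p) f \<and>
         (\<forall>I\<in>ps12_subtriangles. \<exists>q\<in>polys_upto d. \<forall>x\<in>convex hull (p ` I). f x = q x)}"


section \<open>Simplex splines\<close>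

text \<open>
  The degree d is the cardinality of the index type \<open>'d\<close>, and \<open>\<real>\<^sup>d\<^sup>+\<^sup>2\<close> is the product of
  \<open>real^2\<close> and \<open>real^'d\<close>, with \<open>fst\<close> the projection onto the first two coordinates. A simplex over a
  multiset \<open>K\<close> of \<open>d + 3\<close> points is given by its set \<open>C\<close> of vertices: they are affinely independent
  and project to \<open>K\<close>, counted with multiplicity.
\<close>

definition simplex_over :: "(real^2) multiset \<Rightarrow> ((real^2) \<times> (real^'d::finite)) set \<Rightarrow> bool" where
  "simplex_over K C \<longleftrightarrow>
     finite C \<and> card C = CARD('d) + 3 \<and> \<not> affine_dependent C \<and> image_mset fst (mset_set C) = K"

text \<open>
  The value does not depend on the chosen simplex. One exists whenever \<open>K\<close> has \<open>d + 3\<close> elements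
  that are not all on one line; for other \<open>K\<close> the value is meaningless. The number \<open>a\<close> is the area
  of the reference triangle. The fibre over \<open>x\<close> is measured in \<open>real^'d\<close>.
\<close>

definition simplex_spline ::
    "'d::finite itself \<Rightarrow> real \<Rightarrow> (real^2) multiset \<Rightarrow> real^2 \<Rightarrow> real" where
  "simplex_spline _ a K x =
     (let \<sigma> = convex hull (SOME C :: ((real^2) \<times> (real^'d)) set. simplex_over K C)
      in a / real ((CARD('d) + 2) choose 2) *
         (measure lebesgue {y. (x, y) \<in> \<sigma>} / measure lebesgue \<sigma>))"

text \<open>
  A list \<open>[i, j, k, l, m, n, o]\<close> contains the multiplicities of the vertices 1, 2, 3, 4, 5, 6, 10,
  in this order; the last one is 0 in the shorter notation \<open>Q[ijklmn]\<close>.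
\<close>

definition knots :: "(nat \<Rightarrow> real^2) \<Rightarrow> nat list \<Rightarrow> (real^2) multiset" where
  "knots p \<mu> = (\<Sum>i<7. replicate_mset (\<mu> ! i) (p ([1, 2, 3, 4, 5, 6, 10] ! i)))"

definition Qspline :: "'d::finite itself \<Rightarrow> (nat \<Rightarrow> real^2) \<Rightarrow> nat list \<Rightarrow> real^2 \<Rightarrow> real" where
  "Qspline D p \<mu> = simplex_spline D (measure lebesgue (triangle p)) (knots p \<mu>)"


section \<open>The bases and their dual points\<close>

text \<open>
  A basis is a list of scalar factors and knot multiplicities, the dual points of its elements are
  lists of vertex indices. Note that \<open>xs[i := x]\<close> counts positions from 0.
\<close>

definition s1 :: "(real \<times> nat list) list" where
  "s1 = [(1/4, [2,0,0,1,0,1,0]), (1/4, [0,2,0,1,1,0,0]), (1/4, [0,0,2,0,1,1,0]),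
         (1/3, [1,1,0,1,0,0,1]), (1/3, [0,1,1,0,1,0,1]), (1/3, [1,0,1,0,0,1,1]),
         (1/3, [1,0,0,1,0,1,1]), (1/3, [0,1,0,1,1,0,1]), (1/3, [0,0,1,0,1,1,1]),
         (1/4, [0,0,0,1,1,1,1])]"

definition s2 :: "(real \<times> nat list) list" where
  "s2 = [(1/4, [3,0,0,1,0,1,0]), (1/2, [2,1,0,1,0,1,0]), (3/4, [1,1,0,1,1,1,0]),
         (1/2, [1,2,0,1,1,0,0]), (1/4, [0,3,0,1,1,0,0]), (1/2, [0,2,1,1,1,0,0]),
         (3/4, [0,1,1,1,1,1,0]), (1/2, [0,1,2,0,1,1,0]), (1/4, [0,0,3,0,1,1,0]),
         (1/2, [1,0,2,0,1,1,0]), (3/4, [1,0,1,1,1,1,0]), (1/2, [2,0,1,1,0,1,0])]"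

definition s2' :: "(real \<times> nat list) list" where
  "s2' = s2[2 := (3/4, [1,1,1,1,0,1,0]), 6 := (3/4, [1,1,1,1,1,0,0]),
            10 := (3/4, [1,1,1,0,1,1,0])]"

definition s3 :: "(real \<times> nat list) list" where
  "s3 = [(1/4, [4,0,0,1,0,1,0]), (1/2, [3,1,0,1,0,1,0]), (1, [2,2,1,1,0,0,0]),
         (1/2, [1,3,0,1,1,0,0]), (1/4, [0,4,0,1,1,0,0]), (1/2, [0,3,1,1,1,0,0]),
         (1, [1,2,2,0,1,0,0]), (1/2, [0,1,3,0,1,1,0]), (1/4, [0,0,4,0,1,1,0]),
         (1/2, [1,0,3,0,1,1,0]), (1, [2,1,2,0,0,1,0]), (1/2, [3,0,1,1,0,1,0]),
         (1, [2,1,1,1,0,1,0]), (1, [1,2,1,1,1,0,0]), (1, [1,1,2,0,1,1,0]),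
         (1/4, [1,1,1,1,1,1,0])]"

definition s3' :: "(real \<times> nat list) list" where
  "s3' = s3[12 := (3/4, [2,1,1,1,0,1,0]), 13 := (3/4, [1,2,1,1,1,0,0]),
            14 := (3/4, [1,1,2,0,1,1,0]), 15 := (1, [2,2,2,0,0,0,0])]"

definition dual1 :: "nat list list" where
  "dual1 = [[1], [2], [3], [4], [5], [6], [7], [8], [9], [10]]"

definition dual2 :: "nat list list" where
  "dual2 = [[1,1], [1,4], [4,10], [2,4], [2,2], [2,5], [5,10], [3,5], [3,3], [3,6], [6,10], [1,6]]"

definition dual2' :: "nat list list" where
  "dual2' = dual2[2 := [1,10], 6 := [2,10], 10 := [3,10]]"

definition dual3 :: "nat list list" where
  "dual3 = [[1,1,1], [1,1,4], [1,2,4], [2,2,4], [2,2,2], [2,2,5], [2,3,5], [3,3,5], [3,3,3],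
            [3,3,6], [1,3,6], [1,1,6], [1,4,6], [2,4,5], [3,5,6], [1,2,3]]"

definition dual3' :: "nat list list" where
  "dual3' = dual3[12 := [1,1,10], 13 := [2,2,10], 14 := [3,3,10]]"


section \<open>The quasi-interpolants\<close>

text \<open>
  The index tuples \<open>k\<^sub>1 < \<dots> < k\<^sub>m\<close> are the subsets of cardinality \<open>m\<close>, so that repeated dual points
  are counted separately.
\<close>

definition dual_functional :: "(real^2) list \<Rightarrow> (real^2 \<Rightarrow> real) \<Rightarrow> real" where
  "dual_functional ps F =
     (let d = length ps in
      \<Sum>m = 1..d. real m ^ d / fact d * (-1) ^ (d - m) *
        (\<Sum>K | K \<subseteq> {..<d} \<and> card K = m. F ((1 / real m) *\<^sub>R (\<Sum>k\<in>K. ps ! k))))"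

definition quasi_interp ::
    "'d::finite itself \<Rightarrow> (nat \<Rightarrow> real^2) \<Rightarrow> (real \<times> nat list) list \<Rightarrow> nat list list \<Rightarrow>
     (real^2 \<Rightarrow> real) \<Rightarrow> real^2 \<Rightarrow> real" where
  "quasi_interp D p B duals F x =
     (\<Sum>j<length B. dual_functional (map p (duals ! j)) F *
                   (fst (B ! j) * Qspline D p (snd (B ! j)) x))"

definition reproducing_quasi_interpolant ::
    "(nat \<Rightarrow> real^2) \<Rightarrow> nat \<Rightarrow> ((real^2 \<Rightarrow> real) \<Rightarrow> real^2 \<Rightarrow> real) \<Rightarrow> bool" where
  "reproducing_quasi_interpolant p d Q \<longleftrightarrow>
     (\<forall>F. continuous_on (triangle p) F \<longrightarrow> Q F \<in> spline_space p d) \<and>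
     (\<forall>F\<in>polys_upto d. \<forall>x\<in>triangle p. Q F x = F x)"

end

(*
  Choose three non-collinear knots a, b, c. In the coordinates of the other knots the fibre of a
  simplex over x is, up to a constant Jacobian, the polytope of all t >= 0 with sum_j t_j k_j <= x,
  where k_j and x are written in barycentric coordinates with respect to a, b, c. Integrating over x
  gives the volume of a standard simplex, so that the Jacobian cancels and
    Q[K](x) = d! area(p1,p2,p3) / area(a,b,c) * vol(polytope),
  independently of the chosen simplex. For the multisets that occur, the volume is a polynomial plus
  a combination of truncated powers max(0, l)^d, where l = 0 is one of the lines b1 = b2, b2 = b3,
  b3 = b1, b1 = b2 + b3, b2 = b1 + b3, b3 = b1 + b2; for d = 1 also min(b1, b2, b3) is needed.
  These lines are exactly the chords of the 12-split, hence the splines lie in the spline space.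
  Polynomial reproduction is linear in F and is verified on the monomials of degree d in the
  barycentric coordinates, where it is an identity with the truncated powers as indeterminates.
*)
theory Submission
  imports Defs
begin

section \<open>Barycentric coordinates and fibres of simplices\<close>

text \<open>The functional \<open>dual_functional\<close> is the polarization formula: for a form of
  degree d in the barycentric coordinates the weight m^d turns the value at a mean into the value at
  a sum, so that it returns the polar form at the dual points, and reproduction is an identity of
  Marsden type. That identity is not derived from a recurrence; it is checked on the splines in
  closed form. The obstacle is that a simplex spline is given through an arbitrary simplex and is
  only piecewise polynomial. Taking the weights of the surplus knots as coordinates removes the
  dependence on the simplex, and writing every case distinction as a truncated power gives one
  formula on the whole triangle, so that reproduction needs no case distinction over the twelve
  subtriangles. Since b1 + b2 + b3 = 1, every polynomial of degree at most d is a form of degree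
  exactly d in the coordinates, which leaves 3, 6 or 10 monomials. In degrees 2 and 3 the two
  orientations of a chord are tied by \<open>pp_minus_power2\<close> and
  \<open>pp_minus_power3\<close>.\<close>

definition cross2 :: "real^2 \<Rightarrow> real^2 \<Rightarrow> real" where
  "cross2 u v = u$1 * v$2 - u$2 * v$1"

text \<open>The coordinate that belongs to the first argument \<open>a\<close>, as a quotient of
  signed areas. Rotating the arguments gives the other two.\<close>

definition bary :: "real^2 \<Rightarrow> real^2 \<Rightarrow> real^2 \<Rightarrow> real^2 \<Rightarrow> real" where
  "bary a b c x = cross2 (b - x) (c - x) / cross2 (b - a) (c - a)"

lemma cross2_rotate: "cross2 (c - b) (a - b) = cross2 (b - a) (c - a)"
  by (simp add: cross2_def algebra_simps)

lemma measure_triangle: "measure lebesgue (convex hull {a, b, c}) = \<bar>cross2 (b - a) (c - a)\<bar> / 2"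
proof -
  have "measure lebesgue (convex hull {a, b, c}) = measure lborel (convex hull {a, b, c})"
    by (intro measure_completion) (auto intro!: borel_compact finite_imp_compact_convex_hull)
  then show ?thesis
    by (simp add: content_triangle cross2_def algebra_simps)
qed

lemma cross2_eq_0_imp_parallel:
  assumes "cross2 u v = 0" "u \<noteq> 0"
  shows "\<exists>r. v = r *\<^sub>R u"
proof (cases "u$1 = 0")
  case True
  then have "u$2 \<noteq> 0" using assms(2) by (auto simp: vec_eq_iff forall_2)
  then show ?thesis using assms(1) True
    by (intro exI[of _ "v$2 / u$2"]) (auto simp: vec_eq_iff forall_2 cross2_def)
next
  case False
  then show ?thesis using assms(1)
    by (intro exI[of _ "v$1 / u$1"]) (auto simp: vec_eq_iff forall_2 cross2_def field_simps)
qed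

lemma cross2_nonzero:
  assumes "\<not> collinear {a, b, c}"
  shows "cross2 (b - a) (c - a) \<noteq> 0"
proof
  assume z: "cross2 (b - a) (c - a) = 0"
  have "b - a \<noteq> 0" using assms by auto
  then obtain r where "c - a = r *\<^sub>R (b - a)"
    using cross2_eq_0_imp_parallel[OF z] by blast
  then have "collinear {0, b - a, c - a}"
    by (metis collinear_lemma)
  then have "collinear {b, a, c}"
    by (simp add: collinear_3)
  then show False using assms by (simp add: insert_commute)
qed

text \<open>With a common denominator the identities below become polynomial identities.\<close>

lemma bary_eqs:
  "bary b c a x = cross2 (c - x) (a - x) / cross2 (b - a) (c - a)"
  "bary c a b x = cross2 (a - x) (b - x) / cross2 (b - a) (c - a)"
  by (simp_all only: bary_def cross2_rotate[of c b a] cross2_rotate[of a c b])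

lemma bary_unique:
  assumes "\<not> collinear {a, b, c}" "x = u *\<^sub>R a + v *\<^sub>R b + w *\<^sub>R c" "u + v + w = 1"
  shows "bary a b c x = u" "bary b c a x = v" "bary c a b x = w"
proof -
  have u: "u = 1 - v - w" using assms(3) by simp
  show "bary a b c x = u" "bary b c a x = v" "bary c a b x = w"
    using cross2_nonzero[OF assms(1)]
    unfolding bary_eqs[where a=a and b=b and c=c] bary_def[of a] assms(2) u cross2_def
    by (simp_all add: divide_simps) (simp_all add: algebra_simps)
qed

lemma bary_sum:
  assumes "\<not> collinear {a, b, c}"
  shows "bary a b c x + bary b c a x + bary c a b x = 1"
  using cross2_nonzero[OF assms] unfolding bary_eqs[where a=a and b=b and c=c] bary_def[of a]
  by (simp add: add_divide_distrib[symmetric]) (simp add: cross2_def algebra_simps)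

lemma bary_combine:
  assumes "\<not> collinear {a, b, c}"
  shows "bary a b c x *\<^sub>R a + bary b c a x *\<^sub>R b + bary c a b x *\<^sub>R c = x"
  using cross2_nonzero[OF assms] unfolding bary_eqs[where a=a and b=b and c=c] bary_def[of a] vec_eq_iff forall_2
  by (simp add: divide_simps) (simp add: cross2_def algebra_simps)

lemma continuous_on_bary [continuous_intros]: "continuous_on S (bary a b c)"
  unfolding bary_def[abs_def] divide_inverse cross2_def[of "_ - _ :: real^2"]
  by (intro continuous_on_mult_right) (intro continuous_intros)

section \<open>Labelling the vertices of a simplex over a multiset of knots\<close>

lemma image_mset_eq_imp_ex_lift:
  assumes "finite J" "image_mset f M = image_mset g (mset_set J)"
  shows "\<exists>h. M = image_mset h (mset_set J) \<and> (\<forall>j\<in>J. f (h j) = g j)"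
  using assms
proof (induction J arbitrary: M rule: finite_induct)
  case (insert x J)
  then have "image_mset f M = add_mset (g x) (image_mset g (mset_set J))" by simp
  then obtain M1 y where y: "M = add_mset y M1" "f y = g x" "image_mset f M1 = image_mset g (mset_set J)"
    by (auto dest!: msed_map_invR)
  then obtain h where h: "M1 = image_mset h (mset_set J)" "\<forall>j\<in>J. f (h j) = g j"
    using insert.IH by blast
  have "image_mset (h(x := y)) (mset_set J) = image_mset h (mset_set J)"
    using insert.hyps by (intro image_mset_cong) auto
  then show ?case
    using h y insert.hyps by (intro exI[of _ "h(x := y)"]) (auto simp add: fun_upd_def cong: if_cong)
qed simp

text \<open>Three vertices above the anchors \<open>a\<close>, \<open>b\<close>, \<open>c\<close>
  are split off and the others are indexed by the type \<open>'d\<close>. Repeated knots make the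
  choice ambiguous, but any choice serves as long as the chosen vertices are distinct.\<close>

lemma simplex_over_vertices:
  fixes k :: "'d::finite \<Rightarrow> real^2" and C :: "((real^2) \<times> (real^'d)) set"
  assumes C: "simplex_over K C" and K: "K = {#a, b, c#} + image_mset k (mset_set UNIV)"
  obtains \<alpha> \<beta> \<gamma> y where "C = {(a, \<alpha>), (b, \<beta>), (c, \<gamma>)} \<union> range (\<lambda>j. (k j, y j))"
    "mset_set C = {#(a, \<alpha>), (b, \<beta>), (c, \<gamma>)#} + image_mset (\<lambda>j. (k j, y j)) (mset_set UNIV)"
    "inj (\<lambda>j. (k j, y j))" "(a, \<alpha>) \<noteq> (b, \<beta>)" "(a, \<alpha>) \<noteq> (c, \<gamma>)" "(b, \<beta>) \<noteq> (c, \<gamma>)"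
    "{(a, \<alpha>), (b, \<beta>), (c, \<gamma>)} \<inter> range (\<lambda>j. (k j, y j)) = {}"
proof -
  have fin: "finite C" and card: "card C = CARD('d) + 3" and img: "image_mset fst (mset_set C) = K"
    using C by (auto simp: simplex_over_def)
  have "image_mset fst (mset_set C) = add_mset a (add_mset b (add_mset c (image_mset k (mset_set UNIV))))"
    using img K by simp
  then obtain A M1 where 1: "mset_set C = add_mset A M1" "fst A = a"
      "image_mset fst M1 = add_mset b (add_mset c (image_mset k (mset_set UNIV)))"
    by (auto dest!: msed_map_invR)
  from 1(3) obtain B M2 where 2: "M1 = add_mset B M2" "fst B = b"
      "image_mset fst M2 = add_mset c (image_mset k (mset_set UNIV))"
    by (auto dest!: msed_map_invR)
  from 2(3) obtain G M3 where 3: "M2 = add_mset G M3" "fst G = c"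
      "image_mset fst M3 = image_mset k (mset_set UNIV)"
    by (auto dest!: msed_map_invR)
  from 3(3) obtain h where h: "M3 = image_mset h (mset_set UNIV)" "\<And>j. fst (h j) = k j"
    using image_mset_eq_imp_ex_lift[of UNIV fst M3 k] by auto
  have eq: "mset_set C = {#A, B, G#} + image_mset h (mset_set UNIV)"
    using 1 2 3 h by simp
  define y where "y = (\<lambda>j. snd (h j))"
  have h_eq: "h = (\<lambda>j. (k j, y j))"
    using h(2) by (auto simp: y_def fun_eq_iff prod_eq_iff)
  have ABG: "A = (a, snd A)" "B = (b, snd B)" "G = (c, snd G)"
    using 1 2 3 by (auto simp: prod_eq_iff)
  have "C = set_mset (mset_set C)" using fin by simp
  also have "\<dots> = {A, B, G} \<union> range h" unfolding eq by auto
  finally have Ceq: "C = {A, B, G} \<union> range h" .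
  \<comment> \<open>The \<open>CARD('d) + 3\<close> elements of \<open>C\<close> leave no room for
    coincidences among the labels: both cardinality bounds are attained and the overlap is
    empty.\<close>
  have "card {A, B, G} + card (range h) = card C + card ({A, B, G} \<inter> range h)"
    unfolding Ceq by (rule card_Un_Int) auto
  moreover have "card {A, B, G} \<le> 3" by (simp add: card_insert_if)
  moreover have "card (range h) \<le> CARD('d)" by (rule card_image_le) simp
  ultimately have c3: "card {A, B, G} = 3" and ch: "card (range h) = CARD('d)"
    and int: "card ({A, B, G} \<inter> range h) = 0" using card by linarith+
  have "inj h" using ch by (intro eq_card_imp_inj_on) auto
  moreover have "{A, B, G} \<inter> range h = {}" using int by (subst (asm) card_eq_0_iff) auto
  moreover have "A \<noteq> B" "A \<noteq> G" "B \<noteq> G" using c3 by (auto simp: card_insert_if split: if_splits)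
  ultimately show ?thesis
    using eq Ceq ABG(1,2,3)[symmetric] that[of "snd A" "snd B" "snd G" y] unfolding h_eq by simp
qed

text \<open>The anchors are placed at height 0 and the remaining knots above the unit vectors. In an
  affine dependence the heights kill the coefficients of the latter, and non-collinearity kills
  those of the anchors.\<close>

lemma simplex_over_exists:
  fixes k :: "'d::finite \<Rightarrow> real^2"
  assumes nc: "\<not> collinear {a, b, c}" and K: "K = {#a, b, c#} + image_mset k (mset_set UNIV)"
  shows "\<exists>C :: ((real^2) \<times> (real^'d)) set. simplex_over K C"
proof -
  have ne: "a \<noteq> b" "a \<noteq> c" "b \<noteq> c" using nc by (auto simp: insert_commute)
  let ?h = "\<lambda>j::'d. (k j, axis j (1::real))"
  let ?A = "(a, 0) :: (real^2) \<times> (real^'d)" and ?B = "(b, 0) :: (real^2) \<times> (real^'d)"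
    and ?G = "(c, 0) :: (real^2) \<times> (real^'d)"
  let ?C = "insert ?A (insert ?B (insert ?G (range ?h)))"
  have inj: "inj ?h" by (auto simp: inj_on_def axis_eq_axis)
  have nin: "?A \<notin> range ?h" "?B \<notin> range ?h" "?G \<notin> range ?h"
    by (auto simp: axis_eq_0_iff dest!: sym[of 0])
  have ms: "mset_set ?C = {#?A, ?B, ?G#} + image_mset ?h (mset_set UNIV)"
    using nin ne inj by (simp add: image_mset_mset_set)
  have "card ?C = CARD('d) + 3" using nin ne inj by (simp add: card_image)
  moreover have "\<not> affine_dependent ?C"
  proof
    assume "affine_dependent ?C"
    have finC: "finite ?C" by simp
    from \<open>affine_dependent ?C\<close> obtain U v where U: "sum U ?C = 0" "v \<in> ?C" "U v \<noteq> 0" "(\<Sum>v\<in>?C. U v *\<^sub>R v) = 0"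
      unfolding affine_dependent_explicit_finite[OF finC] by blast
    have sumC: "sum f ?C = f ?A + f ?B + f ?G + (\<Sum>j\<in>UNIV. f (?h j))"
      for f :: "_ \<Rightarrow> 'm::comm_monoid_add"
      unfolding sum_unfold_sum_mset ms by (simp add: add.assoc image_mset.compositionality comp_def)
    have eq: "U ?A *\<^sub>R ?A + U ?B *\<^sub>R ?B + U ?G *\<^sub>R ?G + (\<Sum>j\<in>UNIV. U (?h j) *\<^sub>R ?h j) = 0"
      using U(4) unfolding sumC .
    have "(\<Sum>j\<in>UNIV. U (?h j) *\<^sub>R axis j (1::real)) = (0 :: real^'d)"
      using arg_cong[OF eq, of snd] by (simp add: snd_sum)
    then have "(\<Sum>j\<in>UNIV. U (?h j) *\<^sub>R axis j (1::real)) $ i = (0 :: real^'d) $ i" for i by simp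
    then have Uh: "U (?h i) = 0" for i
      by (simp add: axis_def if_distrib sum.delta cong: if_cong)
    have s: "U ?A + U ?B + U ?G = 0" using U(1) unfolding sumC by (simp add: Uh)
    have "U ?A *\<^sub>R a + U ?B *\<^sub>R b + U ?G *\<^sub>R c = 0"
      using arg_cong[OF eq, of fst] by (simp add: fst_sum Uh)
    \<comment> \<open>Adding \<open>a\<close> turns the relation of total weight 0 into a second
      representation of \<open>a\<close> with total weight 1.\<close>
    then have "a = (1 + U ?A) *\<^sub>R a + U ?B *\<^sub>R b + U ?G *\<^sub>R c"
      by (simp add: algebra_simps)
    from bary_unique[OF nc this] s
    have "bary a b c a = 1 + U ?A" "bary b c a a = U ?B" "bary c a b a = U ?G" by simp_all
    moreover have "bary a b c a = 1" "bary b c a a = 0" "bary c a b a = 0"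
      using cross2_nonzero[OF nc] unfolding bary_eqs[where a=a and b=b and c=c]
      by (simp_all add: bary_def) (simp_all add: cross2_def)
    ultimately have "U ?A = 0" "U ?B = 0" "U ?G = 0" by simp_all
    with U(2,3) Uh show False by auto
  qed
  ultimately have "simplex_over K ?C"
    unfolding simplex_over_def ms K by (simp add: image_mset.compositionality comp_def)
  then show ?thesis by blast
qed

section \<open>Fibres of a simplex as polytopes\<close>

text \<open>Here \<open>t\<close> lists the weights of the free vertices in a convex combination;
  the slacks of the three inequalities are the weights that remain for the anchors.\<close>

definition cone_polytope :: "('d::finite \<Rightarrow> real) \<Rightarrow> ('d \<Rightarrow> real) \<Rightarrow> ('d \<Rightarrow> real) \<Rightarrow> real \<Rightarrow> real \<Rightarrow> real \<Rightarrow> (real^'d) set" where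
  "cone_polytope ca cb cc u v w = {t. (\<forall>j. 0 \<le> t$j) \<and> (\<Sum>j\<in>UNIV. ca j * t$j) \<le> u \<and>
     (\<Sum>j\<in>UNIV. cb j * t$j) \<le> v \<and> (\<Sum>j\<in>UNIV. cc j * t$j) \<le> w}"

text \<open>Adding the three inequalities bounds the sum of the nonnegative entries by
  \<open>u + v + w\<close>, because each column has sum 1.\<close>

lemma compact_cone_polytope:
  assumes "\<And>j. ca j + cb j + cc j = 1"
  shows "compact (cone_polytope ca cb cc u v w)"
proof -
  have "closed (cone_polytope ca cb cc u v w)"
    unfolding cone_polytope_def
    by (intro closed_Collect_conj closed_Collect_all closed_Collect_le continuous_intros)
  moreover have "cone_polytope ca cb cc u v w \<subseteq> cbox 0 (\<chi> i. u + v + w)"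
  proof
    fix t assume t: "t \<in> cone_polytope ca cb cc u v w"
    have "(\<Sum>j\<in>UNIV. t$j) = (\<Sum>j\<in>UNIV. (ca j + cb j + cc j) * t$j)" using assms by simp
    also have "\<dots> \<le> u + v + w"
      using t by (simp add: cone_polytope_def ring_distribs sum.distrib)
    finally have *: "(\<Sum>j\<in>UNIV. t$j) \<le> u + v + w" .
    have "t$i \<le> (\<Sum>j\<in>UNIV. t$j)" for i
      using t by (intro member_le_sum) (auto simp: cone_polytope_def)
    with * t show "t \<in> cbox 0 (\<chi> i. u + v + w)"
      by (force simp: mem_box_cart cone_polytope_def intro: order_trans)
  qed
  ultimately show ?thesis
    using bounded_cbox bounded_subset compact_eq_bounded_closed by blast
qed

text \<open>In a convex combination with first component \<open>x\<close> the weights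
  \<open>t\<close> of the free vertices determine the anchor weights, by comparison of barycentric
  coordinates. The second component is thus an affine function of \<open>t\<close> whose linear part
  \<open>L\<close> does not depend on \<open>x\<close>; a nonzero kernel vector of \<open>L\<close>
  would be an affine dependence of the vertices.\<close>

lemma simplex_fibre:
  fixes k :: "'d::finite \<Rightarrow> real^2" and C :: "((real^2) \<times> (real^'d)) set"
  assumes nc: "\<not> collinear {a, b, c}"
    and K: "K = {#a, b, c#} + image_mset k (mset_set UNIV)"
    and k: "\<And>j. k j = ca j *\<^sub>R a + cb j *\<^sub>R b + cc j *\<^sub>R c" "\<And>j. ca j + cb j + cc j = 1"
    and C: "simplex_over K C"
  obtains v L where "linear L" "inj L"
    "\<And>x. {y. (x, y) \<in> convex hull C} =
       (\<lambda>t. v x + L t) ` cone_polytope ca cb cc (bary a b c x) (bary b c a x) (bary c a b x)"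
proof -
  obtain \<alpha> \<beta> \<gamma> y where Ceq: "C = {(a, \<alpha>), (b, \<beta>), (c, \<gamma>)} \<union> range (\<lambda>j. (k j, y j))"
    and ms: "mset_set C = {#(a, \<alpha>), (b, \<beta>), (c, \<gamma>)#} + image_mset (\<lambda>j. (k j, y j)) (mset_set UNIV)"
    and inj: "inj (\<lambda>j. (k j, y j))"
    and ne: "(a, \<alpha>) \<noteq> (b, \<beta>)" "(a, \<alpha>) \<noteq> (c, \<gamma>)" "(b, \<beta>) \<noteq> (c, \<gamma>)"
      "{(a, \<alpha>), (b, \<beta>), (c, \<gamma>)} \<inter> range (\<lambda>j. (k j, y j)) = {}"
    by (rule simplex_over_vertices[OF C K]) blast
  define h where "h = (\<lambda>j. (k j, y j))"
  have fin: "finite C" and indep: "\<not> affine_dependent C"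
    using C by (auto simp: simplex_over_def)
  have sumC: "sum f C = f (a, \<alpha>) + f (b, \<beta>) + f (c, \<gamma>) + (\<Sum>j\<in>UNIV. f (h j))"
    for f :: "_ \<Rightarrow> 'm::comm_monoid_add"
    unfolding sum_unfold_sum_mset ms h_def
    by (simp add: add.assoc image_mset.compositionality comp_def)
  \<comment> \<open>The labelled vertices are distinct, so weights can be prescribed label by
    label.\<close>
  have weights: "\<exists>U. U (a, \<alpha>) = ta \<and> U (b, \<beta>) = tb \<and> U (c, \<gamma>) = tc \<and> (\<forall>j. U (h j) = t$j)"
    for ta tb tc :: real and t :: "real^'d"
  proof -
    have "h j \<noteq> (a, \<alpha>)" "h j \<noteq> (b, \<beta>)" "h j \<noteq> (c, \<gamma>)" for j
      using ne(4) unfolding h_def by blast+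
    moreover have "inv h (h j) = j" for j
      using inj by (simp add: h_def[symmetric])
    ultimately show ?thesis using ne(1-3) ne(1-3)[symmetric]
      by (intro exI[of _ "\<lambda>p. if p = (a, \<alpha>) then ta else if p = (b, \<beta>) then tb
            else if p = (c, \<gamma>) then tc else t$(inv h p)"]) (simp only: if_True if_False simp_thms)
  qed
  \<comment> \<open>\<open>L\<close> sends the j-th unit vector to the displacement of the free
    vertex from the plane through the three anchor vertices; \<open>v x\<close> is the second
    component of the point of that plane over \<open>x\<close>.\<close>
  define L where "L = (\<lambda>t::real^'d. \<Sum>j\<in>UNIV. t$j *\<^sub>R (y j - ca j *\<^sub>R \<alpha> - cb j *\<^sub>R \<beta> - cc j *\<^sub>R \<gamma>))"
  define v where "v = (\<lambda>x. bary a b c x *\<^sub>R \<alpha> + bary b c a x *\<^sub>R \<beta> + bary c a b x *\<^sub>R \<gamma>)"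
  have L_eq: "L t = (\<Sum>j\<in>UNIV. t$j *\<^sub>R y j) - (\<Sum>j\<in>UNIV. ca j * t$j) *\<^sub>R \<alpha>
      - (\<Sum>j\<in>UNIV. cb j * t$j) *\<^sub>R \<beta> - (\<Sum>j\<in>UNIV. cc j * t$j) *\<^sub>R \<gamma>" for t
    by (simp add: L_def algebra_simps sum.distrib sum_subtractf scaleR_sum_left)
  have y_eq: "(\<Sum>j\<in>UNIV. t$j *\<^sub>R y j) = L t + (\<Sum>j\<in>UNIV. ca j * t$j) *\<^sub>R \<alpha>
      + (\<Sum>j\<in>UNIV. cb j * t$j) *\<^sub>R \<beta> + (\<Sum>j\<in>UNIV. cc j * t$j) *\<^sub>R \<gamma>" for t
    by (simp add: L_eq)
  have k_eq: "(\<Sum>j\<in>UNIV. t$j *\<^sub>R k j) = (\<Sum>j\<in>UNIV. ca j * t$j) *\<^sub>R a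
      + (\<Sum>j\<in>UNIV. cb j * t$j) *\<^sub>R b + (\<Sum>j\<in>UNIV. cc j * t$j) *\<^sub>R c" for t :: "real^'d"
    unfolding k(1) by (simp add: algebra_simps sum.distrib scaleR_sum_left)
  have t_eq: "(\<Sum>j\<in>UNIV. ca j * t$j) + (\<Sum>j\<in>UNIV. cb j * t$j) + (\<Sum>j\<in>UNIV. cc j * t$j)
      = (\<Sum>j\<in>UNIV. t$j)" for t :: "real^'d"
    unfolding sum.distrib[symmetric] by (simp add: k(2) flip: distrib_right)
  have lin: "linear L"
    unfolding L_def
    by (rule linearI) (simp_all add: scaleR_add_left sum.distrib scaleR_sum_right)
  have "inj L"
    unfolding linear_injective_0[OF lin]
  proof (intro allI impI)
    fix t assume "L t = 0"
    \<comment> \<open>The anchor coefficients are chosen to cancel both the total weight and the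
      projection to the plane.\<close>
    obtain U where U: "U (a, \<alpha>) = - (\<Sum>j\<in>UNIV. ca j * t$j)" "U (b, \<beta>) = - (\<Sum>j\<in>UNIV. cb j * t$j)"
      "U (c, \<gamma>) = - (\<Sum>j\<in>UNIV. cc j * t$j)" "\<And>j. U (h j) = t$j"
      using weights[of "- (\<Sum>j\<in>UNIV. ca j * t$j)" "- (\<Sum>j\<in>UNIV. cb j * t$j)"
          "- (\<Sum>j\<in>UNIV. cc j * t$j)" t] by blast
    have "sum U C = 0" unfolding sumC U using t_eq[of t] by simp
    moreover have "(\<Sum>p\<in>C. U p *\<^sub>R p) = 0"
      unfolding sumC U prod_eq_iff using \<open>L t = 0\<close>
      by (simp add: fst_sum snd_sum h_def k_eq y_eq)
    ultimately have "\<forall>p\<in>C. U p = 0"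
      using indep unfolding affine_dependent_explicit_finite[OF fin] by blast
    then have "t$j = 0" for j using U(4)[of j] by (auto simp: Ceq h_def)
    then show "t = 0" by (simp add: vec_eq_iff)
  qed
  moreover have "{z. (x, z) \<in> convex hull C} =
       (\<lambda>t. v x + L t) ` cone_polytope ca cb cc (bary a b c x) (bary b c a x) (bary c a b x)" for x
  proof (intro set_eqI iffI)
    fix z assume "z \<in> {z. (x, z) \<in> convex hull C}"
    then obtain U where U: "\<forall>p\<in>C. 0 \<le> U p" "sum U C = 1" "(\<Sum>p\<in>C. U p *\<^sub>R p) = (x, z)"
      by (auto simp: convex_hull_finite[OF fin])
    define t where "t = (\<chi> j. U (h j))"
    have tj: "U (h j) = t$j" for j by (simp add: t_def)
    have xz: "U (a, \<alpha>) *\<^sub>R (a, \<alpha>) + U (b, \<beta>) *\<^sub>R (b, \<beta>) + U (c, \<gamma>) *\<^sub>R (c, \<gamma>)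
        + (\<Sum>j\<in>UNIV. t$j *\<^sub>R h j) = (x, z)"
      using U(3) unfolding sumC tj .
    have x: "x = (U (a, \<alpha>) + (\<Sum>j\<in>UNIV. ca j * t$j)) *\<^sub>R a + (U (b, \<beta>) + (\<Sum>j\<in>UNIV. cb j * t$j)) *\<^sub>R b
        + (U (c, \<gamma>) + (\<Sum>j\<in>UNIV. cc j * t$j)) *\<^sub>R c"
      using arg_cong[OF xz, of fst, symmetric] by (simp add: fst_sum h_def k_eq algebra_simps)
    have s: "(U (a, \<alpha>) + (\<Sum>j\<in>UNIV. ca j * t$j)) + (U (b, \<beta>) + (\<Sum>j\<in>UNIV. cb j * t$j))
        + (U (c, \<gamma>) + (\<Sum>j\<in>UNIV. cc j * t$j)) = 1"
      using U(2) t_eq[of t] unfolding sumC tj by linarith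
    have bx: "bary a b c x = U (a, \<alpha>) + (\<Sum>j\<in>UNIV. ca j * t$j)"
      "bary b c a x = U (b, \<beta>) + (\<Sum>j\<in>UNIV. cb j * t$j)"
      "bary c a b x = U (c, \<gamma>) + (\<Sum>j\<in>UNIV. cc j * t$j)"
      using bary_unique[OF nc x s] by simp_all
    have "t \<in> cone_polytope ca cb cc (bary a b c x) (bary b c a x) (bary c a b x)"
      using U(1) unfolding bx cone_polytope_def by (auto simp: Ceq t_def h_def)
    moreover have "z = v x + L t"
      using arg_cong[OF xz, of snd, symmetric] unfolding v_def bx
      by (simp add: snd_sum h_def y_eq algebra_simps)
    ultimately show "z \<in> (\<lambda>t. v x + L t) ` cone_polytope ca cb cc (bary a b c x) (bary b c a x) (bary c a b x)"
      by blast
  next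
    fix z assume "z \<in> (\<lambda>t. v x + L t) ` cone_polytope ca cb cc (bary a b c x) (bary b c a x) (bary c a b x)"
    then obtain t where t: "z = v x + L t" "\<And>j. 0 \<le> t$j" "(\<Sum>j\<in>UNIV. ca j * t$j) \<le> bary a b c x"
      "(\<Sum>j\<in>UNIV. cb j * t$j) \<le> bary b c a x" "(\<Sum>j\<in>UNIV. cc j * t$j) \<le> bary c a b x"
      by (auto simp: cone_polytope_def)
    obtain U where U: "U (a, \<alpha>) = bary a b c x - (\<Sum>j\<in>UNIV. ca j * t$j)"
      "U (b, \<beta>) = bary b c a x - (\<Sum>j\<in>UNIV. cb j * t$j)"
      "U (c, \<gamma>) = bary c a b x - (\<Sum>j\<in>UNIV. cc j * t$j)" "\<And>j. U (h j) = t$j"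
      using weights[of "bary a b c x - (\<Sum>j\<in>UNIV. ca j * t$j)" "bary b c a x - (\<Sum>j\<in>UNIV. cb j * t$j)"
          "bary c a b x - (\<Sum>j\<in>UNIV. cc j * t$j)" t] by blast
    have "\<forall>p\<in>C. 0 \<le> U p" using t U(1-3) U(4)[unfolded h_def] by (auto simp: Ceq)
    moreover have "sum U C = 1"
      unfolding sumC U using t_eq[of t] bary_sum[OF nc, of x] by simp
    moreover have "(\<Sum>p\<in>C. U p *\<^sub>R p) = (x, z)"
      unfolding sumC U prod_eq_iff using bary_combine[OF nc, of x]
      by (simp add: fst_sum snd_sum h_def t(1) k_eq y_eq v_def algebra_simps)
    ultimately show "z \<in> {z. (x, z) \<in> convex hull C}"
      unfolding convex_hull_finite[OF fin] by blast
  qed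
  ultimately show ?thesis using that lin by blast
qed

section \<open>Fibre integration and the volume of a simplex\<close>

text \<open>The passage between \<open>measure lebesgue\<close>, in which the splines are defined,
  and \<open>lborel\<close>, in which fibres are integrated.\<close>

lemma emeasure_lborel_compact:
  fixes T :: "'a::euclidean_space set"
  assumes "compact T"
  shows "emeasure lborel T = ennreal (measure lebesgue T)"
proof -
  have "T \<in> sets borel" using assms by (rule borel_compact)
  then have "measure lebesgue T = measure lborel T" by (intro measure_completion) simp
  then show ?thesis
    using emeasure_compact_finite[OF assms] by (simp add: emeasure_eq_ennreal_measure)
qed

lemma linear_image_emeasure:
  fixes L :: "real^'n::{finite,wellorder} \<Rightarrow> real^'n::_"
  assumes "linear L" "compact S"
  shows "emeasure lborel ((\<lambda>t. v + L t) ` S) = ennreal \<bar>det (matrix L)\<bar> * emeasure lborel S"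
proof -
  have cL: "compact (L ` S)"
    by (intro compact_continuous_image assms linear_continuous_on)
      (simp add: assms(1) linear_conv_bounded_linear[symmetric])
  have cL': "compact ((+) v ` L ` S)" by (rule compact_translation[OF cL])
  have "measure lebesgue ((+) v ` L ` S) = \<bar>det (matrix L)\<bar> * measure lebesgue S"
    using measure_linear_image[OF assms(1) lmeasurable_compact[OF assms(2)]]
    by (simp add: measure_translation)
  then have "emeasure lborel ((+) v ` L ` S) = ennreal \<bar>det (matrix L)\<bar> * emeasure lborel S"
    using emeasure_lborel_compact[OF cL'] emeasure_lborel_compact[OF assms(2)] by (simp add: ennreal_mult)
  then show ?thesis by (simp add: image_image)
qed

text \<open>Tonelli's theorem in both orders. Fibres over the first component connect the simplex
  with the polytopes; fibres over the second one evaluate the resulting volume.\<close>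

lemma emeasure_lborel_fibre:
  fixes S :: "('a::euclidean_space \<times> 'b::euclidean_space) set"
  assumes "closed S"
  shows "emeasure lborel S = (\<integral>\<^sup>+x. emeasure lborel {y. (x, y) \<in> S} \<partial>lborel)"
    and "emeasure lborel S = (\<integral>\<^sup>+y. emeasure lborel {x. (x, y) \<in> S} \<partial>lborel)"
proof -
  have S: "S \<in> sets (lborel \<Otimes>\<^sub>M lborel)"
    unfolding lborel_prod using assms by simp
  show "emeasure lborel S = (\<integral>\<^sup>+x. emeasure lborel {y. (x, y) \<in> S} \<partial>lborel)"
    using lborel.emeasure_pair_measure_alt[OF S] by (simp add: lborel_prod vimage_def)
  show "emeasure lborel S = (\<integral>\<^sup>+y. emeasure lborel {x. (x, y) \<in> S} \<partial>lborel)"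
    using lborel_pair.emeasure_pair_measure_alt2[OF S] by (simp add: lborel_prod vimage_def)
qed

lemma emeasure_corner_simplex:
  "emeasure lborel ({(u, t). 0 \<le> u$1 \<and> 0 \<le> u$2 \<and> (\<forall>j. 0 \<le> t$j) \<and>
      u$1 + u$2 + (\<Sum>j\<in>UNIV. t$j) \<le> 1} :: ((real^2) \<times> (real^'d::finite)) set)
    = ennreal (1 / fact (CARD('d) + 2))" (is "emeasure lborel ?S = _")
proof -
  have B: "(Basis :: (real^'n::finite) set) = range (\<lambda>i. axis i (1::real))"
    by (auto simp: Basis_vec_def)
  have sumB: "sum f Basis = (\<Sum>i\<in>UNIV. f (axis i 1))" for f :: "real^'n::finite \<Rightarrow> real"
    unfolding B by (subst sum.reindex) (auto simp: inj_on_def axis_eq_axis)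
  have "x \<in> ?S \<longleftrightarrow> (\<forall>i\<in>Basis. 0 \<le> x \<bullet> i) \<and> sum ((\<bullet>) x) Basis \<le> 1" for x
  proof -
    obtain u t where x: "x = (u, t)" by force
    have "sum ((\<bullet>) x) Basis = (\<Sum>i\<in>Basis. u \<bullet> i) + (\<Sum>i\<in>Basis. t \<bullet> i)"
      unfolding Basis_prod_def x
      by (subst sum.union_disjoint) (auto simp: sum.reindex inj_on_def)
    also have "\<dots> = u$1 + u$2 + (\<Sum>j\<in>UNIV. t$j)"
      by (simp add: sumB inner_axis sum_2)
    finally have s: "sum ((\<bullet>) x) Basis = u$1 + u$2 + (\<Sum>j\<in>UNIV. t$j)" .
    have "(\<forall>i\<in>Basis. 0 \<le> x \<bullet> i) \<longleftrightarrow> (\<forall>i. 0 \<le> u$i) \<and> (\<forall>j. 0 \<le> t$j)"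
      unfolding Basis_prod_def x by (simp add: ball_Un B inner_axis)
    then show ?thesis unfolding s by (auto simp: x forall_2)
  qed
  then have "?S = convex hull (insert 0 Basis)"
    unfolding std_simplex by auto
  then show ?thesis by (simp add: emeasure_std_simplex)
qed

text \<open>For fixed \<open>t\<close> the last two coordinates of \<open>x\<close> are shifted by
  the loads of \<open>t\<close>. As the columns have sum 1, the first inequality then says that
  \<open>u$1\<close>, \<open>u$2\<close> and the entries of \<open>t\<close> add up to at most 1, so
  the fibre is an affine image of a fibre of the standard simplex. Only the constant Jacobian of
  \<open>M\<close> remains.\<close>

lemma emeasure_affine_corner:
  fixes a b c :: "real^2"
  assumes nc: "\<not> collinear {a, b, c}"
    and k: "\<And>j. ca j + cb j + cc j = 1"
  shows "emeasure lborel ({(x, t).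
      t \<in> cone_polytope ca cb cc (bary a b c x) (bary b c a x) (bary c a b x)} :: ((real^2) \<times> (real^'d::finite)) set)
    = ennreal (\<bar>cross2 (b - a) (c - a)\<bar> / fact (CARD('d) + 2))" (is "emeasure lborel ?T = _")
proof -
  let ?S = "{(u, t). 0 \<le> u$1 \<and> 0 \<le> u$2 \<and> (\<forall>j. 0 \<le> t$j) \<and>
      u$1 + u$2 + (\<Sum>j\<in>UNIV. t$j) \<le> 1} :: ((real^2) \<times> (real^'d)) set"
  define M where "M = (\<lambda>u::real^2. u$1 *\<^sub>R (b - a) + u$2 *\<^sub>R (c - a))"
  have linM: "linear M"
    unfolding M_def by (intro linearI) (auto simp: algebra_simps)
  have detM: "\<bar>det (matrix M)\<bar> = \<bar>cross2 (b - a) (c - a)\<bar>"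
    by (simp add: det_2 matrix_def M_def cross2_def axis_def algebra_simps)
  have closed_S: "closed ?S"
    unfolding case_prod_unfold
    by (intro closed_Collect_conj closed_Collect_all closed_Collect_le continuous_intros)
  have closed_T: "closed ?T"
    unfolding case_prod_unfold cone_polytope_def mem_Collect_eq
    by (intro closed_Collect_conj closed_Collect_all closed_Collect_le continuous_intros
        continuous_on_compose2[OF continuous_on_bary[of UNIV]]) auto
  have fibre: "{x. (x, t) \<in> ?T} = (\<lambda>u. (a + (\<Sum>j\<in>UNIV. cb j * t$j) *\<^sub>R (b - a)
      + (\<Sum>j\<in>UNIV. cc j * t$j) *\<^sub>R (c - a)) + M u) ` {u. (u, t) \<in> ?S}" (is "_ = ?f ` _") for t
  proof -
    have t_eq: "(\<Sum>j\<in>UNIV. ca j * t$j) + (\<Sum>j\<in>UNIV. cb j * t$j) + (\<Sum>j\<in>UNIV. cc j * t$j)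
        = (\<Sum>j\<in>UNIV. t$j)"
      unfolding sum.distrib[symmetric] by (simp add: k flip: distrib_right)
    have b: "bary b c a (?f u) = u$1 + (\<Sum>j\<in>UNIV. cb j * t$j)"
      "bary c a b (?f u) = u$2 + (\<Sum>j\<in>UNIV. cc j * t$j)" for u
    proof -
      have "?f u = (1 - u$1 - (\<Sum>j\<in>UNIV. cb j * t$j) - u$2 - (\<Sum>j\<in>UNIV. cc j * t$j)) *\<^sub>R a
          + (u$1 + (\<Sum>j\<in>UNIV. cb j * t$j)) *\<^sub>R b + (u$2 + (\<Sum>j\<in>UNIV. cc j * t$j)) *\<^sub>R c"
        by (simp add: M_def algebra_simps)
      from bary_unique[OF nc this] show "bary b c a (?f u) = u$1 + (\<Sum>j\<in>UNIV. cb j * t$j)"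
        "bary c a b (?f u) = u$2 + (\<Sum>j\<in>UNIV. cc j * t$j)" by simp_all
    qed
    have ba: "bary a b c x = 1 - bary b c a x - bary c a b x" for x
      using bary_sum[OF nc, of x] by simp
    have inT: "(?f u, t) \<in> ?T \<longleftrightarrow> (u, t) \<in> ?S" for u
      unfolding mem_Collect_eq case_prod_conv cone_polytope_def ba b using t_eq by auto
    have "\<exists>u. x = ?f u" for x
    proof -
      let ?u = "vector [bary b c a x - (\<Sum>j\<in>UNIV. cb j * t$j), bary c a b x - (\<Sum>j\<in>UNIV. cc j * t$j)] :: real^2"
      have "?f ?u = (1 - bary b c a x - bary c a b x) *\<^sub>R a + bary b c a x *\<^sub>R b + bary c a b x *\<^sub>R c"
        by (simp add: M_def algebra_simps)
      also have "\<dots> = x" using bary_combine[OF nc, of x] by (simp add: ba)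
      finally have "?f ?u = x" .
      from this[symmetric] show ?thesis by (rule exI)
    qed
    then show ?thesis
    proof (intro set_eqI iffI)
      fix x assume x: "x \<in> {x. (x, t) \<in> ?T}"
      obtain u where u: "x = ?f u" using \<open>\<And>x. \<exists>u. x = ?f u\<close> by blast
      with x inT[of u] show "x \<in> ?f ` {u. (u, t) \<in> ?S}" by blast
    next
      fix x assume "x \<in> ?f ` {u. (u, t) \<in> ?S}"
      with inT show "x \<in> {x. (x, t) \<in> ?T}" by blast
    qed
  qed
  have compact: "compact {u. (u, t) \<in> ?S}" for t :: "real^'d"
  proof -
    have "closed {u. (u, t) \<in> ?S}"
      unfolding mem_Collect_eq case_prod_conv
      by (intro closed_Collect_conj closed_Collect_all closed_Collect_le continuous_intros)
    moreover have "{u. (u, t) \<in> ?S} \<subseteq> cbox 0 (vector [1, 1])"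
      by (auto simp: mem_box_cart forall_2 intro: sum_nonneg) 
        (smt (verit) sum_nonneg)+
    ultimately show ?thesis
      using bounded_cbox bounded_subset compact_eq_bounded_closed by blast
  qed
  have "emeasure lborel ?T = (\<integral>\<^sup>+t. emeasure lborel {x. (x, t) \<in> ?T} \<partial>lborel)"
    by (rule emeasure_lborel_fibre(2)[OF closed_T])
  also have "\<dots> = (\<integral>\<^sup>+t. ennreal \<bar>cross2 (b - a) (c - a)\<bar> * emeasure lborel {u. (u, t) \<in> ?S} \<partial>lborel)"
    unfolding fibre linear_image_emeasure[OF linM compact] detM ..
  also have "\<dots> = ennreal \<bar>cross2 (b - a) (c - a)\<bar> * (\<integral>\<^sup>+t. emeasure lborel {u. (u, t) \<in> ?S} \<partial>lborel)"
  proof (rule nn_integral_cmult)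
    have "?S \<in> sets (lborel \<Otimes>\<^sub>M lborel)"
      unfolding lborel_prod using closed_S by simp
    from lborel_pair.measurable_emeasure_Pair2[OF this]
    show "(\<lambda>t. emeasure lborel {u. (u, t) \<in> ?S}) \<in> borel_measurable lborel"
      by (simp add: vimage_def)
  qed
  also have "(\<integral>\<^sup>+t. emeasure lborel {u. (u, t) \<in> ?S} \<partial>lborel) = ennreal (1 / fact (CARD('d) + 2))"
    unfolding emeasure_lborel_fibre(2)[OF closed_S, symmetric] by (rule emeasure_corner_simplex)
  finally show ?thesis by (simp add: ennreal_mult[symmetric])
qed

text \<open>Each fibre has \<open>D\<close> times the volume of its polytope, and integration over
  \<open>x\<close> shows that the volume of the simplex contains the same factor. In the quotient
  \<open>D\<close> cancels, (d + 2)! divided by the binomial coefficient leaves 2 * d!, and the 2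
  turns the cross product in the denominator into an area.\<close>

theorem simplex_spline_eq_measure:
  fixes k :: "'d::{finite,wellorder} \<Rightarrow> real^2"
  assumes nc: "\<not> collinear {a, b, c}"
    and K: "K = {#a, b, c#} + image_mset k (mset_set UNIV)"
    and k: "\<And>j. k j = ca j *\<^sub>R a + cb j *\<^sub>R b + cc j *\<^sub>R c" "\<And>j. ca j + cb j + cc j = 1"
    and x: "x = u *\<^sub>R a + v *\<^sub>R b + w *\<^sub>R c" "u + v + w = 1"
  shows "simplex_spline TYPE('d) A K x =
    fact CARD('d) * (A / measure lebesgue (convex hull {a, b, c})) *
      measure lebesgue (cone_polytope ca cb cc u v w)"
proof -
  let ?P = "\<lambda>x. cone_polytope ca cb cc (bary a b c x) (bary b c a x) (bary c a b x)"
  define C where "C = (SOME C :: ((real^2) \<times> (real^'d::_)) set. simplex_over K C)"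
  have C: "simplex_over K C"
    unfolding C_def using simplex_over_exists[OF nc K] by (rule someI_ex)
  obtain s L where L: "linear L" "inj L"
    and fibre: "\<And>x. {y. (x, y) \<in> convex hull C} = (\<lambda>t. s x + L t) ` ?P x"
    by (rule simplex_fibre[OF nc K k C]) blast
  define D where "D = \<bar>det (matrix L)\<bar>"
  have "D > 0"
    using L det_nz_iff_inj[OF L(1)] by (simp add: D_def)
  have compact_P: "compact (?P x)" for x
    by (rule compact_cone_polytope[OF k(2)])
  have compact_C: "compact (convex hull C)"
    using C by (simp add: simplex_over_def finite_imp_compact_convex_hull)
  have cross: "cross2 (b - a) (c - a) \<noteq> 0" by (rule cross2_nonzero[OF nc])
  have fib: "emeasure lborel {y. (x, y) \<in> convex hull C} = ennreal D * emeasure lborel (?P x)" for x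
    unfolding fibre D_def by (rule linear_image_emeasure[OF L(1) compact_P])
  have closed_T: "closed {(x, t). t \<in> ?P x}"
    unfolding case_prod_unfold cone_polytope_def mem_Collect_eq
    by (intro closed_Collect_conj closed_Collect_all closed_Collect_le continuous_intros
        continuous_on_compose2[OF continuous_on_bary[of UNIV]]) auto
  have "emeasure lborel (convex hull C) = (\<integral>\<^sup>+x. emeasure lborel {y. (x, y) \<in> convex hull C} \<partial>lborel)"
    by (rule emeasure_lborel_fibre(1)[OF compact_imp_closed[OF compact_C]])
  also have "\<dots> = (\<integral>\<^sup>+x. ennreal D * emeasure lborel {t. (x, t) \<in> {(x, t). t \<in> ?P x}} \<partial>lborel)"
    unfolding fib by simp
  also have "\<dots> = ennreal D * (\<integral>\<^sup>+x. emeasure lborel {t. (x, t) \<in> {(x, t). t \<in> ?P x}} \<partial>lborel)"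
  proof (rule nn_integral_cmult)
    have "{(x, t). t \<in> ?P x} \<in> sets (lborel \<Otimes>\<^sub>M lborel)"
      unfolding lborel_prod using closed_T by simp
    from lborel.measurable_emeasure_Pair[OF this]
    show "(\<lambda>x. emeasure lborel {t. (x, t) \<in> {(x, t). t \<in> ?P x}}) \<in> borel_measurable lborel"
      by (simp add: vimage_def)
  qed
  also have "(\<integral>\<^sup>+x. emeasure lborel {t. (x, t) \<in> {(x, t). t \<in> ?P x}} \<partial>lborel)
      = emeasure lborel {(x, t). t \<in> ?P x}"
    by (rule emeasure_lborel_fibre(1)[OF closed_T, symmetric])
  also have "\<dots> = ennreal (\<bar>cross2 (b - a) (c - a)\<bar> / fact (CARD('d) + 2))"
    by (rule emeasure_affine_corner[OF nc k(2)])
  finally have vol: "measure lebesgue (convex hull C) = D * (\<bar>cross2 (b - a) (c - a)\<bar> / fact (CARD('d) + 2))"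
    using \<open>D > 0\<close> unfolding emeasure_lborel_compact[OF compact_C]
    by (simp add: ennreal_mult[symmetric] del: times_divide_eq_right)
  have "compact {y. (x, y) \<in> convex hull C}"
    unfolding fibre using L(1) compact_P
    by (intro compact_continuous_image continuous_intros linear_continuous_on)
       (simp_all add: linear_conv_bounded_linear[symmetric])
  from emeasure_lborel_compact[OF this]
  have fibx: "measure lebesgue {y. (x, y) \<in> convex hull C} = D * measure lebesgue (cone_polytope ca cb cc u v w)"
    using \<open>D > 0\<close> unfolding fib bary_unique[OF nc x] emeasure_lborel_compact[OF compact_cone_polytope[OF k(2)]]
    by (simp add: ennreal_mult[symmetric])
  have fct: "fact (CARD('d) + 2) = real (CARD('d) + 2) * real (CARD('d) + 1) * fact CARD('d)"
    by simp
  have chs: "real ((CARD('d) + 2) choose 2) = real (CARD('d) + 2) * real (CARD('d) + 1) / 2"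
    using times_binomial_minus1_eq[of 2 "CARD('d) + 2"]
    by (simp add: field_simps flip: of_nat_mult of_nat_add of_nat_Suc)
  have "real (CARD('d) + 2) \<noteq> 0" "real (CARD('d) + 1) \<noteq> 0" by simp_all
  then show ?thesis
    unfolding simplex_spline_def C_def[symmetric] Let_def fibx vol measure_triangle fct chs
    using \<open>D > 0\<close> cross by (simp add: divide_simps del: of_nat_add)
qed

section \<open>Volumes of polytopes in dimensions two and three\<close>

definition pp :: "real \<Rightarrow> real" where
  "pp y = max 0 y"

lemma pp_pos [simp]: "0 \<le> y \<Longrightarrow> pp y = y"
  and pp_neg [simp]: "y \<le> 0 \<Longrightarrow> pp y = 0"
  and pp_nonneg [simp]: "0 \<le> pp y"
  by (auto simp: pp_def)

lemma continuous_on_pp [continuous_intros]: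
  "continuous_on S f \<Longrightarrow> continuous_on S (\<lambda>x. pp (f x))"
  unfolding pp_def by (intro continuous_intros)

text \<open>The exponent is at least 2, so at the kink the difference quotient is bounded by a
  positive power of the increment and tends to 0.\<close>

lemma DERIV_pp_power: "DERIV (\<lambda>y. pp y ^ Suc (Suc n)) x :> real (Suc (Suc n)) * pp x ^ Suc n"
proof -
  consider "x < 0" | "x = 0" | "0 < x" by linarith
  then show ?thesis
  proof cases
    case 1
    have d: "DERIV (\<lambda>y. 0) x :> real (Suc (Suc n)) * pp x ^ Suc n"
      using 1 by simp
    have e: "\<forall>\<^sub>F y in nhds x. pp y ^ Suc (Suc n) = 0"
      using 1 by (auto simp: eventually_nhds intro!: exI[of _ "{..<0}"])
    show ?thesis by (rule DERIV_cong_ev[OF refl e refl, THEN iffD2, OF d])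
  next
    case 2
    have "(\<lambda>h. (pp (0 + h) ^ Suc (Suc n) - pp 0 ^ Suc (Suc n)) / h) \<midarrow>0\<rightarrow> 0"
    proof (rule Lim_null_comparison)
      show "\<forall>\<^sub>F h in at 0. norm ((pp (0 + h) ^ Suc (Suc n) - pp 0 ^ Suc (Suc n)) / h) \<le> \<bar>h\<bar> ^ Suc n"
      proof (rule eventually_at_filter[THEN iffD2], intro always_eventually allI impI)
        fix h :: real assume "h \<noteq> 0"
        show "norm ((pp (0 + h) ^ Suc (Suc n) - pp 0 ^ Suc (Suc n)) / h) \<le> \<bar>h\<bar> ^ Suc n"
        proof (cases "0 \<le> h")
          case True
          then show ?thesis using \<open>h \<noteq> 0\<close> by simp
        next
          case False
          then have "norm ((pp (0 + h) ^ Suc (Suc n) - pp 0 ^ Suc (Suc n)) / h) = 0" by simp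
          also have "\<dots> \<le> \<bar>h\<bar> ^ Suc n" by (rule zero_le_power) simp
          finally show ?thesis .
        qed
      qed
      have "(\<lambda>h::real. \<bar>h\<bar> ^ Suc n) \<midarrow>0\<rightarrow> \<bar>0\<bar> ^ Suc n" by (intro tendsto_intros)
      then show "(\<lambda>h::real. \<bar>h\<bar> ^ Suc n) \<midarrow>0\<rightarrow> 0" by simp
    qed
    then show ?thesis using 2 by (simp add: DERIV_def)
  next
    case 3
    have "DERIV (\<lambda>y. y ^ Suc (Suc n)) x :> real (Suc (Suc n)) * x ^ Suc n"
      using DERIV_pow[of "Suc (Suc n)" x] by simp
    then have d: "DERIV (\<lambda>y. y ^ Suc (Suc n)) x :> real (Suc (Suc n)) * pp x ^ Suc n"
      using 3 by simp
    have e: "\<forall>\<^sub>F y in nhds x. pp y ^ Suc (Suc n) = y ^ Suc (Suc n)"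
      using 3 by (auto simp: eventually_nhds intro!: exI[of _ "{0<..}"])
    show ?thesis by (rule DERIV_cong_ev[OF refl e refl, THEN iffD2, OF d])
  qed
qed

lemma DERIV_pp_power2 [derivative_intros]:
  "DERIV g x :> g' \<Longrightarrow> DERIV (\<lambda>x. pp (g x) ^ 2) x :> 2 * pp (g x) * g'"
  using DERIV_chain2[of "\<lambda>y. pp y ^ 2"] DERIV_pp_power[of 0 "g x"]
  by (simp add: numeral_2_eq_2)

lemma DERIV_pp_power3 [derivative_intros]:
  "DERIV g x :> g' \<Longrightarrow> DERIV (\<lambda>x. pp (g x) ^ 3) x :> 3 * pp (g x) ^ 2 * g'"
  using DERIV_chain2[of "\<lambda>y. pp y ^ 3"] DERIV_pp_power[of 1 "g x"]
  by (simp add: numeral_3_eq_3 numeral_2_eq_2)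

section \<open>Slicing the plane and the space along the first coordinate\<close>

definition vec2 :: "real \<Rightarrow> real \<Rightarrow> real^2" where
  "vec2 s r = (\<chi> i. if i = 1 then s else r)"

text \<open>The last two coordinates are kept together as a vector of \<open>real^2\<close>, so that
  slices of a solid are plane sets to which the area formulas apply.\<close>

definition vec3 :: "real \<Rightarrow> real^2 \<Rightarrow> real^3" where
  "vec3 s q = (\<chi> i. if i = 1 then s else if i = 2 then q$1 else q$2)"

lemma vec2_nth [simp]: "vec2 s r $ 1 = s" "vec2 s r $ 2 = r"
  by (simp_all add: vec2_def)

lemma vec3_nth [simp]: "vec3 s q $ 1 = s" "vec3 s q $ 2 = q$1" "vec3 s q $ 3 = q$2"
  by (simp_all add: vec3_def)

lemma emeasure_box_vec:
  fixes l u :: "real^'n::finite"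
  assumes "\<And>i. l$i \<le> u$i"
  shows "emeasure lborel (box l u) = ennreal (\<Prod>i\<in>UNIV. u$i - l$i)"
proof -
  have B: "(Basis :: (real^'n) set) = range (\<lambda>i. axis i (1::real))"
    by (auto simp: Basis_vec_def)
  have "(\<Prod>b\<in>Basis. (u - l) \<bullet> b) = (\<Prod>i\<in>UNIV. u$i - l$i)"
    unfolding B by (subst prod.reindex) (auto simp: inj_on_def axis_eq_axis inner_axis)
  then show ?thesis
    using assms by (subst emeasure_lborel_box) (auto simp: B inner_axis)
qed

lemma continuous_vec2: "continuous_on UNIV (\<lambda>(s, r). vec2 s r)"
  unfolding vec2_def case_prod_unfold
proof (rule continuous_on_vec_lambda)
  show "continuous_on UNIV (\<lambda>x. if i = 1 then fst x else snd x)" for i :: 2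
    by (cases "i = 1") (auto intro!: continuous_intros)
qed

lemma continuous_vec3: "continuous_on UNIV (\<lambda>(s, q). vec3 s q)"
  unfolding vec3_def case_prod_unfold
proof (rule continuous_on_vec_lambda)
  show "continuous_on UNIV (\<lambda>x. if i = 1 then fst x else if i = 2 then snd x $ 1 else snd x $ 2)" for i :: 3
    by (cases "i = 1"; cases "i = 2") (auto intro!: continuous_intros)
qed

text \<open>Lebesgue measure is determined by its values on boxes, and the preimage of a box is a
  product of boxes.\<close>

lemma lborel_eq_distr_vec2: "lborel = distr lborel borel (\<lambda>(s, r). vec2 s r)"
proof (rule lborel_eqI)
  fix l u :: "real^2" assume "\<And>b. b \<in> Basis \<Longrightarrow> l \<bullet> b \<le> u \<bullet> b"
  then have le: "l$i \<le> u$i" for i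
    by (metis axis_in_Basis_iff inner_axis inner_real_def mult.right_neutral Basis_real_def singletonI)
  have meas: "(\<lambda>(s, r). vec2 s r) \<in> borel_measurable lborel"
    using borel_measurable_continuous_onI[OF continuous_vec2] by simp
  have "emeasure (distr lborel borel (\<lambda>(s, r). vec2 s r)) (box l u)
      = emeasure lborel ((\<lambda>(s, r). vec2 s r) -` box l u)"
    using meas by (subst emeasure_distr) auto
  also have "(\<lambda>(s, r). vec2 s r) -` box l u = box (l$1) (u$1) \<times> box (l$2) (u$2)"
    by (auto simp: mem_box_cart forall_2 box_real)
  also have "emeasure lborel \<dots> = emeasure (lborel \<Otimes>\<^sub>M lborel) (box (l$1) (u$1) \<times> box (l$2) (u$2))"
    unfolding lborel_prod ..
  also have "\<dots> = emeasure lborel (box (l$1) (u$1)) * emeasure lborel (box (l$2) (u$2))"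
    by (rule lborel.emeasure_pair_measure_Times) auto
  also have "\<dots> = ennreal ((u$1 - l$1) * (u$2 - l$2))"
    using le by (simp add: box_real ennreal_mult)
  also have "\<dots> = emeasure lborel (box l u)"
    unfolding emeasure_box_vec[OF le] UNIV_2 by simp
  also have "\<dots> = ennreal (\<Prod>b\<in>Basis. (u - l) \<bullet> b)"
    using \<open>\<And>b. b \<in> Basis \<Longrightarrow> l \<bullet> b \<le> u \<bullet> b\<close> by simp
  finally show "emeasure (distr lborel borel (\<lambda>(s, r). vec2 s r)) (box l u) = ennreal (\<Prod>b\<in>Basis. (u - l) \<bullet> b)" .
qed simp

lemma lborel_eq_distr_vec3: "lborel = distr lborel borel (\<lambda>(s, q). vec3 s q)"
proof (rule lborel_eqI)
  fix l u :: "real^3" assume "\<And>b. b \<in> Basis \<Longrightarrow> l \<bullet> b \<le> u \<bullet> b"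
  then have le: "l$i \<le> u$i" for i
    by (metis axis_in_Basis_iff inner_axis inner_real_def mult.right_neutral Basis_real_def singletonI)
  have meas: "(\<lambda>(s, q). vec3 s q) \<in> borel_measurable lborel"
    using borel_measurable_continuous_onI[OF continuous_vec3] by simp
  have "emeasure (distr lborel borel (\<lambda>(s, q). vec3 s q)) (box l u)
      = emeasure lborel ((\<lambda>(s, q). vec3 s q) -` box l u)"
    using meas by (subst emeasure_distr) auto
  also have "(\<lambda>(s, q). vec3 s q) -` box l u = box (l$1) (u$1) \<times> box (vec2 (l$2) (l$3)) (vec2 (u$2) (u$3))"
    by (auto simp: mem_box_cart forall_2 forall_3 box_real)
  also have "emeasure lborel \<dots> = emeasure (lborel \<Otimes>\<^sub>M lborel) (box (l$1) (u$1) \<times> box (vec2 (l$2) (l$3)) (vec2 (u$2) (u$3)))"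
    unfolding lborel_prod ..
  also have "\<dots> = emeasure lborel (box (l$1) (u$1)) * emeasure lborel (box (vec2 (l$2) (l$3)) (vec2 (u$2) (u$3)))"
    by (rule lborel.emeasure_pair_measure_Times) auto
  also have "emeasure lborel (box (vec2 (l$2) (l$3)) (vec2 (u$2) (u$3))) = ennreal ((u$2 - l$2) * (u$3 - l$3))"
    using le by (subst emeasure_box_vec) (auto simp: vec2_def UNIV_2)
  also have "emeasure lborel (box (l$1) (u$1)) * \<dots> = ennreal ((u$1 - l$1) * ((u$2 - l$2) * (u$3 - l$3)))"
    using le by (simp add: box_real ennreal_mult)
  also have "\<dots> = emeasure lborel (box l u)"
    unfolding emeasure_box_vec[OF le] UNIV_3 by (simp add: mult.assoc)
  also have "\<dots> = ennreal (\<Prod>b\<in>Basis. (u - l) \<bullet> b)"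
    using \<open>\<And>b. b \<in> Basis \<Longrightarrow> l \<bullet> b \<le> u \<bullet> b\<close> by simp
  finally show "emeasure (distr lborel borel (\<lambda>(s, q). vec3 s q)) (box l u) = ennreal (\<Prod>b\<in>Basis. (u - l) \<bullet> b)" .
qed simp

lemma emeasure_slice_vec2:
  fixes S :: "(real^2) set"
  assumes "closed S"
  shows "emeasure lborel S = (\<integral>\<^sup>+s. emeasure lborel {r. vec2 s r \<in> S} \<partial>lborel)"
proof -
  have meas: "(\<lambda>(s, r). vec2 s r) \<in> borel_measurable lborel"
    using borel_measurable_continuous_onI[OF continuous_vec2] by simp
  have "emeasure lborel S = emeasure lborel ((\<lambda>(s, r). vec2 s r) -` S)"
    by (subst lborel_eq_distr_vec2) (use meas assms in \<open>simp add: emeasure_distr\<close>)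
  also have "\<dots> = (\<integral>\<^sup>+s. emeasure lborel {r. (s, r) \<in> (\<lambda>(s, r). vec2 s r) -` S} \<partial>lborel)"
    by (rule emeasure_lborel_fibre(1)[OF closed_vimage[OF assms continuous_vec2]])
  finally show ?thesis by simp
qed

lemma emeasure_slice_vec3:
  fixes S :: "(real^3) set"
  assumes "closed S"
  shows "emeasure lborel S = (\<integral>\<^sup>+s. emeasure lborel {q. vec3 s q \<in> S} \<partial>lborel)"
proof -
  have meas: "(\<lambda>(s, q). vec3 s q) \<in> borel_measurable lborel"
    using borel_measurable_continuous_onI[OF continuous_vec3] by simp
  have "emeasure lborel S = emeasure lborel ((\<lambda>(s, q). vec3 s q) -` S)"
    by (subst lborel_eq_distr_vec3) (use meas assms in \<open>simp add: emeasure_distr\<close>)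
  also have "\<dots> = (\<integral>\<^sup>+s. emeasure lborel {q. (s, q) \<in> (\<lambda>(s, q). vec3 s q) -` S} \<partial>lborel)"
    by (rule emeasure_lborel_fibre(1)[OF closed_vimage[OF assms continuous_vec3]])
  finally show ?thesis by simp
qed

text \<open>Cavalieri's principle followed by the fundamental theorem of calculus. The function
  \<open>f\<close> describes the slices on \<open>{0..B}\<close> only; there it is nonnegative as a
  measure, and its continuity supplies measurability.\<close>

lemma measure_eq_FTC:
  fixes S :: "'a::euclidean_space set" and G :: "real \<Rightarrow> 'b::euclidean_space set"
  assumes "emeasure lborel S = (\<integral>\<^sup>+s. emeasure lborel (G s) \<partial>lborel)" "compact S"
    and "\<And>s. compact (G s)"
    and B: "0 \<le> B" and out: "\<And>s. s \<notin> {0..B} \<Longrightarrow> G s = {}"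
    and f: "\<And>s. s \<in> {0..B} \<Longrightarrow> measure lebesgue (G s) = f s" "continuous_on UNIV f"
    and F: "\<And>s. s \<in> {0..B} \<Longrightarrow> DERIV F s :> f s"
  shows "measure lebesgue S = F B - F 0"
proof -
  have f_nonneg: "0 \<le> f s" if "s \<in> {0..B}" for s
    using f(1)[OF that] by (metis measure_nonneg)
  have "emeasure lborel (G s) = ennreal (f s) * indicator {0..B} s" for s
    using out[of s] f(1)[of s] by (auto simp: indicator_def emeasure_lborel_compact[OF assms(3)])
  then have "emeasure lborel S = (\<integral>\<^sup>+s. ennreal (f s) * indicator {0..B} s \<partial>lborel)"
    using assms(1) by simp
  also have "\<dots> = ennreal (F B - F 0)"
    using B f_nonneg F borel_measurable_continuous_onI[OF f(2)]
    by (intro nn_integral_FTC_Icc) (auto simp: has_real_derivative_iff_has_vector_derivative)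
  finally have "ennreal (measure lebesgue S) = ennreal (F B - F 0)"
    by (simp add: emeasure_lborel_compact[OF assms(2)])
  moreover have "F 0 \<le> F B"
    using B f_nonneg F by (intro DERIV_nonneg_imp_nondecreasing[of 0 B F]) auto
  ultimately show ?thesis by simp
qed

lemma compact_slice_vec2:
  assumes "compact S"
  shows "compact {r. vec2 s r \<in> S}"
proof -
  have "closed {r. vec2 s r \<in> S}"
    using closed_vimage[OF compact_imp_closed[OF assms], of "vec2 s"]
      continuous_on_compose2[OF continuous_vec2, of UNIV "\<lambda>r. (s, r)"]
    by (simp add: vimage_def continuous_on_Pair)
  moreover have "{r. vec2 s r \<in> S} \<subseteq> (\<lambda>q. q $ 2) ` S"
    by (force simp: image_iff)
  moreover have "bounded ((\<lambda>q. q $ 2) ` S)"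
    by (intro compact_imp_bounded compact_continuous_image assms continuous_intros)
  ultimately show ?thesis using bounded_subset compact_eq_bounded_closed by blast
qed

lemma compact_slice_vec3:
  assumes "compact S"
  shows "compact {q. vec3 s q \<in> S}"
proof -
  have "closed {q. vec3 s q \<in> S}"
    using closed_vimage[OF compact_imp_closed[OF assms], of "vec3 s"]
      continuous_on_compose2[OF continuous_vec3, of UNIV "\<lambda>q. (s, q)"]
    by (simp add: vimage_def continuous_on_Pair)
  moreover have "{q. vec3 s q \<in> S} \<subseteq> (\<lambda>q. vec2 (q $ 2) (q $ 3)) ` S"
  proof
    fix q assume "q \<in> {q. vec3 s q \<in> S}"
    moreover have "q = vec2 (vec3 s q $ 2) (vec3 s q $ 3)"
      by (simp add: vec_eq_iff forall_2)
    ultimately show "q \<in> (\<lambda>q. vec2 (q $ 2) (q $ 3)) ` S" by blast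
  qed
  moreover have "bounded ((\<lambda>q. vec2 (q $ 2) (q $ 3)) ` S)"
    by (intro compact_imp_bounded compact_continuous_image assms
        continuous_on_compose2[OF continuous_vec2, of S "\<lambda>q. (q $ 2, q $ 3)", simplified] continuous_intros)
  ultimately show ?thesis using bounded_subset compact_eq_bounded_closed by blast
qed

lemma measure_slice_vec2:
  assumes "compact S" "0 \<le> B" "\<And>s. s \<notin> {0..B} \<Longrightarrow> {r. vec2 s r \<in> S} = {}"
    and "\<And>s. s \<in> {0..B} \<Longrightarrow> measure lebesgue {r. vec2 s r \<in> S} = f s" "continuous_on UNIV f"
    and "\<And>s. s \<in> {0..B} \<Longrightarrow> DERIV F s :> f s"
  shows "measure lebesgue S = F B - F 0"
  by (rule measure_eq_FTC[OF emeasure_slice_vec2[OF compact_imp_closed[OF assms(1)]] assms(1)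
        compact_slice_vec2[OF assms(1)] assms(2-6)])

lemma measure_slice_vec3:
  assumes "compact S" "0 \<le> B" "\<And>s. s \<notin> {0..B} \<Longrightarrow> {q. vec3 s q \<in> S} = {}"
    and "\<And>s. s \<in> {0..B} \<Longrightarrow> measure lebesgue {q. vec3 s q \<in> S} = f s" "continuous_on UNIV f"
    and "\<And>s. s \<in> {0..B} \<Longrightarrow> DERIV F s :> f s"
  shows "measure lebesgue S = F B - F 0"
  by (rule measure_eq_FTC[OF emeasure_slice_vec3[OF compact_imp_closed[OF assms(1)]] assms(1)
        compact_slice_vec3[OF assms(1)] assms(2-6)])

section \<open>Areas and volumes of the polytopes that occur\<close>

lemma compact_subset_cbox:
  fixes P :: "real^'n::finite \<Rightarrow> bool"
  assumes "closed {q. P q}" "\<And>q. P q \<Longrightarrow> \<forall>i. 0 \<le> q$i \<and> q$i \<le> c"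
  shows "compact {q. P q}"
proof -
  have "{q. P q} \<subseteq> cbox 0 (\<chi> i. c)"
    using assms(2) by (auto simp: mem_box_cart)
  then show ?thesis
    using assms(1) bounded_cbox bounded_subset compact_eq_bounded_closed by blast
qed

lemma measure_real_interval: "measure lebesgue {r::real. 0 \<le> r \<and> r \<le> c \<and> r \<le> d} = pp (min c d)"
proof -
  have "{r::real. 0 \<le> r \<and> r \<le> c \<and> r \<le> d} = {0..min c d}" by auto
  moreover have "measure lebesgue {0..m} = pp m" for m
    by (cases "0 \<le> m") simp_all
  ultimately show ?thesis by (simp only:)
qed

lemma measure_box_vec:
  fixes u :: "real^'n::finite"
  assumes "\<And>i. 0 \<le> u$i"
  shows "measure lebesgue {q. \<forall>i. 0 \<le> q$i \<and> q$i \<le> u$i} = (\<Prod>i\<in>UNIV. u$i)"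
proof -
  have "{q. \<forall>i. 0 \<le> q$i \<and> q$i \<le> u$i} = cbox 0 u" by (auto simp: mem_box_cart)
  moreover have "cbox 0 u \<noteq> {}" using assms by (simp add: interval_ne_empty_cart)
  then have "measure lborel (cbox 0 u) = (\<Prod>i\<in>UNIV. u$i)"
    by (subst content_cbox_cart) simp_all
  ultimately show ?thesis by simp
qed

text \<open>Inclusion-exclusion: from the corner triangle of leg \<open>c\<close> the parts beyond
  \<open>B\<close> and beyond \<open>C\<close> are removed and their overlap is restored. Truncation
  covers all positions of the cutting line.\<close>

lemma area_cut_rectangle:
  assumes "0 \<le> B" "0 \<le> C"
  shows "measure lebesgue {q::real^2. 0 \<le> q$1 \<and> q$1 \<le> B \<and> 0 \<le> q$2 \<and> q$2 \<le> C \<and> q$1 + q$2 \<le> c} =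
    (pp c ^ 2 - pp (c - B) ^ 2 - pp (c - C) ^ 2 + pp (c - B - C) ^ 2) / 2" (is "measure lebesgue ?S = _")
proof -
  define f where "f = (\<lambda>s. pp (c - s) - pp (c - C - s))"
  define F where "F = (\<lambda>s. - (pp (c - s) ^ 2 - pp (c - C - s) ^ 2) / 2)"
  have "compact ?S"
    by (rule compact_subset_cbox[where c = "B + C"])
      ((intro closed_Collect_conj closed_Collect_le; intro continuous_intros),
        use assms in \<open>auto simp: forall_2\<close>)
  then have "measure lebesgue ?S = F B - F 0"
  proof (rule measure_slice_vec2[where f = f])
    show "{r. vec2 s r \<in> ?S} = {}" if "s \<notin> {0..B}" for s using that by auto
    show "measure lebesgue {r. vec2 s r \<in> ?S} = f s" if "s \<in> {0..B}" for s
    proof -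
      have "{r. vec2 s r \<in> ?S} = {r. 0 \<le> r \<and> r \<le> C \<and> r \<le> c - s}" using that by auto
      then show ?thesis using assms
        by (simp add: measure_real_interval f_def) (auto simp: pp_def)
    qed
    show "continuous_on UNIV f" unfolding f_def by (intro continuous_intros)
    show "DERIV F s :> f s" for s
      unfolding F_def f_def by (auto intro!: derivative_eq_intros)
  qed (fact assms)
  then show ?thesis unfolding F_def by (simp add: field_simps)
qed

text \<open>The bound \<open>pp c\<close> on the second coordinate is implied by the others, and
  with it the last two truncated terms of the rectangle formula vanish.\<close>

lemma area_cut_strip:
  assumes "0 \<le> B"
  shows "measure lebesgue {q::real^2. 0 \<le> q$1 \<and> q$1 \<le> B \<and> 0 \<le> q$2 \<and> q$1 + q$2 \<le> c} =
    (pp c ^ 2 - pp (c - B) ^ 2) / 2"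
proof -
  have "{q::real^2. 0 \<le> q$1 \<and> q$1 \<le> B \<and> 0 \<le> q$2 \<and> q$1 + q$2 \<le> c} =
    {q::real^2. 0 \<le> q$1 \<and> q$1 \<le> B \<and> 0 \<le> q$2 \<and> q$2 \<le> pp c \<and> q$1 + q$2 \<le> c}"
    by (auto simp: pp_def le_max_iff_disj)
  moreover have "pp (c - pp c) = 0" "pp (c - B - pp c) = 0" using assms by (auto simp: pp_def)
  ultimately show ?thesis using area_cut_rectangle[OF assms pp_nonneg] by simp
qed

text \<open>Slices in the first coordinate are cut strips of width \<open>C\<close>; integrating
  their areas raises each truncated power by one.\<close>

lemma volume_cut_prism:
  assumes "0 \<le> B" "0 \<le> C"
  shows "measure lebesgue {q::real^3. 0 \<le> q$1 \<and> q$1 \<le> B \<and> 0 \<le> q$2 \<and> q$2 \<le> C \<and> 0 \<le> q$3 \<and> q$1 + q$2 + q$3 \<le> c} =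
    (pp c ^ 3 - pp (c - B) ^ 3 - pp (c - C) ^ 3 + pp (c - B - C) ^ 3) / 6" (is "measure lebesgue ?S = _")
proof -
  define f where "f = (\<lambda>s. (pp (c - s) ^ 2 - pp (c - C - s) ^ 2) / 2)"
  define F where "F = (\<lambda>s. - (pp (c - s) ^ 3 - pp (c - C - s) ^ 3) / 6)"
  have "compact ?S"
    by (rule compact_subset_cbox[where c = "B + C + \<bar>c\<bar>"])
      ((intro closed_Collect_conj closed_Collect_le; intro continuous_intros),
        use assms in \<open>auto simp: forall_3\<close>)
  then have "measure lebesgue ?S = F B - F 0"
  proof (rule measure_slice_vec3[where f = f])
    show "{r. vec3 s r \<in> ?S} = {}" if "s \<notin> {0..B}" for s using that by auto
    show "measure lebesgue {r. vec3 s r \<in> ?S} = f s" if "s \<in> {0..B}" for s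
    proof -
      have "{r. vec3 s r \<in> ?S} = {q. 0 \<le> q$1 \<and> q$1 \<le> C \<and> 0 \<le> q$2 \<and> q$1 + q$2 \<le> c - s}"
        using that by auto
      then show ?thesis
        by (simp only: area_cut_strip[OF assms(2)] f_def cancel_ab_semigroup_add_class.diff_right_commute[of c C s])
    qed
    show "continuous_on UNIV f" unfolding f_def by (intro continuous_intros) auto
    show "DERIV F s :> f s" for s
      unfolding F_def f_def by (auto intro!: derivative_eq_intros simp: field_simps)
  qed (fact assms)
  then show ?thesis unfolding F_def by (simp add: field_simps)
qed

text \<open>The first coordinate is the one shared by both constraints; once it is fixed at
  \<open>s\<close>, the others range independently over a rectangle with sides \<open>b1 - s\<close>
  and \<open>b2 - s\<close>.\<close>

lemma volume_two_constraints:
  assumes "0 \<le> b1" "0 \<le> b2"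
  defines "m \<equiv> min b1 b2"
  shows "measure lebesgue {q::real^3. 0 \<le> q$1 \<and> 0 \<le> q$2 \<and> 0 \<le> q$3 \<and> q$2 + q$1 \<le> b1 \<and> q$3 + q$1 \<le> b2} =
    b1 * b2 * m - (b1 + b2) * m ^ 2 / 2 + m ^ 3 / 3" (is "measure lebesgue ?S = _")
proof -
  define f where "f = (\<lambda>s::real. (b1 - s) * (b2 - s))"
  define F where "F = (\<lambda>s::real. b1 * b2 * s - (b1 + b2) * s ^ 2 / 2 + s ^ 3 / 3)"
  have "compact ?S"
    by (rule compact_subset_cbox[where c = "b1 + b2"])
      ((intro closed_Collect_conj closed_Collect_le; intro continuous_intros),
        use assms in \<open>auto simp: forall_3\<close>)
  then have "measure lebesgue ?S = F m - F 0"
  proof (rule measure_slice_vec3[where f = f])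
    show "{r. vec3 s r \<in> ?S} = {}" if "s \<notin> {0..m}" for s using that by (auto simp: m_def)
    show "measure lebesgue {r. vec3 s r \<in> ?S} = f s" if "s \<in> {0..m}" for s
    proof -
      have "{r. vec3 s r \<in> ?S} = {q. \<forall>i. 0 \<le> q$i \<and> q$i \<le> vec2 (b1 - s) (b2 - s) $ i}"
        using that by (auto simp: forall_2)
      also have "measure lebesgue \<dots> = (\<Prod>i\<in>UNIV. vec2 (b1 - s) (b2 - s) $ i)"
        using that by (intro measure_box_vec) (auto simp: vec2_def m_def)
      finally show ?thesis by (simp add: f_def UNIV_2)
    qed
    show "continuous_on UNIV f" unfolding f_def by (intro continuous_intros)
    show "DERIV F s :> f s" for s
      unfolding F_def f_def by (auto intro!: derivative_eq_intros simp: field_simps power2_eq_square)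
    show "0 \<le> m" using assms by simp
  qed
  then show ?thesis unfolding F_def by simp
qed

text \<open>Fixing the first coordinate decouples two of the constraints and leaves a rectangle cut
  by the third. The factor 1/6 instead of 1/3 in \<open>F\<close> comes from the inner slope
  2.\<close>

lemma volume_three_constraints:
  assumes "0 \<le> b1" "0 \<le> b2" "0 \<le> b3"
  defines "m \<equiv> min b1 b2"
  defines "F \<equiv> \<lambda>s. (b3 ^ 2 * s - pp (b3 - b2 + s) ^ 3 / 3 - pp (b3 - b1 + s) ^ 3 / 3 + pp (b3 - b1 - b2 + 2 * s) ^ 3 / 6) / 2"
  shows "measure lebesgue {q::real^3. 0 \<le> q$1 \<and> 0 \<le> q$2 \<and> 0 \<le> q$3 \<and>
      q$1 + q$3 \<le> b1 \<and> q$1 + q$2 \<le> b2 \<and> q$2 + q$3 \<le> b3} = F m - F 0" (is "measure lebesgue ?S = _")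
proof -
  define f where "f = (\<lambda>s. (b3 ^ 2 - pp (b3 - b2 + s) ^ 2 - pp (b3 - b1 + s) ^ 2 + pp (b3 - b1 - b2 + 2 * s) ^ 2) / 2)"
  have "compact ?S"
    by (rule compact_subset_cbox[where c = "b1 + b2"])
      ((intro closed_Collect_conj closed_Collect_le; intro continuous_intros),
        use assms in \<open>auto simp: forall_3\<close>)
  then show ?thesis
  proof (rule measure_slice_vec3[where f = f])
    show "{r. vec3 s r \<in> ?S} = {}" if "s \<notin> {0..m}" for s using that by (auto simp: m_def)
    show "measure lebesgue {r. vec3 s r \<in> ?S} = f s" if "s \<in> {0..m}" for s
    proof -
      have "{r. vec3 s r \<in> ?S} = {q. 0 \<le> q$1 \<and> q$1 \<le> b2 - s \<and> 0 \<le> q$2 \<and> q$2 \<le> b1 - s \<and> q$1 + q$2 \<le> b3}"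
        using that by auto
      also have "measure lebesgue \<dots> = f s"
        using that assms by (subst area_cut_rectangle) (auto simp: f_def m_def algebra_simps)
      finally show ?thesis .
    qed
    show "continuous_on UNIV f" unfolding f_def by (intro continuous_intros) auto
    show "DERIV F s :> f s" for s
      unfolding F_def f_def by (auto intro!: derivative_eq_intros simp: field_simps)
    show "0 \<le> m" using assms by simp
  qed
qed

text \<open>A truncated minimum becomes a sum of truncated affine functions, as \<open>p\<close> and
  \<open>q\<close> are not both negative. The halved argument has slope -1 in the integration
  variable of \<open>area_hat\<close>, like the other two.\<close>

lemma pp_min:
  assumes "0 \<le> p + q"
  shows "pp (min p q) = pp p - 2 * pp ((p - q) / 2) + pp (- q)"
proof (cases "p \<le> q")
  case True
  then show ?thesis using assms by simp
next
  case False
  then show ?thesis using assms by (cases "0 \<le> q") (simp_all add: field_simps)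
qed

text \<open>The slice at \<open>v\<close> is bounded by the minimum of a falling and a rising affine
  function, \<open>b1 - v\<close> and \<open>b2 - b3 + v\<close>. Their sum is \<open>s\<close> for
  every \<open>v\<close>, so \<open>0 \<le> s\<close> is the condition of \<open>pp_min\<close>, and
  for negative \<open>s\<close> the region is empty.\<close>

lemma area_hat:
  assumes "0 \<le> b1" "0 \<le> b2" "0 \<le> b3"
  defines "s \<equiv> b1 + b2 - b3"
  defines "F \<equiv> \<lambda>v. - (pp (b1 - v) ^ 2 - 2 * pp (b1 - s / 2 - v) ^ 2 + pp (b1 - s - v) ^ 2) / 2"
  shows "measure lebesgue {q::real^2. 0 \<le> q$1 \<and> q$1 \<le> b3 \<and> 0 \<le> q$2 \<and> q$2 + q$1 \<le> b1 \<and> q$2 - q$1 \<le> b2 - b3} =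
    (if 0 \<le> s then F b3 - F 0 else 0)" (is "measure lebesgue ?S = _")
proof (cases "0 \<le> s")
  case True
  define f where "f = (\<lambda>v. pp (b1 - v) - 2 * pp (b1 - s / 2 - v) + pp (b1 - s - v))"
  have "compact ?S"
    by (rule compact_subset_cbox[where c = "b3 + b1"])
      ((intro closed_Collect_conj closed_Collect_le; intro continuous_intros),
        use assms in \<open>auto simp: forall_2\<close>)
  then have "measure lebesgue ?S = F b3 - F 0"
  proof (rule measure_slice_vec2[where f = f])
    show "{r. vec2 v r \<in> ?S} = {}" if "v \<notin> {0..b3}" for v using that by auto
    show "measure lebesgue {r. vec2 v r \<in> ?S} = f v" if "v \<in> {0..b3}" for v
    proof -
      have "{r. vec2 v r \<in> ?S} = {r. 0 \<le> r \<and> r \<le> b1 - v \<and> r \<le> b2 - b3 + v}" using that by auto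
      moreover have "b1 - s / 2 - v = (b1 - v - (b2 - b3 + v)) / 2" "b1 - s - v = - (b2 - b3 + v)"
        by (simp_all add: s_def field_simps)
      ultimately show ?thesis using True
        using pp_min[of "b1 - v" "b2 - b3 + v"]
        by (simp only: measure_real_interval f_def)
    qed
    show "continuous_on UNIV f" unfolding f_def by (intro continuous_intros) auto
    show "DERIV F v :> f v" for v
      unfolding F_def f_def by (auto intro!: derivative_eq_intros)
  qed (fact assms)
  then show ?thesis using True by simp
next
  case False
  then have empty: "?S = {}" by (auto simp: s_def)
  show ?thesis unfolding empty using False by simp
qed

section \<open>Simplex splines as sums of truncated powers\<close>

lemma cross2_nonzero_imp_not_collinear:
  assumes "cross2 (b - a) (c - a) \<noteq> 0"
  shows "\<not> collinear {a, b, c}"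
proof
  assume "collinear {a, b, c}"
  then have "collinear {0, b - a, c - a}"
    using collinear_3[of b a c] by (simp add: insert_commute)
  then obtain r where "b - a = 0 \<or> c - a = r *\<^sub>R (b - a)"
    unfolding collinear_lemma by (metis scaleR_zero_left)
  with assms show False
    by (auto simp: cross2_def mult.left_commute simp del: vector_minus_component)
qed

text \<open>Dividing \<open>t$j\<close> by \<open>m j\<close> multiplies column j by
  \<open>m j\<close>; the Jacobian of this stretching is the reciprocal of the product of all
  \<open>m j\<close>.\<close>

lemma measure_cone_polytope_scaled:
  fixes ca :: "'d::{finite,wellorder} \<Rightarrow> real"
  assumes k: "\<And>j. ca j + cb j + cc j = 1" and m: "\<And>j. 0 < m j"
  shows "measure lebesgue (cone_polytope ca cb cc u v w) = (\<Prod>j\<in>UNIV. m j) *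
    measure lebesgue (cone_polytope (\<lambda>j. m j * ca j) (\<lambda>j. m j * cb j) (\<lambda>j. m j * cc j) u v w)"
proof -
  have nz: "m j \<noteq> 0" for j using m[of j] by simp
  let ?P = "cone_polytope ca cb cc u v w"
    and ?S = "cone_polytope (\<lambda>j. m j * ca j) (\<lambda>j. m j * cb j) (\<lambda>j. m j * cc j) u v w"
  have "?S = (\<lambda>t. \<chi> j. (1 / m j) * t$j) ` ?P"
  proof (intro set_eqI iffI)
    fix t assume "t \<in> ?S"
    then have "(\<chi> j. m j * t$j) \<in> ?P"
      using m by (auto simp: cone_polytope_def less_imp_le ac_simps)
    moreover have "t = (\<chi> j. (1 / m j) * (\<chi> j. m j * t$j) $ j)"
      by (simp add: vec_eq_iff nz)
    ultimately show "t \<in> (\<lambda>t. \<chi> j. (1 / m j) * t$j) ` ?P" by (rule image_eqI[rotated])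
  next
    fix t assume "t \<in> (\<lambda>t. \<chi> j. (1 / m j) * t$j) ` ?P"
    then show "t \<in> ?S"
      using m by (auto simp: cone_polytope_def nz less_imp_le)
  qed
  then have "measure lebesgue ?S = \<bar>\<Prod>j\<in>UNIV. 1 / m j\<bar> * measure lebesgue ?P"
    using measure_stretch[OF lmeasurable_compact[OF compact_cone_polytope[OF k]], of "\<lambda>j. 1 / m j"]
    by simp
  moreover have "0 < (\<Prod>j\<in>UNIV. m j)" using m by (simp add: prod_pos)
  ultimately show ?thesis by (simp add: prod_dividef nz)
qed

text \<open>Only multiples of the knots enter, so that their coordinates can be taken to be integers.\<close>

theorem simplex_spline_eq_scaled_measure:
  fixes k :: "'d::{finite,wellorder} \<Rightarrow> real^2"
  assumes nc: "\<not> collinear {a, b, c}"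
    and K: "K = {#a, b, c#} + image_mset k (mset_set UNIV)"
    and k: "\<And>j. (ca j + cb j + cc j) *\<^sub>R k j = ca j *\<^sub>R a + cb j *\<^sub>R b + cc j *\<^sub>R c"
      "\<And>j. 0 < ca j + cb j + cc j"
    and x: "x = u *\<^sub>R a + v *\<^sub>R b + w *\<^sub>R c" "u + v + w = 1"
  shows "simplex_spline TYPE('d) A K x =
    fact CARD('d) * (A / measure lebesgue (convex hull {a, b, c})) *
      ((\<Prod>j\<in>UNIV. ca j + cb j + cc j) * measure lebesgue (cone_polytope ca cb cc u v w))"
proof -
  define m where "m j = ca j + cb j + cc j" for j
  have nz: "m j \<noteq> 0" for j using k(2)[of j] by (simp add: m_def)
  have 1: "k j = (ca j / m j) *\<^sub>R a + (cb j / m j) *\<^sub>R b + (cc j / m j) *\<^sub>R c" for j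
  proof -
    have "k j = (1 / m j) *\<^sub>R (m j *\<^sub>R k j)" using nz by simp
    also have "\<dots> = (1 / m j) *\<^sub>R (ca j *\<^sub>R a + cb j *\<^sub>R b + cc j *\<^sub>R c)"
      unfolding m_def k(1) ..
    finally show ?thesis by (simp add: algebra_simps)
  qed
  have 2: "ca j / m j + cb j / m j + cc j / m j = 1" for j
    using nz[of j] by (simp add: m_def add_divide_distrib[symmetric])
  show ?thesis
    unfolding simplex_spline_eq_measure[OF nc K 1 2 x]
      measure_cone_polytope_scaled[where m = m, OF 2 k(2)[folded m_def]]
    by (simp add: nz flip: m_def)
qed

section \<open>Simplex splines with explicit knots in degrees 1, 2 and 3\<close>

lemma simplex_spline_1:
  assumes "\<not> collinear {a, b, c}"
    and "(p1 + q1 + r1) *\<^sub>R k1 = p1 *\<^sub>R a + q1 *\<^sub>R b + r1 *\<^sub>R c" "0 < p1 + q1 + r1"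
    and "x = u *\<^sub>R a + v *\<^sub>R b + w *\<^sub>R c" "u + v + w = 1"
    and "K = {#a, b, c, k1#}"
  shows "simplex_spline TYPE(1) A K x = A / measure lebesgue (convex hull {a, b, c}) *
    ((p1 + q1 + r1) * measure lebesgue {t::real^1. 0 \<le> t$1 \<and> p1 * t$1 \<le> u \<and> q1 * t$1 \<le> v \<and> r1 * t$1 \<le> w})"
proof -
  have K: "K = {#a, b, c#} + image_mset (\<lambda>_::1. k1) (mset_set UNIV)"
    using assms(6) by (simp add: UNIV_1)
  show ?thesis
    by (subst simplex_spline_eq_scaled_measure[OF assms(1) K assms(2-5)])
      (simp add: UNIV_1 cone_polytope_def forall_1)
qed

lemma simplex_spline_2:
  assumes "\<not> collinear {a, b, c}"
    and k: "(p1 + q1 + r1) *\<^sub>R k1 = p1 *\<^sub>R a + q1 *\<^sub>R b + r1 *\<^sub>R c" "0 < p1 + q1 + r1"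
      "(p2 + q2 + r2) *\<^sub>R k2 = p2 *\<^sub>R a + q2 *\<^sub>R b + r2 *\<^sub>R c" "0 < p2 + q2 + r2"
    and x: "x = u *\<^sub>R a + v *\<^sub>R b + w *\<^sub>R c" "u + v + w = 1"
    and "K = {#a, b, c, k1, k2#}"
  shows "simplex_spline TYPE(2) A K x = 2 * (A / measure lebesgue (convex hull {a, b, c})) *
    ((p1 + q1 + r1) * (p2 + q2 + r2) *
      measure lebesgue {t::real^2. 0 \<le> t$1 \<and> 0 \<le> t$2 \<and> p1 * t$1 + p2 * t$2 \<le> u \<and>
        q1 * t$1 + q2 * t$2 \<le> v \<and> r1 * t$1 + r2 * t$2 \<le> w})"
proof -
  let ?f = "\<lambda>y1 y2 (i::2). if i = 1 then y1 else y2"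
  have K: "K = {#a, b, c#} + image_mset (?f k1 k2) (mset_set UNIV)"
    using assms(8) by (simp add: UNIV_2)
  have 1: "(?f p1 p2 j + ?f q1 q2 j + ?f r1 r2 j) *\<^sub>R ?f k1 k2 j =
      ?f p1 p2 j *\<^sub>R a + ?f q1 q2 j *\<^sub>R b + ?f r1 r2 j *\<^sub>R c" for j
    using k by simp
  have 2: "0 < ?f p1 p2 j + ?f q1 q2 j + ?f r1 r2 j" for j
    using k by simp
  show ?thesis
    unfolding simplex_spline_eq_scaled_measure[OF assms(1) K 1 2 x]
    by (simp add: UNIV_2 cone_polytope_def forall_2)
qed

lemma simplex_spline_3:
  assumes "\<not> collinear {a, b, c}"
    and k: "(p1 + q1 + r1) *\<^sub>R k1 = p1 *\<^sub>R a + q1 *\<^sub>R b + r1 *\<^sub>R c" "0 < p1 + q1 + r1"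
      "(p2 + q2 + r2) *\<^sub>R k2 = p2 *\<^sub>R a + q2 *\<^sub>R b + r2 *\<^sub>R c" "0 < p2 + q2 + r2"
      "(p3 + q3 + r3) *\<^sub>R k3 = p3 *\<^sub>R a + q3 *\<^sub>R b + r3 *\<^sub>R c" "0 < p3 + q3 + r3"
    and x: "x = u *\<^sub>R a + v *\<^sub>R b + w *\<^sub>R c" "u + v + w = 1"
    and "K = {#a, b, c, k1, k2, k3#}"
  shows "simplex_spline TYPE(3) A K x = 6 * (A / measure lebesgue (convex hull {a, b, c})) *
    ((p1 + q1 + r1) * (p2 + q2 + r2) * (p3 + q3 + r3) *
      measure lebesgue {t::real^3. 0 \<le> t$1 \<and> 0 \<le> t$2 \<and> 0 \<le> t$3 \<and>
        p1 * t$1 + p2 * t$2 + p3 * t$3 \<le> u \<and>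
        q1 * t$1 + q2 * t$2 + q3 * t$3 \<le> v \<and> r1 * t$1 + r2 * t$2 + r3 * t$3 \<le> w})"
proof -
  let ?f = "\<lambda>y1 y2 y3 (i::3). if i = 1 then y1 else if i = 2 then y2 else y3"
  have ms3: "mset_set (UNIV :: 3 set) = {#1, 2, 3#}" unfolding UNIV_3 by simp
  have K: "K = {#a, b, c#} + image_mset (?f k1 k2 k3) (mset_set UNIV)"
    unfolding assms(10) ms3 by simp
  have 1: "(?f p1 p2 p3 j + ?f q1 q2 q3 j + ?f r1 r2 r3 j) *\<^sub>R ?f k1 k2 k3 j =
      ?f p1 p2 p3 j *\<^sub>R a + ?f q1 q2 q3 j *\<^sub>R b + ?f r1 r2 r3 j *\<^sub>R c" for j
    by (cases "j = 1"; cases "j = 2") (use k(1,3,5) in simp_all)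
  have 2: "0 < ?f p1 p2 p3 j + ?f q1 q2 q3 j + ?f r1 r2 r3 j" for j
    by (cases "j = 1"; cases "j = 2") (use k(2,4,6) in simp_all)
  have f6: "fact CARD(3) = (6::real)" by (simp add: fact_numeral)
  have P: "(\<Prod>j\<in>UNIV. ?f p1 p2 p3 j + ?f q1 q2 q3 j + ?f r1 r2 r3 j) =
      (p1 + q1 + r1) * (p2 + q2 + r2) * (p3 + q3 + r3)"
    unfolding UNIV_3 by simp
  have S: "cone_polytope (?f p1 p2 p3) (?f q1 q2 q3) (?f r1 r2 r3) u v w =
      {t::real^3. 0 \<le> t$1 \<and> 0 \<le> t$2 \<and> 0 \<le> t$3 \<and> p1 * t$1 + p2 * t$2 + p3 * t$3 \<le> u \<and>
        q1 * t$1 + q2 * t$2 + q3 * t$3 \<le> v \<and> r1 * t$1 + r2 * t$2 + r3 * t$3 \<le> w}"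
    unfolding cone_polytope_def forall_3 sum_3 by simp
  show ?thesis
    unfolding simplex_spline_eq_scaled_measure[OF assms(1) K 1 2 x] f6 P S ..
qed

lemma cross2_subtriangle:
  "cross2 (midpoint a b - a) (midpoint a c - a) = cross2 (b - a) (c - a) / 4"
  "cross2 (b - a) (midpoint a c - a) = cross2 (b - a) (c - a) / 2"
  "cross2 (b - a) (midpoint b c - a) = cross2 (b - a) (c - a) / 2"
  "cross2 (b - a) ((1/3) *\<^sub>R (a + b + c) - a) = cross2 (b - a) (c - a) / 3"
  "cross2 (midpoint b c - midpoint a b) (midpoint a c - midpoint a b) = cross2 (b - a) (c - a) / 4"
  by (simp_all add: cross2_def midpoint_def) (simp_all add: field_simps)

lemma interval_vec1: "measure lebesgue {t::real^1. 0 \<le> t$1 \<and> l \<le> t$1 \<and> t$1 \<le> h} = pp (h - pp l)"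
proof -
  have eq: "{t::real^1. 0 \<le> t$1 \<and> l \<le> t$1 \<and> t$1 \<le> h} = cbox (\<chi> i. pp l) (\<chi> i. h)"
    by (auto simp: mem_box_cart forall_1 pp_def)
  show ?thesis
  proof (cases "pp l \<le> h")
    case True
    then have "cbox (\<chi> i. pp l) (\<chi> i. h) \<noteq> ({} :: (real^1) set)"
      by (simp add: interval_ne_empty_cart)
    then show ?thesis unfolding eq using True by (simp add: content_cbox_cart)
  next
    case False
    then have "cbox (\<chi> i. pp l) (\<chi> i. h) = ({} :: (real^1) set)"
      by (simp add: interval_eq_empty_cart)
    then show ?thesis unfolding eq using False by simp
  qed
qed

section \<open>Normal forms in truncated powers\<close>

lemma pp_minus_power2: "pp (- y) ^ 2 = y ^ 2 - pp y ^ 2"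
  by (cases "0 \<le> y") simp_all

lemma pp_minus_power3: "pp (- y) ^ 3 = pp y ^ 3 - y ^ 3"
  by (cases "0 \<le> y") (simp_all add: power3_eq_cube)

text \<open>Upper bounds of the form \<open>pp c\<close> are inserted below to make a box formula
  applicable; these rules discard the terms that they create.\<close>

lemma pp_diff_pp: "0 \<le> d \<Longrightarrow> pp (c - d - pp c) = 0" "pp (c - pp c) = 0" "0 \<le> d \<Longrightarrow> pp (c - pp c - d) = 0"
  by (simp_all add: pp_def)

text \<open>
  The normal forms absorb the case distinctions into truncated powers of the chords, which makes the
  smoothness across the chords visible.
\<close>

lemma hat_normal_form:
  assumes "0 \<le> b1" "0 \<le> b2" "0 \<le> b3"
  defines "s \<equiv> b1 + b2 - b3"
  defines "F \<equiv> \<lambda>v. - (pp (b1 - v) ^ 2 - 2 * pp (b1 - s / 2 - v) ^ 2 + pp (b1 - s - v) ^ 2) / 2"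
  shows "(if 0 \<le> s then F b3 - F 0 else 0) =
    (b1 ^ 2 - (b1 + b3 - b2) ^ 2 / 2 + pp (b3 - b2) ^ 2 - pp (b1 - b3) ^ 2
    + (pp (b1 - b2 - b3) ^ 2 + pp (b2 - b1 - b3) ^ 2 - pp (b3 - b1 - b2) ^ 2) / 2) / 2"
proof (cases "0 \<le> s")
  case True
  have half: "pp (y / 2) = pp y / 2" for y by (simp add: pp_def)
  have e: "b1 - s / 2 - b3 = (b1 - b2 - b3) / 2" "b1 - s - b3 = - b2"
    "b1 - s / 2 - 0 = (b1 + b3 - b2) / 2" "b1 - s - 0 = b3 - b2"
    by (simp_all add: s_def field_simps)
  \<comment> \<open>Of the two orientations of this chord the normal form contains
    \<open>b2 - b1 - b3\<close>; the truncated square of the other one is a polynomial minus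
    it.\<close>
  have f: "pp (b1 + b3 - b2) ^ 2 = (b1 + b3 - b2) ^ 2 - pp (b2 - b1 - b3) ^ 2"
    using pp_minus_power2[of "b2 - b1 - b3"] by (simp add: algebra_simps power2_eq_square)
  have g: "pp (b3 - b1 - b2) = 0" "pp (- b2) = 0" "pp (b1 - 0) = b1"
    using True assms by (simp_all add: s_def)
  show ?thesis
    using True unfolding F_def e half power_divide f g by (simp add: field_simps)
next
  case False
  \<comment> \<open>Beyond the chord \<open>b3 = b1 + b2\<close> every truncation is decided, and
    the right-hand side vanishes by the parallelogram law for \<open>b1\<close> and
    \<open>b3 - b2\<close>.\<close>
  have f: "pp (b3 - b1 - b2) = b3 - b1 - b2" "pp (b3 - b2) = b3 - b2" "pp (b1 - b3) = 0"
    "pp (b1 - b2 - b3) = 0" "pp (b2 - b1 - b3) = 0"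
    using False assms(1-3) by (simp_all add: s_def)
  show ?thesis
    using False unfolding f by (simp add: power2_eq_square field_simps)
qed

text \<open>The two branches of the minimum differ by \<open>(b2 - b1) ^ 3 / 6\<close>, so one
  branch plus a truncated cube describes both.\<close>

lemma two_constraints_normal_form:
  "b1 * b2 * min b1 b2 - (b1 + b2) * min b1 b2 ^ 2 / 2 + min b1 b2 ^ 3 / 3 =
    b1 * b2 ^ 2 / 2 - b2 ^ 3 / 6 + pp (b2 - b1) ^ 3 / 6"
  by (cases "b1 \<le> b2") (simp_all add: power2_eq_square power3_eq_cube field_simps)

text \<open>At the upper end of the integration each argument in \<open>F\<close> collapses to
  \<open>b3\<close> or to the negative of a chord form such as \<open>b2 - b1 - b3\<close>;
  reversing the latter leaves truncated cubes of chords and a polynomial. At the lower end the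
  arguments are chord forms already.\<close>

lemma three_constraints_normal_form:
  assumes "0 \<le> b1" "0 \<le> b2" "0 \<le> b3"
  defines "F \<equiv> \<lambda>s. (b3 ^ 2 * s - pp (b3 - b2 + s) ^ 3 / 3 - pp (b3 - b1 + s) ^ 3 / 3 + pp (b3 - b1 - b2 + 2 * s) ^ 3 / 6) / 2"
  shows "F (min b1 b2) - F 0 = (b3 ^ 2 * b1 - b3 ^ 3 / 3 - (b1 + b3 - b2) ^ 3 / 6
    + (pp (b1 - b2) ^ 3 + pp (b3 - b1) ^ 3 + pp (b3 - b2) ^ 3) / 3
    - (pp (b1 - b2 - b3) ^ 3 + pp (b2 - b1 - b3) ^ 3 + pp (b3 - b1 - b2) ^ 3) / 6) / 2"
proof (cases "b1 \<le> b2")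
  case True
  have e: "b3 - b2 + b1 = - (b2 - b1 - b3)" "b3 - b1 + b1 = b3" "b3 - b1 - b2 + 2 * b1 = - (b2 - b1 - b3)"
    by simp_all
  have g: "pp b3 = b3" "pp (b1 - b2) = 0" "pp (b1 - b2 - b3) = 0"
    using True assms(1-3) by simp_all
  show ?thesis
    using True unfolding F_def min_absorb1[OF True] e pp_minus_power3 g
    by (simp add: power2_eq_square power3_eq_cube field_simps)
next
  case False
  then have le: "b2 \<le> b1" by simp
  have e: "b3 - b1 + b2 = - (b1 - b2 - b3)" "b3 - b2 + b2 = b3" "b3 - b1 - b2 + 2 * b2 = - (b1 - b2 - b3)"
    by simp_all
  have g: "pp b3 = b3" "pp (b1 - b2) = b1 - b2" "pp (b2 - b1 - b3) = 0"
    using False assms(1-3) by simp_all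
  show ?thesis
    unfolding F_def min_absorb2[OF le] e pp_minus_power3 g
    by (simp add: power2_eq_square power3_eq_cube field_simps)
qed

section \<open>Closed forms of the simplex splines over a labelled triangle\<close>

context
  fixes a1 a2 a3 x :: "real^2" and b1 b2 b3 A :: real
  assumes nc: "\<not> collinear {a1, a2, a3}"
    and nonneg: "0 \<le> b1" "0 \<le> b2" "0 \<le> b3" and sum1: "b1 + b2 + b3 = 1"
    and x: "x = b1 *\<^sub>R a1 + b2 *\<^sub>R a2 + b3 *\<^sub>R a3"
    and A: "A = measure lebesgue (convex hull {a1, a2, a3})"
begin

text \<open>The digits name the anchors in the numbering of the 12-split, with \<open>a1\<close>,
  \<open>a2\<close>, \<open>a3\<close> as vertices 1, 2, 3. Anchors must be knots of the multiset at
  hand, so several triples are needed; the constants are the ratios of areas.\<close>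

lemma subtriangle_146: "\<not> collinear {a1, midpoint a1 a2, midpoint a1 a3}"
  "A / measure lebesgue (convex hull {a1, midpoint a1 a2, midpoint a1 a3}) = 4"
  and subtriangle_126: "\<not> collinear {a1, a2, midpoint a1 a3}"
  "A / measure lebesgue (convex hull {a1, a2, midpoint a1 a3}) = 2"
  and subtriangle_125: "\<not> collinear {a1, a2, midpoint a2 a3}"
  "A / measure lebesgue (convex hull {a1, a2, midpoint a2 a3}) = 2"
  and subtriangle_1210: "\<not> collinear {a1, a2, (1/3) *\<^sub>R (a1 + a2 + a3)}"
  "A / measure lebesgue (convex hull {a1, a2, (1/3) *\<^sub>R (a1 + a2 + a3)}) = 3"
  and subtriangle_456: "\<not> collinear {midpoint a1 a2, midpoint a2 a3, midpoint a1 a3}"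
  "A / measure lebesgue (convex hull {midpoint a1 a2, midpoint a2 a3, midpoint a1 a3}) = 4"
  and subtriangle_123: "A / measure lebesgue (convex hull {a1, a2, a3}) = 1"
  using cross2_nonzero[OF nc]
  unfolding A measure_triangle cross2_subtriangle(1,5)
  unfolding cross2_subtriangle(2-4)
  by (auto intro!: cross2_nonzero_imp_not_collinear simp: cross2_subtriangle(1,5))
    (auto simp: cross2_subtriangle(2-4))

text \<open>The coordinates with respect to the anchors become the bounds of the polytopes. They may
  be negative, for \<open>x\<close> outside the triangle of the anchors.\<close>

lemma x_146: "x = (b1 - b2 - b3) *\<^sub>R a1 + (2 * b2) *\<^sub>R midpoint a1 a2 + (2 * b3) *\<^sub>R midpoint a1 a3"
  "b1 - b2 - b3 + 2 * b2 + 2 * b3 = 1"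
  and x_126: "x = (b1 - b3) *\<^sub>R a1 + b2 *\<^sub>R a2 + (2 * b3) *\<^sub>R midpoint a1 a3"
  "b1 - b3 + b2 + 2 * b3 = 1"
  and x_125: "x = b1 *\<^sub>R a1 + (b2 - b3) *\<^sub>R a2 + (2 * b3) *\<^sub>R midpoint a2 a3"
  "b1 + (b2 - b3) + 2 * b3 = 1"
  and x_1210: "x = (b1 - b3) *\<^sub>R a1 + (b2 - b3) *\<^sub>R a2 + (3 * b3) *\<^sub>R ((1/3) *\<^sub>R (a1 + a2 + a3))"
  "b1 - b3 + (b2 - b3) + 3 * b3 = 1"
  and x_456: "x = (b1 + b2 - b3) *\<^sub>R midpoint a1 a2 + (b2 + b3 - b1) *\<^sub>R midpoint a2 a3 +
      (b1 + b3 - b2) *\<^sub>R midpoint a1 a3"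
  "b1 + b2 - b3 + (b2 + b3 - b1) + (b1 + b3 - b2) = 1"
  using sum1 unfolding x vec_eq_iff by (simp_all add: midpoint_def forall_2 field_simps)

lemma spline1_200101:
  assumes "K = {#a1, midpoint a1 a2, midpoint a1 a3, a1#}"
  shows "simplex_spline TYPE(1) A K x = 4 * pp (b1 - b2 - b3)"
proof -
  have k: "(1 + 0 + 0) *\<^sub>R a1 = 1 *\<^sub>R a1 + 0 *\<^sub>R (midpoint a1 a2) + 0 *\<^sub>R (midpoint a1 a3)" "0 < (1::real) + 0 + 0"
    by (simp_all add: midpoint_def vec_eq_iff forall_2 field_simps)
  have S: "{t::real^1. 0 \<le> t$1 \<and> 1 * t$1 \<le> b1 - b2 - b3 \<and> 0 * t$1 \<le> 2 * b2 \<and> 0 * t$1 \<le> 2 * b3} =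
      {t::real^1. 0 \<le> t$1 \<and> 0 \<le> t$1 \<and> t$1 \<le> b1 - b2 - b3}"
    using nonneg by auto
  have V: "measure lebesgue {t::real^1. 0 \<le> t$1 \<and> 0 \<le> t$1 \<and> t$1 \<le> b1 - b2 - b3} = pp (b1 - b2 - b3)"
    unfolding interval_vec1 by simp
  show ?thesis
    unfolding simplex_spline_1[OF subtriangle_146(1) k x_146 assms] subtriangle_146(2) S V by (simp add: field_simps)
qed

text \<open>The interval has length \<open>pp (min b1 b2 - b3)\<close>, which is the minimum of two
  coordinates minus that of all three. The factor 6 is the area ratio 3 times the total 2 of the
  scaled coordinates of the midpoint.\<close>

lemma spline1_110100_1:
  assumes "K = {#a1, a2, (1/3) *\<^sub>R (a1 + a2 + a3), midpoint a1 a2#}"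
  shows "simplex_spline TYPE(1) A K x = 6 * (b1 - pp (b1 - b2) - min b1 (min b2 b3))"
proof -
  have k: "(1 + 1 + 0) *\<^sub>R (midpoint a1 a2) = 1 *\<^sub>R a1 + 1 *\<^sub>R a2 + 0 *\<^sub>R ((1/3) *\<^sub>R (a1 + a2 + a3))" "0 < (1::real) + 1 + 0"
    by (simp_all add: midpoint_def vec_eq_iff forall_2 field_simps)
  have S: "{t::real^1. 0 \<le> t$1 \<and> 1 * t$1 \<le> b1 - b3 \<and> 1 * t$1 \<le> b2 - b3 \<and> 0 * t$1 \<le> 3 * b3} =
      {t::real^1. 0 \<le> t$1 \<and> 0 \<le> t$1 \<and> t$1 \<le> min b1 b2 - b3}"
    using nonneg by auto
  have V: "measure lebesgue {t::real^1. 0 \<le> t$1 \<and> 0 \<le> t$1 \<and> t$1 \<le> min b1 b2 - b3} = b1 - pp (b1 - b2) - min b1 (min b2 b3)"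
    unfolding interval_vec1 by (simp add: pp_def min_def)
  show ?thesis
    unfolding simplex_spline_1[OF subtriangle_1210(1) k x_1210 assms] subtriangle_1210(2) S V by (simp add: field_simps)
qed

text \<open>The four knots are in convex position, so one of them lies outside the triangle of the
  others. Here it is the centroid, with coordinates (-1, 2, 2) / 3; the negative one turns an upper
  bound into a lower bound. The bracket equals
  \<open>pp (b1 - max b2 b3) - pp (b1 - b2 - b3)\<close>.\<close>

lemma spline1_100101_1:
  assumes "K = {#a1, midpoint a1 a2, midpoint a1 a3, (1/3) *\<^sub>R (a1 + a2 + a3)#}"
  shows "simplex_spline TYPE(1) A K x = 12 * (pp (b1 - b2) + pp (b3 - b1) + min b1 (min b2 b3) - b3 - pp (b1 - b2 - b3))"
proof -
  have k: "((- 1) + 2 + 2) *\<^sub>R ((1/3) *\<^sub>R (a1 + a2 + a3)) = (- 1) *\<^sub>R a1 + 2 *\<^sub>R (midpoint a1 a2) + 2 *\<^sub>R (midpoint a1 a3)" "0 < ((- 1)::real) + 2 + 2"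
    by (simp_all add: midpoint_def vec_eq_iff forall_2 field_simps)
  have S: "{t::real^1. 0 \<le> t$1 \<and> (- 1) * t$1 \<le> b1 - b2 - b3 \<and> 2 * t$1 \<le> 2 * b2 \<and> 2 * t$1 \<le> 2 * b3} =
      {t::real^1. 0 \<le> t$1 \<and> b2 + b3 - b1 \<le> t$1 \<and> t$1 \<le> min b2 b3}"
    by auto
  have V: "measure lebesgue {t::real^1. 0 \<le> t$1 \<and> b2 + b3 - b1 \<le> t$1 \<and> t$1 \<le> min b2 b3} = pp (b1 - b2) + pp (b3 - b1) + min b1 (min b2 b3) - b3 - pp (b1 - b2 - b3)"
    unfolding interval_vec1 using nonneg by (simp add: pp_def min_def max_def)
  show ?thesis
    unfolding simplex_spline_1[OF subtriangle_146(1) k x_146 assms] subtriangle_146(2) S V by (simp add: field_simps)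
qed

text \<open>The cyclic sum of truncated differences is the maximum minus the minimum of the
  coordinates, so the inner bracket is the maximum, and the smallest of the three bounds is
  \<open>b1 + b2 + b3\<close> minus twice the maximum. The last three terms, of which at most one is
  nonzero, truncate it at 0.\<close>

lemma spline1_000111_1:
  assumes "K = {#midpoint a1 a2, midpoint a2 a3, midpoint a1 a3, (1/3) *\<^sub>R (a1 + a2 + a3)#}"
  shows "simplex_spline TYPE(1) A K x = 12 * (b1 + b2 + b3 - 2 * (pp (b1 - b2) + pp (b2 - b3) + pp (b3 - b1) + min b1 (min b2 b3))
    + pp (b1 - b2 - b3) + pp (b2 - b1 - b3) + pp (b3 - b1 - b2))"
proof -
  have k: "(1 + 1 + 1) *\<^sub>R ((1/3) *\<^sub>R (a1 + a2 + a3)) = 1 *\<^sub>R (midpoint a1 a2) + 1 *\<^sub>R (midpoint a2 a3) + 1 *\<^sub>R (midpoint a1 a3)" "0 < (1::real) + 1 + 1"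
    by (simp_all add: midpoint_def vec_eq_iff forall_2 field_simps)
  have S: "{t::real^1. 0 \<le> t$1 \<and> 1 * t$1 \<le> b1 + b2 - b3 \<and> 1 * t$1 \<le> b2 + b3 - b1 \<and> 1 * t$1 \<le> b1 + b3 - b2} =
      {t::real^1. 0 \<le> t$1 \<and> 0 \<le> t$1 \<and> t$1 \<le> min (b1 + b2 - b3) (min (b2 + b3 - b1) (b1 + b3 - b2))}"
    by auto
  have V: "measure lebesgue {t::real^1. 0 \<le> t$1 \<and> 0 \<le> t$1 \<and> t$1 \<le> min (b1 + b2 - b3) (min (b2 + b3 - b1) (b1 + b3 - b2))} = b1 + b2 + b3 - 2 * (pp (b1 - b2) + pp (b2 - b3) + pp (b3 - b1) + min b1 (min b2 b3))
    + pp (b1 - b2 - b3) + pp (b2 - b1 - b3) + pp (b3 - b1 - b2)"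
    unfolding interval_vec1 using nonneg by (simp add: pp_def min_def max_def)
  show ?thesis
    unfolding simplex_spline_1[OF subtriangle_456(1) k x_456 assms] subtriangle_456(2) S V by (simp add: field_simps)
qed

lemma spline2_300101:
  assumes "K = {#a1, midpoint a1 a2, midpoint a1 a3, a1, a1#}"
  shows "simplex_spline TYPE(2) A K x = 4 * pp (b1 - b2 - b3) ^ 2"
proof -
  have k: "(1 + 0 + 0) *\<^sub>R a1 = 1 *\<^sub>R a1 + 0 *\<^sub>R (midpoint a1 a2) + 0 *\<^sub>R (midpoint a1 a3)" "0 < (1::real) + 0 + 0"
      "(1 + 0 + 0) *\<^sub>R a1 = 1 *\<^sub>R a1 + 0 *\<^sub>R (midpoint a1 a2) + 0 *\<^sub>R (midpoint a1 a3)" "0 < (1::real) + 0 + 0"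
    by (simp_all add: midpoint_def vec_eq_iff forall_2 field_simps)
  have S: "{t::real^2. 0 \<le> t$1 \<and> 0 \<le> t$2 \<and> 1 * t$1 + 1 * t$2 \<le> b1 - b2 - b3 \<and> 0 * t$1 + 0 * t$2 \<le> 2 * b2 \<and> 0 * t$1 + 0 * t$2 \<le> 2 * b3} =
      {t::real^2. 0 \<le> t$1 \<and> t$1 \<le> pp (b1 - b2 - b3) \<and> 0 \<le> t$2 \<and> t$1 + t$2 \<le> b1 - b2 - b3}"
    using nonneg by (auto simp: pp_def)
  have V: "measure lebesgue {t::real^2. 0 \<le> t$1 \<and> t$1 \<le> pp (b1 - b2 - b3) \<and> 0 \<le> t$2 \<and> t$1 + t$2 \<le> b1 - b2 - b3} = pp (b1 - b2 - b3) ^ 2 / 2"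
    by (subst area_cut_strip) (simp_all add: pp_diff_pp)
  show ?thesis
    unfolding simplex_spline_2[OF subtriangle_146(1) k x_146 assms] subtriangle_146(2) S V by (simp add: field_simps)
qed

lemma spline2_210101:
  assumes "K = {#a1, a2, midpoint a1 a3, midpoint a1 a2, a1#}"
  shows "simplex_spline TYPE(2) A K x = 4 * (pp (b1 - b3) ^ 2 - pp (b1 - b2 - b3) ^ 2)"
proof -
  have k: "(1 + 1 + 0) *\<^sub>R (midpoint a1 a2) = 1 *\<^sub>R a1 + 1 *\<^sub>R a2 + 0 *\<^sub>R (midpoint a1 a3)" "0 < (1::real) + 1 + 0"
      "(1 + 0 + 0) *\<^sub>R a1 = 1 *\<^sub>R a1 + 0 *\<^sub>R a2 + 0 *\<^sub>R (midpoint a1 a3)" "0 < (1::real) + 0 + 0"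
    by (simp_all add: midpoint_def vec_eq_iff forall_2 field_simps)
  have S: "{t::real^2. 0 \<le> t$1 \<and> 0 \<le> t$2 \<and> 1 * t$1 + 1 * t$2 \<le> b1 - b3 \<and> 1 * t$1 + 0 * t$2 \<le> b2 \<and> 0 * t$1 + 0 * t$2 \<le> 2 * b3} =
      {t::real^2. 0 \<le> t$1 \<and> t$1 \<le> b2 \<and> 0 \<le> t$2 \<and> t$1 + t$2 \<le> b1 - b3}"
    using nonneg by auto
  have V: "measure lebesgue {t::real^2. 0 \<le> t$1 \<and> t$1 \<le> b2 \<and> 0 \<le> t$2 \<and> t$1 + t$2 \<le> b1 - b3} = (pp (b1 - b3) ^ 2 - pp (b1 - b2 - b3) ^ 2) / 2"
    by (subst area_cut_strip) (simp_all add: nonneg algebra_simps)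
  show ?thesis
    unfolding simplex_spline_2[OF subtriangle_126(1) k x_126 assms] subtriangle_126(2) S V by (simp add: field_simps)
qed

lemma spline2_111101:
  assumes "K = {#a1, a2, a3, midpoint a1 a2, midpoint a1 a3#}"
  shows "simplex_spline TYPE(2) A K x = 4 * (b1 ^ 2 - pp (b1 - b2) ^ 2 - pp (b1 - b3) ^ 2 + pp (b1 - b2 - b3) ^ 2)"
proof -
  have k: "(1 + 1 + 0) *\<^sub>R (midpoint a1 a2) = 1 *\<^sub>R a1 + 1 *\<^sub>R a2 + 0 *\<^sub>R a3" "0 < (1::real) + 1 + 0"
      "(1 + 0 + 1) *\<^sub>R (midpoint a1 a3) = 1 *\<^sub>R a1 + 0 *\<^sub>R a2 + 1 *\<^sub>R a3" "0 < (1::real) + 0 + 1"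
    by (simp_all add: midpoint_def vec_eq_iff forall_2 field_simps)
  have S: "{t::real^2. 0 \<le> t$1 \<and> 0 \<le> t$2 \<and> 1 * t$1 + 1 * t$2 \<le> b1 \<and> 1 * t$1 + 0 * t$2 \<le> b2 \<and> 0 * t$1 + 1 * t$2 \<le> b3} =
      {t::real^2. 0 \<le> t$1 \<and> t$1 \<le> b2 \<and> 0 \<le> t$2 \<and> t$2 \<le> b3 \<and> t$1 + t$2 \<le> b1}"
    using nonneg by auto
  have V: "measure lebesgue {t::real^2. 0 \<le> t$1 \<and> t$1 \<le> b2 \<and> 0 \<le> t$2 \<and> t$2 \<le> b3 \<and> t$1 + t$2 \<le> b1} = (b1 ^ 2 - pp (b1 - b2) ^ 2 - pp (b1 - b3) ^ 2 + pp (b1 - b2 - b3) ^ 2) / 2"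
    by (subst area_cut_rectangle) (simp_all add: nonneg)
  show ?thesis
    unfolding simplex_spline_2[OF nc k x sum1 assms] subtriangle_123 S V by (simp add: field_simps)
qed

text \<open>The hull of the five knots is a trapezoid, so every choice of anchors leaves a knot
  outside. With the anchors 1, 2, 5 this is the midpoint 6, whose coordinate -1/2 produces the
  difference constraint of \<open>area_hat\<close>.\<close>

lemma spline2_110111:
  assumes "K = {#a1, a2, midpoint a2 a3, midpoint a1 a3, midpoint a1 a2#}"
  shows "simplex_spline TYPE(2) A K x = 8 * (b1 ^ 2 - (b1 + b3 - b2) ^ 2 / 2 + pp (b3 - b2) ^ 2 - pp (b1 - b3) ^ 2
    + (pp (b1 - b2 - b3) ^ 2 + pp (b2 - b1 - b3) ^ 2 - pp (b3 - b1 - b2) ^ 2) / 2)"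
proof -
  have k: "(1 + (- 1) + 2) *\<^sub>R (midpoint a1 a3) = 1 *\<^sub>R a1 + (- 1) *\<^sub>R a2 + 2 *\<^sub>R (midpoint a2 a3)" "0 < (1::real) + (- 1) + 2"
      "(1 + 1 + 0) *\<^sub>R (midpoint a1 a2) = 1 *\<^sub>R a1 + 1 *\<^sub>R a2 + 0 *\<^sub>R (midpoint a2 a3)" "0 < (1::real) + 1 + 0"
    by (simp_all add: midpoint_def vec_eq_iff forall_2 field_simps)
  have S: "{t::real^2. 0 \<le> t$1 \<and> 0 \<le> t$2 \<and> 1 * t$1 + 1 * t$2 \<le> b1 \<and> (- 1) * t$1 + 1 * t$2 \<le> b2 - b3 \<and> 2 * t$1 + 0 * t$2 \<le> 2 * b3} =
      {t::real^2. 0 \<le> t$1 \<and> t$1 \<le> b3 \<and> 0 \<le> t$2 \<and> t$2 + t$1 \<le> b1 \<and> t$2 - t$1 \<le> b2 - b3}"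
    by auto
  have V: "measure lebesgue {t::real^2. 0 \<le> t$1 \<and> t$1 \<le> b3 \<and> 0 \<le> t$2 \<and> t$2 + t$1 \<le> b1 \<and> t$2 - t$1 \<le> b2 - b3} = (b1 ^ 2 - (b1 + b3 - b2) ^ 2 / 2 + pp (b3 - b2) ^ 2 - pp (b1 - b3) ^ 2
    + (pp (b1 - b2 - b3) ^ 2 + pp (b2 - b1 - b3) ^ 2 - pp (b3 - b1 - b2) ^ 2) / 2) / 2"
    unfolding area_hat[OF nonneg] by (rule hat_normal_form[OF nonneg])
  show ?thesis
    unfolding simplex_spline_2[OF subtriangle_125(1) k x_125 assms] subtriangle_125(2) S V by (simp add: field_simps)
qed

lemma spline3_400101:
  assumes "K = {#a1, midpoint a1 a2, midpoint a1 a3, a1, a1, a1#}"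
  shows "simplex_spline TYPE(3) A K x = 4 * pp (b1 - b2 - b3) ^ 3"
proof -
  have k: "(1 + 0 + 0) *\<^sub>R a1 = 1 *\<^sub>R a1 + 0 *\<^sub>R (midpoint a1 a2) + 0 *\<^sub>R (midpoint a1 a3)" "0 < (1::real) + 0 + 0"
      "(1 + 0 + 0) *\<^sub>R a1 = 1 *\<^sub>R a1 + 0 *\<^sub>R (midpoint a1 a2) + 0 *\<^sub>R (midpoint a1 a3)" "0 < (1::real) + 0 + 0"
      "(1 + 0 + 0) *\<^sub>R a1 = 1 *\<^sub>R a1 + 0 *\<^sub>R (midpoint a1 a2) + 0 *\<^sub>R (midpoint a1 a3)" "0 < (1::real) + 0 + 0"
    by (simp_all add: midpoint_def vec_eq_iff forall_2 field_simps)
  have S: "{t::real^3. 0 \<le> t$1 \<and> 0 \<le> t$2 \<and> 0 \<le> t$3 \<and> 1 * t$1 + 1 * t$2 + 1 * t$3 \<le> b1 - b2 - b3 \<and> 0 * t$1 + 0 * t$2 + 0 * t$3 \<le> 2 * b2 \<and> 0 * t$1 + 0 * t$2 + 0 * t$3 \<le> 2 * b3} =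
      {t::real^3. 0 \<le> t$1 \<and> t$1 \<le> pp (b1 - b2 - b3) \<and> 0 \<le> t$2 \<and> t$2 \<le> pp (b1 - b2 - b3) \<and> 0 \<le> t$3 \<and> t$1 + t$2 + t$3 \<le> b1 - b2 - b3}"
    using nonneg by (auto simp: pp_def)
  have V: "measure lebesgue {t::real^3. 0 \<le> t$1 \<and> t$1 \<le> pp (b1 - b2 - b3) \<and> 0 \<le> t$2 \<and> t$2 \<le> pp (b1 - b2 - b3) \<and> 0 \<le> t$3 \<and> t$1 + t$2 + t$3 \<le> b1 - b2 - b3} = pp (b1 - b2 - b3) ^ 3 / 6"
    unfolding volume_cut_prism[OF pp_nonneg pp_nonneg] pp_diff_pp(2) pp_diff_pp(3)[OF pp_nonneg] by simp
  show ?thesis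
    unfolding simplex_spline_3[OF subtriangle_146(1) k x_146 assms] subtriangle_146(2) S V by (simp add: field_simps)
qed

lemma spline3_310101:
  assumes "K = {#a1, a2, midpoint a1 a3, midpoint a1 a2, a1, a1#}"
  shows "simplex_spline TYPE(3) A K x = 4 * (pp (b1 - b3) ^ 3 - pp (b1 - b2 - b3) ^ 3)"
proof -
  have k: "(1 + 1 + 0) *\<^sub>R (midpoint a1 a2) = 1 *\<^sub>R a1 + 1 *\<^sub>R a2 + 0 *\<^sub>R (midpoint a1 a3)" "0 < (1::real) + 1 + 0"
      "(1 + 0 + 0) *\<^sub>R a1 = 1 *\<^sub>R a1 + 0 *\<^sub>R a2 + 0 *\<^sub>R (midpoint a1 a3)" "0 < (1::real) + 0 + 0"
      "(1 + 0 + 0) *\<^sub>R a1 = 1 *\<^sub>R a1 + 0 *\<^sub>R a2 + 0 *\<^sub>R (midpoint a1 a3)" "0 < (1::real) + 0 + 0"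
    by (simp_all add: midpoint_def vec_eq_iff forall_2 field_simps)
  have S: "{t::real^3. 0 \<le> t$1 \<and> 0 \<le> t$2 \<and> 0 \<le> t$3 \<and> 1 * t$1 + 1 * t$2 + 1 * t$3 \<le> b1 - b3 \<and> 1 * t$1 + 0 * t$2 + 0 * t$3 \<le> b2 \<and> 0 * t$1 + 0 * t$2 + 0 * t$3 \<le> 2 * b3} =
      {t::real^3. 0 \<le> t$1 \<and> t$1 \<le> b2 \<and> 0 \<le> t$2 \<and> t$2 \<le> pp (b1 - b3) \<and> 0 \<le> t$3 \<and> t$1 + t$2 + t$3 \<le> b1 - b3}"
    using nonneg by (auto simp: pp_def)
  have V: "measure lebesgue {t::real^3. 0 \<le> t$1 \<and> t$1 \<le> b2 \<and> 0 \<le> t$2 \<and> t$2 \<le> pp (b1 - b3) \<and> 0 \<le> t$3 \<and> t$1 + t$2 + t$3 \<le> b1 - b3} = (pp (b1 - b3) ^ 3 - pp (b1 - b2 - b3) ^ 3) / 6"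
    unfolding volume_cut_prism[OF nonneg(2) pp_nonneg] pp_diff_pp(2) pp_diff_pp(1)[OF nonneg(2)]
    by (simp add: algebra_simps)
  show ?thesis
    unfolding simplex_spline_3[OF subtriangle_126(1) k x_126 assms] subtriangle_126(2) S V by (simp add: field_simps)
qed

text \<open>The midpoint is the free knot that loads two coordinates and thus becomes the shared
  variable. The spline is symmetric in \<open>b1\<close> and \<open>b2\<close>, although the normal
  form favours one orientation of their chord.\<close>

lemma spline3_221100:
  assumes "K = {#a1, a2, a3, midpoint a1 a2, a1, a2#}"
  shows "simplex_spline TYPE(3) A K x = 6 * b1 * b2 ^ 2 - 2 * b2 ^ 3 + 2 * pp (b2 - b1) ^ 3"
proof -
  have k: "(1 + 1 + 0) *\<^sub>R (midpoint a1 a2) = 1 *\<^sub>R a1 + 1 *\<^sub>R a2 + 0 *\<^sub>R a3" "0 < (1::real) + 1 + 0"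
      "(1 + 0 + 0) *\<^sub>R a1 = 1 *\<^sub>R a1 + 0 *\<^sub>R a2 + 0 *\<^sub>R a3" "0 < (1::real) + 0 + 0"
      "(0 + 1 + 0) *\<^sub>R a2 = 0 *\<^sub>R a1 + 1 *\<^sub>R a2 + 0 *\<^sub>R a3" "0 < (0::real) + 1 + 0"
    by (simp_all add: midpoint_def vec_eq_iff forall_2 field_simps)
  have S: "{t::real^3. 0 \<le> t$1 \<and> 0 \<le> t$2 \<and> 0 \<le> t$3 \<and> 1 * t$1 + 1 * t$2 + 0 * t$3 \<le> b1 \<and> 1 * t$1 + 0 * t$2 + 1 * t$3 \<le> b2 \<and> 0 * t$1 + 0 * t$2 + 0 * t$3 \<le> b3} =
      {t::real^3. 0 \<le> t$1 \<and> 0 \<le> t$2 \<and> 0 \<le> t$3 \<and> t$2 + t$1 \<le> b1 \<and> t$3 + t$1 \<le> b2}"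
    using nonneg by auto
  have V: "measure lebesgue {t::real^3. 0 \<le> t$1 \<and> 0 \<le> t$2 \<and> 0 \<le> t$3 \<and> t$2 + t$1 \<le> b1 \<and> t$3 + t$1 \<le> b2} = b1 * b2 ^ 2 / 2 - b2 ^ 3 / 6 + pp (b2 - b1) ^ 3 / 6"
    unfolding volume_two_constraints[OF nonneg(1,2)] by (rule two_constraints_normal_form)
  show ?thesis
    unfolding simplex_spline_3[OF nc k x sum1 assms] subtriangle_123 S V by (simp add: field_simps)
qed

lemma spline3_211101:
  assumes "K = {#a1, a2, a3, midpoint a1 a2, midpoint a1 a3, a1#}"
  shows "simplex_spline TYPE(3) A K x = 4 * (b1 ^ 3 - pp (b1 - b2) ^ 3 - pp (b1 - b3) ^ 3 + pp (b1 - b2 - b3) ^ 3)"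
proof -
  have k: "(1 + 1 + 0) *\<^sub>R (midpoint a1 a2) = 1 *\<^sub>R a1 + 1 *\<^sub>R a2 + 0 *\<^sub>R a3" "0 < (1::real) + 1 + 0"
      "(1 + 0 + 1) *\<^sub>R (midpoint a1 a3) = 1 *\<^sub>R a1 + 0 *\<^sub>R a2 + 1 *\<^sub>R a3" "0 < (1::real) + 0 + 1"
      "(1 + 0 + 0) *\<^sub>R a1 = 1 *\<^sub>R a1 + 0 *\<^sub>R a2 + 0 *\<^sub>R a3" "0 < (1::real) + 0 + 0"
    by (simp_all add: midpoint_def vec_eq_iff forall_2 field_simps)
  have S: "{t::real^3. 0 \<le> t$1 \<and> 0 \<le> t$2 \<and> 0 \<le> t$3 \<and> 1 * t$1 + 1 * t$2 + 1 * t$3 \<le> b1 \<and> 1 * t$1 + 0 * t$2 + 0 * t$3 \<le> b2 \<and> 0 * t$1 + 1 * t$2 + 0 * t$3 \<le> b3} =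
      {t::real^3. 0 \<le> t$1 \<and> t$1 \<le> b2 \<and> 0 \<le> t$2 \<and> t$2 \<le> b3 \<and> 0 \<le> t$3 \<and> t$1 + t$2 + t$3 \<le> b1}"
    using nonneg by auto
  have V: "measure lebesgue {t::real^3. 0 \<le> t$1 \<and> t$1 \<le> b2 \<and> 0 \<le> t$2 \<and> t$2 \<le> b3 \<and> 0 \<le> t$3 \<and> t$1 + t$2 + t$3 \<le> b1} = (b1 ^ 3 - pp (b1 - b2) ^ 3 - pp (b1 - b3) ^ 3 + pp (b1 - b2 - b3) ^ 3) / 6"
    by (subst volume_cut_prism) (simp_all add: nonneg)
  show ?thesis
    unfolding simplex_spline_3[OF nc k x sum1 assms] subtriangle_123 S V by (simp add: field_simps)
qed

text \<open>Each midpoint loads the coordinates of the two endpoints of its side, which gives three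
  pairwise constraints on three variables.\<close>

lemma spline3_111111:
  assumes "K = {#a1, a2, a3, midpoint a1 a2, midpoint a2 a3, midpoint a1 a3#}"
  shows "simplex_spline TYPE(3) A K x = 24 * (b3 ^ 2 * b1 - b3 ^ 3 / 3 - (b1 + b3 - b2) ^ 3 / 6
    + (pp (b1 - b2) ^ 3 + pp (b3 - b1) ^ 3 + pp (b3 - b2) ^ 3) / 3
    - (pp (b1 - b2 - b3) ^ 3 + pp (b2 - b1 - b3) ^ 3 + pp (b3 - b1 - b2) ^ 3) / 6)"
proof -
  have k: "(1 + 1 + 0) *\<^sub>R (midpoint a1 a2) = 1 *\<^sub>R a1 + 1 *\<^sub>R a2 + 0 *\<^sub>R a3" "0 < (1::real) + 1 + 0"
      "(0 + 1 + 1) *\<^sub>R (midpoint a2 a3) = 0 *\<^sub>R a1 + 1 *\<^sub>R a2 + 1 *\<^sub>R a3" "0 < (0::real) + 1 + 1"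
      "(1 + 0 + 1) *\<^sub>R (midpoint a1 a3) = 1 *\<^sub>R a1 + 0 *\<^sub>R a2 + 1 *\<^sub>R a3" "0 < (1::real) + 0 + 1"
    by (simp_all add: midpoint_def vec_eq_iff forall_2 field_simps)
  have S: "{t::real^3. 0 \<le> t$1 \<and> 0 \<le> t$2 \<and> 0 \<le> t$3 \<and> 1 * t$1 + 0 * t$2 + 1 * t$3 \<le> b1 \<and> 1 * t$1 + 1 * t$2 + 0 * t$3 \<le> b2 \<and> 0 * t$1 + 1 * t$2 + 1 * t$3 \<le> b3} =
      {t::real^3. 0 \<le> t$1 \<and> 0 \<le> t$2 \<and> 0 \<le> t$3 \<and> t$1 + t$3 \<le> b1 \<and> t$1 + t$2 \<le> b2 \<and> t$2 + t$3 \<le> b3}"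
    by auto
  have V: "measure lebesgue {t::real^3. 0 \<le> t$1 \<and> 0 \<le> t$2 \<and> 0 \<le> t$3 \<and> t$1 + t$3 \<le> b1 \<and> t$1 + t$2 \<le> b2 \<and> t$2 + t$3 \<le> b3} = (b3 ^ 2 * b1 - b3 ^ 3 / 3 - (b1 + b3 - b2) ^ 3 / 6
    + (pp (b1 - b2) ^ 3 + pp (b3 - b1) ^ 3 + pp (b3 - b2) ^ 3) / 3
    - (pp (b1 - b2 - b3) ^ 3 + pp (b2 - b1 - b3) ^ 3 + pp (b3 - b1 - b2) ^ 3) / 6) / 2"
    unfolding volume_three_constraints[OF nonneg] by (rule three_constraints_normal_form[OF nonneg])
  show ?thesis
    unfolding simplex_spline_3[OF nc k x sum1 assms] subtriangle_123 S V by (simp add: field_simps)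
qed

text \<open>All free knots are vertices, so the polytope is a box and the spline is a cubic
  Bernstein polynomial.\<close>

lemma spline3_222000:
  assumes "K = {#a1, a2, a3, a1, a2, a3#}"
  shows "simplex_spline TYPE(3) A K x = 6 * b1 * b2 * b3"
proof -
  have k: "(1 + 0 + 0) *\<^sub>R a1 = 1 *\<^sub>R a1 + 0 *\<^sub>R a2 + 0 *\<^sub>R a3" "0 < (1::real) + 0 + 0"
      "(0 + 1 + 0) *\<^sub>R a2 = 0 *\<^sub>R a1 + 1 *\<^sub>R a2 + 0 *\<^sub>R a3" "0 < (0::real) + 1 + 0"
      "(0 + 0 + 1) *\<^sub>R a3 = 0 *\<^sub>R a1 + 0 *\<^sub>R a2 + 1 *\<^sub>R a3" "0 < (0::real) + 0 + 1"
    by (simp_all add: midpoint_def vec_eq_iff forall_2 field_simps)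
  have S: "{t::real^3. 0 \<le> t$1 \<and> 0 \<le> t$2 \<and> 0 \<le> t$3 \<and> 1 * t$1 + 0 * t$2 + 0 * t$3 \<le> b1 \<and> 0 * t$1 + 1 * t$2 + 0 * t$3 \<le> b2 \<and> 0 * t$1 + 0 * t$2 + 1 * t$3 \<le> b3} =
      {t. \<forall>i. 0 \<le> t$i \<and> t$i \<le> vec3 b1 (vec2 b2 b3) $ i}"
    by (auto simp: forall_3)
  have V: "measure lebesgue {t. \<forall>i. 0 \<le> t$i \<and> t$i \<le> vec3 b1 (vec2 b2 b3) $ i} = b1 * b2 * b3"
  proof -
    have *: "0 \<le> vec3 b1 (vec2 b2 b3) $ i" for i
      using nonneg by (simp add: vec3_def)
    show ?thesis unfolding measure_box_vec[OF *] UNIV_3 by (simp add: mult.assoc)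
  qed
  show ?thesis
    unfolding simplex_spline_3[OF nc k x sum1 assms] subtriangle_123 S V by (simp add: field_simps)
qed

end

section \<open>Differentiability classes and bivariate polynomials\<close>

lemma Ck_on_cong:
  assumes "\<And>x. x \<in> S \<Longrightarrow> f x = g x" "Ck_on r S f"
  shows "Ck_on r S g"
proof (cases r)
  case 0
  then show ?thesis using assms continuous_on_cong[of S S f g] by simp
next
  case (Suc r')
  then obtain g1 g2 where g: "Ck_on r' S g1" "Ck_on r' S g2"
    and d: "\<And>x. x \<in> S \<Longrightarrow> (f has_derivative (\<lambda>v. g1 x * v$1 + g2 x * v$2)) (at x within S)"
    using assms(2) by auto
  have "(g has_derivative (\<lambda>v. g1 x * v$1 + g2 x * v$2)) (at x within S)" if "x \<in> S" for x
    by (rule has_derivative_transform[OF that assms(1)[symmetric] d[OF that]])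
  with g Suc show ?thesis by auto
qed

lemma Ck_on_SucD: "Ck_on (Suc r) S f \<Longrightarrow> Ck_on r S f"
proof (induction r arbitrary: f)
  case 0
  then have "\<And>x. x \<in> S \<Longrightarrow> \<exists>f'. (f has_derivative f') (at x within S)" by auto
  then show ?case
    by (auto simp: continuous_on_eq_continuous_within intro: has_derivative_continuous)
next
  case (Suc r)
  from Suc.prems obtain g1 g2 where g: "Ck_on (Suc r) S g1" "Ck_on (Suc r) S g2"
    and d: "\<forall>x\<in>S. (f has_derivative (\<lambda>v. g1 x * v$1 + g2 x * v$2)) (at x within S)"
    by (subst (asm) Ck_on.simps(2)) blast
  from Suc.IH[OF g(1)] Suc.IH[OF g(2)] d show ?case
    by (subst Ck_on.simps(2)) blast
qed

lemma Ck_on_const: "Ck_on r S (\<lambda>_. c)"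
proof (induction r arbitrary: c)
  case (Suc r)
  show ?case
    by (subst Ck_on.simps(2), intro exI[of _ "\<lambda>_. 0"]) (use Suc in auto)
qed simp

lemma Ck_on_add: "Ck_on r S f \<Longrightarrow> Ck_on r S g \<Longrightarrow> Ck_on r S (\<lambda>x. f x + g x)"
proof (induction r arbitrary: f g)
  case 0
  then show ?case by (simp add: continuous_on_add)
next
  case (Suc r)
  from Suc.prems(1) obtain f1 f2 where f: "Ck_on r S f1" "Ck_on r S f2"
    and df: "\<forall>x\<in>S. (f has_derivative (\<lambda>v. f1 x * v$1 + f2 x * v$2)) (at x within S)"
    by (subst (asm) Ck_on.simps(2)) blast
  from Suc.prems(2) obtain g1 g2 where g: "Ck_on r S g1" "Ck_on r S g2"
    and dg: "\<forall>x\<in>S. (g has_derivative (\<lambda>v. g1 x * v$1 + g2 x * v$2)) (at x within S)"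
    by (subst (asm) Ck_on.simps(2)) blast
  have "\<forall>x\<in>S. ((\<lambda>x. f x + g x) has_derivative (\<lambda>v. (f1 x + g1 x) * v$1 + (f2 x + g2 x) * v$2)) (at x within S)"
  proof
    fix x assume "x \<in> S"
    then show "((\<lambda>x. f x + g x) has_derivative (\<lambda>v. (f1 x + g1 x) * v$1 + (f2 x + g2 x) * v$2)) (at x within S)"
      using has_derivative_add[OF df[rule_format] dg[rule_format]] by (simp add: algebra_simps)
  qed
  with Suc.IH[OF f(1) g(1)] Suc.IH[OF f(2) g(2)] show ?case
    by (subst Ck_on.simps(2)) blast
qed

text \<open>The partial derivatives of a product contain \<open>f\<close> and \<open>g\<close>
  themselves, so the induction uses that both factors also belong to the class one step
  lower.\<close>

lemma Ck_on_mult: "Ck_on r S f \<Longrightarrow> Ck_on r S g \<Longrightarrow> Ck_on r S (\<lambda>x. f x * g x)"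
proof (induction r arbitrary: f g)
  case 0
  then show ?case by (simp add: continuous_on_mult)
next
  case (Suc r)
  note fr = Ck_on_SucD[OF Suc.prems(1)] and gr = Ck_on_SucD[OF Suc.prems(2)]
  from Suc.prems(1) obtain f1 f2 where f: "Ck_on r S f1" "Ck_on r S f2"
    and df: "\<forall>x\<in>S. (f has_derivative (\<lambda>v. f1 x * v$1 + f2 x * v$2)) (at x within S)"
    by (subst (asm) Ck_on.simps(2)) blast
  from Suc.prems(2) obtain g1 g2 where g: "Ck_on r S g1" "Ck_on r S g2"
    and dg: "\<forall>x\<in>S. (g has_derivative (\<lambda>v. g1 x * v$1 + g2 x * v$2)) (at x within S)"
    by (subst (asm) Ck_on.simps(2)) blast
  have "\<forall>x\<in>S. ((\<lambda>x. f x * g x) has_derivative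
      (\<lambda>v. (f x * g1 x + f1 x * g x) * v$1 + (f x * g2 x + f2 x * g x) * v$2)) (at x within S)"
  proof
    fix x assume "x \<in> S"
    then show "((\<lambda>x. f x * g x) has_derivative
      (\<lambda>v. (f x * g1 x + f1 x * g x) * v$1 + (f x * g2 x + f2 x * g x) * v$2)) (at x within S)"
      using has_derivative_mult[OF df[rule_format] dg[rule_format]] by (simp add: algebra_simps)
  qed
  moreover have "Ck_on r S (\<lambda>x. f x * g1 x + f1 x * g x)" "Ck_on r S (\<lambda>x. f x * g2 x + f2 x * g x)"
    by (intro Ck_on_add Suc.IH fr gr f g)+
  ultimately show ?case
    by (subst Ck_on.simps(2)) blast
qed

section \<open>Affine functions and their truncated powers\<close>

definition affine_function :: "(real^2 \<Rightarrow> real) \<Rightarrow> bool" where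
  "affine_function f \<longleftrightarrow> (\<exists>\<alpha> \<beta> \<gamma>. \<forall>x. f x = \<alpha> * x$1 + \<beta> * x$2 + \<gamma>)"

lemma affine_functionE:
  assumes "affine_function f"
  obtains \<alpha> \<beta> \<gamma> where "f = (\<lambda>x. \<alpha> * x$1 + \<beta> * x$2 + \<gamma>)"
  using assms unfolding affine_function_def by (metis ext)

lemma affine_function_add:
  assumes "affine_function f" "affine_function g"
  shows "affine_function (\<lambda>x. f x + g x)"
proof -
  obtain a b c where f: "f = (\<lambda>x. a * x$1 + b * x$2 + c)" using assms(1) by (rule affine_functionE)
  obtain a' b' c' where g: "g = (\<lambda>x. a' * x$1 + b' * x$2 + c')" using assms(2) by (rule affine_functionE)
  show ?thesis unfolding affine_function_def f g
    by (intro exI[of _ "a + a'"] exI[of _ "b + b'"] exI[of _ "c + c'"]) (simp add: algebra_simps)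
qed

lemma affine_function_cmult:
  assumes "affine_function f"
  shows "affine_function (\<lambda>x. k * f x)"
proof -
  obtain a b c where f: "f = (\<lambda>x. a * x$1 + b * x$2 + c)" using assms by (rule affine_functionE)
  show ?thesis unfolding affine_function_def f
    by (intro exI[of _ "k * a"] exI[of _ "k * b"] exI[of _ "k * c"]) (simp add: algebra_simps)
qed

lemma affine_function_diff:
  assumes "affine_function f" "affine_function g"
  shows "affine_function (\<lambda>x. f x - g x)"
  using affine_function_add[OF assms(1) affine_function_cmult[OF assms(2), of "- 1"]] by simp

lemma affine_function_bary: "affine_function (bary a b c)"
  unfolding affine_function_def bary_def cross2_def[of "_ - _ :: real^2"]
  by (intro exI[of _ "(b$2 - c$2) / cross2 (b - a) (c - a)"] exI[of _ "(c$1 - b$1) / cross2 (b - a) (c - a)"]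
      exI[of _ "(b$1 * c$2 - b$2 * c$1) / cross2 (b - a) (c - a)"])
    (simp add: cross2_def add_divide_distrib[symmetric] algebra_simps)

lemma affine_function_has_derivative:
  "((\<lambda>x::real^2. a * x$1 + b * x$2 + c) has_derivative (\<lambda>v. a * v$1 + b * v$2)) (at x within S)"
  by (auto intro!: derivative_eq_intros bounded_linear.has_derivative[OF bounded_linear_vec_nth])

lemma Ck_on_affine:
  assumes "affine_function f"
  shows "Ck_on r S f"
proof -
  obtain a b c where f: "f = (\<lambda>x. a * x$1 + b * x$2 + c)" using assms by (rule affine_functionE)
  show ?thesis
  proof (cases r)
    case 0
    then show ?thesis unfolding f by (auto intro!: continuous_intros)
  next
    case (Suc r')
    show ?thesis unfolding Suc f
      by (subst Ck_on.simps(2), intro exI[of _ "\<lambda>_. a"] exI[of _ "\<lambda>_. b"])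
        (simp add: Ck_on_const affine_function_has_derivative)
  qed
qed

text \<open>The gradient of a truncated power of an affine function is a constant vector times the
  next lower truncated power; the exponent r + 1 leaves a continuous function after r
  differentiations.\<close>

lemma Ck_on_pp_power:
  assumes "affine_function f"
  shows "Ck_on r S (\<lambda>x. pp (f x) ^ Suc r)"
proof -
  obtain a b c where f: "f = (\<lambda>x. a * x$1 + b * x$2 + c)" using assms by (rule affine_functionE)
  show ?thesis
  proof (induction r)
    case 0
    then show ?case unfolding f by (auto intro!: continuous_intros)
  next
    case (Suc r)
    have "((\<lambda>x. pp (f x) ^ Suc (Suc r)) has_derivative
      (\<lambda>v. (a * real (Suc (Suc r))) * pp (f x) ^ Suc r * v$1 + (b * real (Suc (Suc r))) * pp (f x) ^ Suc r * v$2))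
        (at x within S)" for x
      using DERIV_compose_FDERIV[OF DERIV_pp_power[of r] affine_function_has_derivative[of a b c x S]]
      unfolding f by (simp add: algebra_simps)
    moreover have "Ck_on r S (\<lambda>x. k * pp (f x) ^ Suc r)" for k
      by (intro Ck_on_mult Ck_on_const Suc.IH)
    ultimately show ?case
      by (subst Ck_on.simps(2)) blast
  qed
qed

section \<open>Closure properties of bivariate polynomials\<close>

lemma polys_upto_add:
  assumes "f \<in> polys_upto d" "g \<in> polys_upto d"
  shows "(\<lambda>x. f x + g x) \<in> polys_upto d"
proof -
  obtain c where c: "\<forall>x. f x = (\<Sum>i\<le>d. \<Sum>j\<le>d - i. c i j * (x$1)^i * (x$2)^j)"
    using assms(1) by (auto simp: polys_upto_def)
  obtain e where e: "\<forall>x. g x = (\<Sum>i\<le>d. \<Sum>j\<le>d - i. e i j * (x$1)^i * (x$2)^j)"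
    using assms(2) by (auto simp: polys_upto_def)
  show ?thesis unfolding polys_upto_def mem_Collect_eq
    by (intro exI[of _ "\<lambda>i j. c i j + e i j"] allI)
      (simp only: c e sum.distrib[symmetric] distrib_right)
qed

lemma polys_upto_cmult:
  assumes "f \<in> polys_upto d"
  shows "(\<lambda>x. k * f x) \<in> polys_upto d"
proof -
  obtain c where c: "\<forall>x. f x = (\<Sum>i\<le>d. \<Sum>j\<le>d - i. c i j * (x$1)^i * (x$2)^j)"
    using assms(1) by (auto simp: polys_upto_def)
  show ?thesis unfolding polys_upto_def mem_Collect_eq
    by (intro exI[of _ "\<lambda>i j. k * c i j"] allI)
      (simp only: c sum_distrib_left mult.assoc)
qed

lemma polys_upto_monomial:
  assumes "i + j \<le> d"
  shows "(\<lambda>x. (x$1)^i * (x$2)^j) \<in> polys_upto d"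
proof -
  have "(\<Sum>i'\<le>d. \<Sum>j'\<le>d - i'. (if i' = i \<and> j' = j then 1 else 0) * (x$1)^i' * (x$2)^j') = (x$1)^i * (x$2)^j"
    for x :: "real^2"
  proof -
    have "(\<Sum>j'\<le>d - i'. (if i' = i \<and> j' = j then 1 else 0) * (x$1)^i' * (x$2)^j') =
        (if i' = i then (x$1)^i * (x$2)^j else 0)" if "i' \<le> d" for i'
    proof (cases "i' = i")
      case True
      have "(\<Sum>j'\<le>d - i. (if j' = j then 1 else 0) * (x$1)^i * (x$2)^j') =
          (\<Sum>j'\<le>d - i. if j' = j then (x$1)^i * (x$2)^j' else 0)"
        by (intro sum.cong) auto
      then show ?thesis using True assms by (simp add: sum.delta)
    qed simp
    then have "(\<Sum>i'\<le>d. \<Sum>j'\<le>d - i'. (if i' = i \<and> j' = j then 1 else 0) * (x$1)^i' * (x$2)^j') =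
        (\<Sum>i'\<le>d. if i' = i then (x$1)^i * (x$2)^j else 0)"
      by (intro sum.cong) auto
    then show ?thesis using assms by (simp add: sum.delta)
  qed
  then show ?thesis unfolding polys_upto_def mem_Collect_eq
    by (intro exI[of _ "\<lambda>i' j'. if i' = i \<and> j' = j then 1 else 0"] allI) (rule sym)
qed

lemma polys_upto_sum:
  "finite I \<Longrightarrow> (\<And>i. i \<in> I \<Longrightarrow> f i \<in> polys_upto d) \<Longrightarrow> (\<lambda>x. \<Sum>i\<in>I. f i x) \<in> polys_upto d"
proof (induction I rule: finite_induct)
  case empty
  show ?case using polys_upto_cmult[OF polys_upto_monomial[of 0 0 d], of 0] by simp
next
  case (insert i I)
  then show ?case using polys_upto_add by simp
qed

lemma polys_upto_affine_mult:
  assumes "affine_function f" "g \<in> polys_upto d"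
  shows "(\<lambda>x. f x * g x) \<in> polys_upto (Suc d)"
proof -
  obtain a b c where f: "f = (\<lambda>x. a * x$1 + b * x$2 + c)" using assms(1) by (rule affine_functionE)
  obtain e where "\<forall>x. g x = (\<Sum>i\<le>d. \<Sum>j\<le>d - i. e i j * (x$1)^i * (x$2)^j)"
    using assms(2) by (auto simp: polys_upto_def)
  then have g: "g = (\<lambda>x. \<Sum>i\<le>d. \<Sum>j\<le>d - i. e i j * (x$1)^i * (x$2)^j)" by auto
  have "(\<lambda>x. \<Sum>i\<le>d. \<Sum>j\<le>d - i. (a * e i j) * ((x$1)^Suc i * (x$2)^j) +
      (b * e i j) * ((x$1)^i * (x$2)^Suc j) + (c * e i j) * ((x$1)^i * (x$2)^j)) \<in> polys_upto (Suc d)"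
    by (intro polys_upto_sum polys_upto_add polys_upto_cmult polys_upto_monomial) auto
  moreover have "(\<lambda>x. \<Sum>i\<le>d. \<Sum>j\<le>d - i. (a * e i j) * ((x$1)^Suc i * (x$2)^j) +
      (b * e i j) * ((x$1)^i * (x$2)^Suc j) + (c * e i j) * ((x$1)^i * (x$2)^j)) = (\<lambda>x. f x * g x)"
    unfolding f g sum_distrib_left by (intro ext sum.cong refl) (simp add: algebra_simps)
  ultimately show ?thesis by simp
qed

lemma polys_upto_const: "(\<lambda>_. c) \<in> polys_upto d"
  using polys_upto_cmult[OF polys_upto_monomial[of 0 0 d], of c] by simp

lemma polys_upto_affine_power:
  assumes "affine_function f"
  shows "(\<lambda>x. f x ^ d) \<in> polys_upto d"
  by (induction d) (use polys_upto_affine_mult[OF assms] polys_upto_const[of 1 0] in auto)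

text \<open>Reduces sign questions on a subtriangle to its three vertices.\<close>

lemma affine_function_nonneg_on_hull:
  assumes "affine_function f" "\<And>v. v \<in> V \<Longrightarrow> 0 \<le> f v" "x \<in> convex hull V"
  shows "0 \<le> f x"
proof -
  obtain a b c where f: "f = (\<lambda>x. a * x$1 + b * x$2 + c)" using assms(1) by (rule affine_functionE)
  have "convex {x. 0 \<le> f x}"
  proof (rule convexI)
    fix x y u v assume *: "x \<in> {x. 0 \<le> f x}" "y \<in> {x. 0 \<le> f x}" "0 \<le> u" "0 \<le> v" "u + v = (1::real)"
    then have v: "v = 1 - u" by simp
    have "f (u *\<^sub>R x + v *\<^sub>R y) = u * f x + v * f y"
      unfolding f v by (simp add: algebra_simps)
    with * show "u *\<^sub>R x + v *\<^sub>R y \<in> {x. 0 \<le> f x}" by simp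
  qed
  then have "convex hull V \<subseteq> {x. 0 \<le> f x}" using assms(2) by (intro hull_minimal) auto
  with assms(3) show ?thesis by auto
qed

section \<open>The five bases and their quasi-interpolants\<close>

text \<open>Every index other than 1 and 2 stands for the third coordinate, so \<open>bc p i\<close>
  is affine for all \<open>i\<close>.\<close>

definition bc :: "(nat \<Rightarrow> real^2) \<Rightarrow> nat \<Rightarrow> real^2 \<Rightarrow> real" where
  "bc p i = (if i = 1 then bary (p 1) (p 2) (p 3) else if i = 2 then bary (p 2) (p 3) (p 1)
     else bary (p 3) (p 1) (p 2))"

text \<open>The orderings of the vertices: a closed form proved for a labelled triangle serves for
  all its images under the symmetries.\<close>

definition perms3 :: "(nat \<times> nat \<times> nat) set" where
  "perms3 = {(1,2,3), (1,3,2), (2,1,3), (2,3,1), (3,1,2), (3,2,1)}"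

text \<open>
  Up to permutation of the vertices, \<open>corner\<close> is Q[200101], Q[300101], Q[400101] for d = 1, 2, 3,
  \<open>edge\<close> is Q[210101], Q[310101], and \<open>face\<close> is Q[111101], Q[211101] for d = 2, 3. The others
  are \<open>mid1\<close> = Q[110100;1], \<open>inner1\<close> = Q[100101;1], \<open>center1\<close> = Q[000111;1], \<open>mid2\<close> = Q[110111],
  \<open>mid3\<close> = Q[221100], \<open>center3\<close> = Q[111111] and \<open>bernstein3\<close> = Q[222000].
\<close>

definition corner :: "nat \<Rightarrow> real \<Rightarrow> real \<Rightarrow> real \<Rightarrow> real" where
  "corner d b1 b2 b3 = 4 * pp (b1 - b2 - b3) ^ d"

definition edge :: "nat \<Rightarrow> real \<Rightarrow> real \<Rightarrow> real \<Rightarrow> real" where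
  "edge d b1 b2 b3 = 4 * (pp (b1 - b3) ^ d - pp (b1 - b2 - b3) ^ d)"

definition face :: "nat \<Rightarrow> real \<Rightarrow> real \<Rightarrow> real \<Rightarrow> real" where
  "face d b1 b2 b3 = 4 * (b1 ^ d - pp (b1 - b2) ^ d - pp (b1 - b3) ^ d + pp (b1 - b2 - b3) ^ d)"

definition mid1 :: "real \<Rightarrow> real \<Rightarrow> real \<Rightarrow> real" where
  "mid1 b1 b2 b3 = 6 * (b1 - pp (b1 - b2) - min b1 (min b2 b3))"

definition inner1 :: "real \<Rightarrow> real \<Rightarrow> real \<Rightarrow> real" where
  "inner1 b1 b2 b3 = 12 * (pp (b1 - b2) + pp (b3 - b1) + min b1 (min b2 b3) - b3 - pp (b1 - b2 - b3))"

definition center1 :: "real \<Rightarrow> real \<Rightarrow> real \<Rightarrow> real" where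
  "center1 b1 b2 b3 = 12 * (b1 + b2 + b3
     - 2 * (pp (b1 - b2) + pp (b2 - b3) + pp (b3 - b1) + min b1 (min b2 b3))
     + pp (b1 - b2 - b3) + pp (b2 - b1 - b3) + pp (b3 - b1 - b2))"

definition mid2 :: "real \<Rightarrow> real \<Rightarrow> real \<Rightarrow> real" where
  "mid2 b1 b2 b3 = 8 * (b1 ^ 2 - (b1 + b3 - b2) ^ 2 / 2 + pp (b3 - b2) ^ 2 - pp (b1 - b3) ^ 2
    + (pp (b1 - b2 - b3) ^ 2 + pp (b2 - b1 - b3) ^ 2 - pp (b3 - b1 - b2) ^ 2) / 2)"

definition mid3 :: "real \<Rightarrow> real \<Rightarrow> real \<Rightarrow> real" where
  "mid3 b1 b2 b3 = 6 * b1 * b2 ^ 2 - 2 * b2 ^ 3 + 2 * pp (b2 - b1) ^ 3"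

definition center3 :: "real \<Rightarrow> real \<Rightarrow> real \<Rightarrow> real" where
  "center3 b1 b2 b3 = 24 * (b3 ^ 2 * b1 - b3 ^ 3 / 3 - (b1 + b3 - b2) ^ 3 / 6
    + (pp (b1 - b2) ^ 3 + pp (b3 - b1) ^ 3 + pp (b3 - b2) ^ 3) / 3
    - (pp (b1 - b2 - b3) ^ 3 + pp (b2 - b1 - b3) ^ 3 + pp (b3 - b1 - b2) ^ 3) / 6)"

definition bernstein3 :: "real \<Rightarrow> real \<Rightarrow> real \<Rightarrow> real" where
  "bernstein3 b1 b2 b3 = 6 * b1 * b2 * b3"

section \<open>Evaluation of the dual functionals and of the knot multisets\<close>

text \<open>A sum over a zipped list lets simplification run through the literal lists of basis
  elements and dual points.\<close>

lemma quasi_interp_zip: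
  assumes "length B = length duals"
  shows "quasi_interp D p B duals F x =
    (\<Sum>(b, js)\<leftarrow>zip B duals. dual_functional (map p js) F * (fst b * Qspline D p (snd b) x))"
  using assms unfolding quasi_interp_def
  by (simp add: sum_list_sum_nth atLeast0LessThan case_prod_unfold)

lemma card_1_subsets:
  "{K. K \<subseteq> {..<n::nat} \<and> card K = 1} = (\<lambda>i. {i}) ` {..<n}"
  by (auto simp: card_1_singleton_iff)

lemma card_full_subsets:
  "{K. K \<subseteq> {..<n::nat} \<and> card K = n} = {{..<n}}"
  by (auto dest: card_subset_eq[rotated])

lemma card_2_subsets:
  "{K. K \<subseteq> {..<3::nat} \<and> card K = 2} = {{0, 1}, {0, 2}, {1, 2}}"
proof (intro set_eqI iffI)
  fix K assume "K \<in> {K. K \<subseteq> {..<3::nat} \<and> card K = 2}"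
  then obtain x y where "K = {x, y}" "x \<noteq> y" "x < 3" "y < 3"
    by (auto simp: card_2_iff)
  moreover from this have "x = 0 \<or> x = 1 \<or> x = 2" "y = 0 \<or> y = 1 \<or> y = 2" by linarith+
  ultimately show "K \<in> {{0, 1}, {0, 2}, {1, 2}}"
    by (elim disjE) (simp_all add: insert_commute)
qed auto

lemma dual_functional_1: "dual_functional [a] F = F a"
proof -
  have "{..<1::nat} = {0}" by auto
  then show ?thesis
    using card_1_subsets[of 1] by (simp add: dual_functional_def)
qed

lemma dual_functional_2:
  "dual_functional [a, b] F = 2 * F ((1/2) *\<^sub>R (a + b)) - (F a + F b) / 2"
proof -
  have m: "{1..2::nat} = {1, 2}" and n: "{..<2::nat} = {0, 1}" by auto
  have 1: "(\<Sum>K | K \<subseteq> {..<2::nat} \<and> card K = 1. f K) = f {0} + f {1}" for f :: "_ \<Rightarrow> real"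
    unfolding card_1_subsets by (simp add: n sum.reindex)
  have 2: "(\<Sum>K | K \<subseteq> {..<2::nat} \<and> card K = 2. f K) = f {0, 1}" for f :: "_ \<Rightarrow> real"
    unfolding card_full_subsets by (simp add: n)
  have l: "length [a, b] = 2" by simp
  show ?thesis
    unfolding dual_functional_def l Let_def m by (simp add: 1 2 fact_numeral field_simps del: One_nat_def)
qed

text \<open>The coefficients 9/2, 4/3 and 1/6 are m^3 / 3! for m = 3, 2, 1.\<close>

lemma dual_functional_3:
  "dual_functional [a, b, c] F = 9/2 * F ((1/3) *\<^sub>R (a + b + c)) -
     4/3 * (F ((1/2) *\<^sub>R (a + b)) + F ((1/2) *\<^sub>R (a + c)) + F ((1/2) *\<^sub>R (b + c))) + (F a + F b + F c) / 6"
proof -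
  have m: "{1..3::nat} = {1, 2, 3}" and n: "{..<3::nat} = {0, 1, 2}" by auto
  have 1: "(\<Sum>K | K \<subseteq> {..<3::nat} \<and> card K = 1. f K) = f {0} + f {1} + f {2}" for f :: "_ \<Rightarrow> real"
    unfolding card_1_subsets by (simp add: n sum.reindex)
  have 2: "(\<Sum>K | K \<subseteq> {..<3::nat} \<and> card K = 2. f K) = f {0, 1} + f {0, 2} + f {1, 2}" for f :: "_ \<Rightarrow> real"
    unfolding card_2_subsets by (simp add: doubleton_eq_iff)
  have 3: "(\<Sum>K | K \<subseteq> {..<3::nat} \<and> card K = 3. f K) = f {0, 1, 2}" for f :: "_ \<Rightarrow> real"
    unfolding card_full_subsets by (simp add: n)
  have l: "length [a, b, c] = 3" by simp
  show ?thesis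
    unfolding dual_functional_def l Let_def m
    by (simp add: 1 2 3 fact_numeral field_simps del: One_nat_def)
qed

lemma replicate_mset_numerals:
  "replicate_mset 1 a = {#a#}" "replicate_mset 2 a = {#a, a#}" "replicate_mset 3 a = {#a, a, a#}"
  "replicate_mset 4 a = {#a, a, a, a#}"
  by (simp_all add: eval_nat_numeral)

lemma knots_eq:
  "knots p [k1, k2, k3, k4, k5, k6, k10] = replicate_mset k1 (p 1) + replicate_mset k2 (p 2) +
     replicate_mset k3 (p 3) + replicate_mset k4 (p 4) + replicate_mset k5 (p 5) +
     replicate_mset k6 (p 6) + replicate_mset k10 (p 10)"
proof -
  have "{..<7::nat} = {0, 1, 2, 3, 4, 5, 6}" by auto
  then show ?thesis by (simp add: knots_def add.assoc)
qed

lemma list_update_numeral: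
  "(a # xs)[numeral n := y] = a # xs[pred_numeral n := y]"
  "(a # xs)[1 := y] = a # xs[0 := y]"
  "(a # xs)[0 := y] = y # xs"
  by (simp_all add: numeral_eq_Suc)

lemma perms3_permute:
  assumes "(i, j, k) \<in> perms3"
  shows "(i, k, j) \<in> perms3" "(j, i, k) \<in> perms3" "(j, k, i) \<in> perms3" "(k, i, j) \<in> perms3" "(k, j, i) \<in> perms3"
  using assms by (auto simp: perms3_def)

text \<open>Exactly \<open>d\<close> factors: monomials of lower degree are padded with the constant
  1, which is the sum of the barycentric coordinates. Each factor is then a linear form in them, and
  the product is homogeneous.\<close>

inductive coordinate_product :: "nat \<Rightarrow> (real^2 \<Rightarrow> real) \<Rightarrow> bool" where
  one: "coordinate_product 0 (\<lambda>_. 1)"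
| step: "coordinate_product d f \<Longrightarrow> g = (\<lambda>x. x$1) \<or> g = (\<lambda>x. x$2) \<or> g = (\<lambda>_. 1) \<Longrightarrow>
    coordinate_product (Suc d) (\<lambda>x. g x * f x)"

lemma coordinate_product_monomial:
  "i + j \<le> d \<Longrightarrow> coordinate_product d (\<lambda>x. (x$1)^i * (x$2)^j)"
proof (induction d arbitrary: i j)
  case 0
  then show ?case using coordinate_product.one by simp
next
  case (Suc d)
  consider i' where "i = Suc i'" | j' where "i = 0" "j = Suc j'" | "i = 0" "j = 0"
    by (metis not0_implies_Suc)
  then show ?case
  proof cases
    case 1
    then have "coordinate_product d (\<lambda>x. (x$1)^i' * (x$2)^j)" using Suc by simp
    from coordinate_product.step[OF this, of "\<lambda>x. x$1"] show ?thesis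
      using 1 by (simp add: mult.assoc)
  next
    case 2
    then have "coordinate_product d (\<lambda>x. (x$1)^0 * (x$2)^j')" using Suc by (intro Suc.IH) simp
    from coordinate_product.step[OF this, of "\<lambda>x. x$2"] show ?thesis
      using 2 by simp
  next
    case 3
    then have "coordinate_product d (\<lambda>x. (x$1)^0 * (x$2)^0)" by (intro Suc.IH) simp
    from coordinate_product.step[OF this, of "\<lambda>_. 1"] show ?thesis
      using 3 by simp
  qed
qed

lemma sum_eq_1_cases:
  assumes "a + b + c = (1::nat)"
  obtains "a = 1" "b = 0" "c = 0"
    | "a = 0" "b = 1" "c = 0"
    | "a = 0" "b = 0" "c = 1"
proof -
  have "a = 0 \<or> a = 1" "b = 0 \<or> b = 1"
    using assms by linarith+
  then show ?thesis
    using assms that by (elim disjE; simp)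
qed

lemma sum_eq_2_cases:
  assumes "a + b + c = (2::nat)"
  obtains "a = 2" "b = 0" "c = 0"
    | "a = 1" "b = 1" "c = 0"
    | "a = 1" "b = 0" "c = 1"
    | "a = 0" "b = 2" "c = 0"
    | "a = 0" "b = 1" "c = 1"
    | "a = 0" "b = 0" "c = 2"
proof -
  have "a = 0 \<or> a = 1 \<or> a = 2" "b = 0 \<or> b = 1 \<or> b = 2"
    using assms by linarith+
  then show ?thesis
    using assms that by (elim disjE; simp)
qed

lemma sum_eq_3_cases:
  assumes "a + b + c = (3::nat)"
  obtains "a = 3" "b = 0" "c = 0"
    | "a = 2" "b = 1" "c = 0"
    | "a = 2" "b = 0" "c = 1"
    | "a = 1" "b = 2" "c = 0"
    | "a = 1" "b = 1" "c = 1"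
    | "a = 1" "b = 0" "c = 2"
    | "a = 0" "b = 3" "c = 0"
    | "a = 0" "b = 2" "c = 1"
    | "a = 0" "b = 1" "c = 2"
    | "a = 0" "b = 0" "c = 3"
proof -
  have "a = 0 \<or> a = 1 \<or> a = 2 \<or> a = 3" "b = 0 \<or> b = 1 \<or> b = 2 \<or> b = 3"
    using assms by linarith+
  then show ?thesis
    using assms that by (elim disjE; simp)
qed

context
  fixes p :: "nat \<Rightarrow> real^2"
  assumes nc: "\<not> collinear {p 1, p 2, p 3}" and ps12: "ps12_vertices p"
begin

text \<open>Otherwise the simplifier turns \<open>p 1\<close> into \<open>p (Suc 0)\<close>.\<close>

declare One_nat_def [simp del]

lemma bc_combine: "bc p 1 x *\<^sub>R p 1 + bc p 2 x *\<^sub>R p 2 + bc p 3 x *\<^sub>R p 3 = x"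
  using bary_combine[OF nc] by (simp add: bc_def)

lemma bc_sum: "bc p 1 x + bc p 2 x + bc p 3 x = 1"
  using bary_sum[OF nc] by (simp add: bc_def)

lemma bc_unique:
  assumes "x = u *\<^sub>R p 1 + v *\<^sub>R p 2 + w *\<^sub>R p 3" "u + v + w = 1"
  shows "bc p 1 x = u \<and> bc p 2 x = v \<and> bc p 3 x = w"
  using bary_unique[OF nc assms] by (simp add: bc_def)

lemma affine_function_bc: "affine_function (bc p i)"
  by (simp add: bc_def affine_function_bary)

lemma bc_vertex:
  "bc p 1 (p 1) = 1" "bc p 2 (p 1) = 0" "bc p 3 (p 1) = 0"
  "bc p 1 (p 2) = 0" "bc p 2 (p 2) = 1" "bc p 3 (p 2) = 0"
  "bc p 1 (p 3) = 0" "bc p 2 (p 3) = 0" "bc p 3 (p 3) = 1"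
  "bc p 1 (p 4) = 1/2" "bc p 2 (p 4) = 1/2" "bc p 3 (p 4) = 0"
  "bc p 1 (p 5) = 0" "bc p 2 (p 5) = 1/2" "bc p 3 (p 5) = 1/2"
  "bc p 1 (p 6) = 1/2" "bc p 2 (p 6) = 0" "bc p 3 (p 6) = 1/2"
  "bc p 1 (p 7) = 1/2" "bc p 2 (p 7) = 1/4" "bc p 3 (p 7) = 1/4"
  "bc p 1 (p 8) = 1/4" "bc p 2 (p 8) = 1/2" "bc p 3 (p 8) = 1/4"
  "bc p 1 (p 9) = 1/4" "bc p 2 (p 9) = 1/4" "bc p 3 (p 9) = 1/2"
  "bc p 1 (p 10) = 1/3" "bc p 2 (p 10) = 1/3" "bc p 3 (p 10) = 1/3"
proof -
  note v = ps12[unfolded ps12_vertices_def midpoint_def]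
  have "p 1 = 1 *\<^sub>R p 1 + 0 *\<^sub>R p 2 + 0 *\<^sub>R p 3" by simp
  from bc_unique[OF this] show "bc p 1 (p 1) = 1" "bc p 2 (p 1) = 0" "bc p 3 (p 1) = 0" by simp_all
  have "p 2 = 0 *\<^sub>R p 1 + 1 *\<^sub>R p 2 + 0 *\<^sub>R p 3" by simp
  from bc_unique[OF this] show "bc p 1 (p 2) = 0" "bc p 2 (p 2) = 1" "bc p 3 (p 2) = 0" by simp_all
  have "p 3 = 0 *\<^sub>R p 1 + 0 *\<^sub>R p 2 + 1 *\<^sub>R p 3" by simp
  from bc_unique[OF this] show "bc p 1 (p 3) = 0" "bc p 2 (p 3) = 0" "bc p 3 (p 3) = 1" by simp_all
  have "p 4 = (1/2) *\<^sub>R p 1 + (1/2) *\<^sub>R p 2 + 0 *\<^sub>R p 3"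
    using v by (simp add: vec_eq_iff forall_2 field_simps)
  from bc_unique[OF this] show "bc p 1 (p 4) = 1/2" "bc p 2 (p 4) = 1/2" "bc p 3 (p 4) = 0" by simp_all
  have "p 5 = 0 *\<^sub>R p 1 + (1/2) *\<^sub>R p 2 + (1/2) *\<^sub>R p 3"
    using v by (simp add: vec_eq_iff forall_2 field_simps)
  from bc_unique[OF this] show "bc p 1 (p 5) = 0" "bc p 2 (p 5) = 1/2" "bc p 3 (p 5) = 1/2" by simp_all
  have "p 6 = (1/2) *\<^sub>R p 1 + 0 *\<^sub>R p 2 + (1/2) *\<^sub>R p 3"
    using v by (simp add: vec_eq_iff forall_2 field_simps)
  from bc_unique[OF this] show "bc p 1 (p 6) = 1/2" "bc p 2 (p 6) = 0" "bc p 3 (p 6) = 1/2" by simp_all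
  have "p 7 = (1/2) *\<^sub>R p 1 + (1/4) *\<^sub>R p 2 + (1/4) *\<^sub>R p 3"
    using v by (simp add: vec_eq_iff forall_2 field_simps)
  from bc_unique[OF this] show "bc p 1 (p 7) = 1/2" "bc p 2 (p 7) = 1/4" "bc p 3 (p 7) = 1/4" by simp_all
  have "p 8 = (1/4) *\<^sub>R p 1 + (1/2) *\<^sub>R p 2 + (1/4) *\<^sub>R p 3"
    using v by (simp add: vec_eq_iff forall_2 field_simps)
  from bc_unique[OF this] show "bc p 1 (p 8) = 1/4" "bc p 2 (p 8) = 1/2" "bc p 3 (p 8) = 1/4" by simp_all
  have "p 9 = (1/4) *\<^sub>R p 1 + (1/4) *\<^sub>R p 2 + (1/2) *\<^sub>R p 3"
    using v by (simp add: vec_eq_iff forall_2 field_simps)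
  from bc_unique[OF this] show "bc p 1 (p 9) = 1/4" "bc p 2 (p 9) = 1/4" "bc p 3 (p 9) = 1/2" by simp_all
  have "p 10 = (1/3) *\<^sub>R p 1 + (1/3) *\<^sub>R p 2 + (1/3) *\<^sub>R p 3"
    using v by (simp add: vec_eq_iff forall_2 field_simps)
  from bc_unique[OF this] show "bc p 1 (p 10) = 1/3" "bc p 2 (p 10) = 1/3" "bc p 3 (p 10) = 1/3" by simp_all
qed

lemma triangle_iff: "x \<in> triangle p \<longleftrightarrow> 0 \<le> bc p 1 x \<and> 0 \<le> bc p 2 x \<and> 0 \<le> bc p 3 x"
proof
  assume "x \<in> triangle p"
  then obtain u v w where "0 \<le> u" "0 \<le> v" "0 \<le> w" "u + v + w = 1" "x = u *\<^sub>R p 1 + v *\<^sub>R p 2 + w *\<^sub>R p 3"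
    by (auto simp: triangle_def convex_hull_3)
  then show "0 \<le> bc p 1 x \<and> 0 \<le> bc p 2 x \<and> 0 \<le> bc p 3 x"
    using bc_unique[of x u v w] by simp
next
  assume "0 \<le> bc p 1 x \<and> 0 \<le> bc p 2 x \<and> 0 \<le> bc p 3 x"
  then show "x \<in> triangle p"
    unfolding triangle_def convex_hull_3
    using bc_sum[of x] bc_combine[of x, symmetric] by blast
qed

lemma subtriangle_subset:
  assumes "I \<in> ps12_subtriangles"
  shows "convex hull (p ` I) \<subseteq> triangle p"
proof (rule hull_minimal)
  show "p ` I \<subseteq> triangle p"
    using assms by (auto simp: ps12_subtriangles_def triangle_iff bc_vertex)
  show "convex (triangle p)" by (simp add: triangle_def)
qed

section \<open>Closure properties of the spline space\<close>

text \<open>The closed forms of the splines hold on the triangle only, and this is all that the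
  space sees.\<close>

lemma spline_space_cong:
  assumes "f \<in> spline_space p d" "\<And>x. x \<in> triangle p \<Longrightarrow> f x = g x"
  shows "g \<in> spline_space p d"
  unfolding spline_space_def mem_Collect_eq
proof (intro conjI ballI)
  show "Ck_on (d - 1) (triangle p) g"
    using assms by (intro Ck_on_cong[of "triangle p" f g]) (auto simp: spline_space_def)
  fix I assume I: "I \<in> ps12_subtriangles"
  then obtain q where "q \<in> polys_upto d" "\<forall>x\<in>convex hull (p ` I). f x = q x"
    using assms(1) by (auto simp: spline_space_def)
  then show "\<exists>q\<in>polys_upto d. \<forall>x\<in>convex hull (p ` I). g x = q x"
    using assms(2) subtriangle_subset[OF I] by (metis subsetD)
qed

lemma spline_space_add:
  assumes "f \<in> spline_space p d" "g \<in> spline_space p d"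
  shows "(\<lambda>x. f x + g x) \<in> spline_space p d"
  unfolding spline_space_def mem_Collect_eq
proof (intro conjI ballI)
  show "Ck_on (d - 1) (triangle p) (\<lambda>x. f x + g x)"
    using assms by (intro Ck_on_add) (auto simp: spline_space_def)
  fix I assume I: "I \<in> ps12_subtriangles"
  obtain q where q: "q \<in> polys_upto d" "\<forall>x\<in>convex hull (p ` I). f x = q x"
    using assms(1) I by (auto simp: spline_space_def)
  obtain r where r: "r \<in> polys_upto d" "\<forall>x\<in>convex hull (p ` I). g x = r x"
    using assms(2) I by (auto simp: spline_space_def)
  show "\<exists>q\<in>polys_upto d. \<forall>x\<in>convex hull (p ` I). f x + g x = q x"
    using polys_upto_add[OF q(1) r(1)] q(2) r(2) by (intro bexI[of _ "\<lambda>x. q x + r x"]) auto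
qed

lemma spline_space_cmult:
  assumes "f \<in> spline_space p d"
  shows "(\<lambda>x. k * f x) \<in> spline_space p d"
  unfolding spline_space_def mem_Collect_eq
proof (intro conjI ballI)
  show "Ck_on (d - 1) (triangle p) (\<lambda>x. k * f x)"
    using assms by (intro Ck_on_mult Ck_on_const) (auto simp: spline_space_def)
  fix I assume I: "I \<in> ps12_subtriangles"
  obtain q where q: "q \<in> polys_upto d" "\<forall>x\<in>convex hull (p ` I). f x = q x"
    using assms(1) I by (auto simp: spline_space_def)
  show "\<exists>q\<in>polys_upto d. \<forall>x\<in>convex hull (p ` I). k * f x = q x"
    using polys_upto_cmult[OF q(1)] q(2) by (intro bexI[of _ "\<lambda>x. k * q x"]) auto
qed

lemma spline_space_diff:
  assumes "f \<in> spline_space p d" "g \<in> spline_space p d"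
  shows "(\<lambda>x. f x - g x) \<in> spline_space p d"
  using spline_space_add[OF assms(1) spline_space_cmult[OF assms(2), of "- 1"]] by simp

lemma spline_space_divide:
  assumes "f \<in> spline_space p d"
  shows "(\<lambda>x. f x / k) \<in> spline_space p d"
  using spline_space_cmult[OF assms, of "1 / k"] by simp

lemma spline_space_poly:
  assumes "f \<in> polys_upto d" "Ck_on (d - 1) (triangle p) f"
  shows "f \<in> spline_space p d"
  using assms by (auto simp: spline_space_def)

lemma spline_space_affine:
  assumes "affine_function f"
  shows "f \<in> spline_space p 1"
  using polys_upto_affine_power[OF assms, of 1] Ck_on_affine[OF assms]
  by (intro spline_space_poly) simp_all

lemma spline_space_affine2:
  assumes "affine_function f" "affine_function g"
  shows "(\<lambda>x. f x * g x) \<in> spline_space p 2"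
  using polys_upto_affine_mult[OF assms(1) polys_upto_affine_power[OF assms(2), of 1]] assms
  by (intro spline_space_poly Ck_on_mult Ck_on_affine) (simp_all add: numeral_2_eq_2)

lemma spline_space_affine3:
  assumes "affine_function f" "affine_function g" "affine_function h"
  shows "(\<lambda>x. f x * g x * h x) \<in> spline_space p 3"
  using polys_upto_affine_mult[OF assms(1)
      polys_upto_affine_mult[OF assms(2) polys_upto_affine_power[OF assms(3), of 1]]] assms
  by (intro spline_space_poly Ck_on_mult Ck_on_affine) (simp_all add: numeral_3_eq_3 mult.assoc)

lemma spline_space_power2:
  "affine_function f \<Longrightarrow> (\<lambda>x. f x ^ 2) \<in> spline_space p 2"
  using spline_space_affine2[of f f] by (simp add: power2_eq_square)

lemma spline_space_power3:
  "affine_function f \<Longrightarrow> (\<lambda>x. f x ^ 3) \<in> spline_space p 3"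
  using spline_space_affine3[of f f f] by (simp add: power3_eq_cube)

text \<open>If \<open>f\<close> has no sign change on a subtriangle, its truncated power is there
  either the polynomial \<open>f x ^ d\<close> or 0. Smoothness across the line where
  \<open>f\<close> vanishes comes from the exponent.\<close>

lemma spline_space_pp_power:
  assumes f: "affine_function f" and d: "0 < d"
    and sgn: "\<forall>I\<in>ps12_subtriangles. (\<forall>k\<in>I. 0 \<le> f (p k)) \<or> (\<forall>k\<in>I. f (p k) \<le> 0)"
  shows "(\<lambda>x. pp (f x) ^ d) \<in> spline_space p d"
  unfolding spline_space_def mem_Collect_eq
proof (intro conjI ballI)
  show "Ck_on (d - 1) (triangle p) (\<lambda>x. pp (f x) ^ d)"
    using Ck_on_pp_power[OF f, of "d - 1"] d by simp
  fix I assume I: "I \<in> ps12_subtriangles"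
  with sgn consider "\<forall>k\<in>I. 0 \<le> f (p k)" | "\<forall>k\<in>I. f (p k) \<le> 0" by blast
  then show "\<exists>q\<in>polys_upto d. \<forall>x\<in>convex hull (p ` I). pp (f x) ^ d = q x"
  proof cases
    case 1
    then have "0 \<le> f x" if "x \<in> convex hull (p ` I)" for x
      using affine_function_nonneg_on_hull[OF f _ that] by auto
    then show ?thesis
      by (intro bexI[OF _ polys_upto_affine_power[OF f]]) simp
  next
    case 2
    then have "0 \<le> - 1 * f x" if "x \<in> convex hull (p ` I)" for x
      using affine_function_nonneg_on_hull[OF affine_function_cmult[OF f] _ that, of "- 1"] by auto
    then show ?thesis
      using d by (intro bexI[OF _ polys_upto_const[of 0]]) (simp add: zero_power)
  qed
qed

text \<open>No line on which two coordinates agree crosses the interior of a subtriangle; by the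
  vertex criterion this is a finite check of signs.\<close>

lemma spline_space_chord2:
  assumes "(i, j, k) \<in> perms3" "0 < d"
  shows "(\<lambda>x. pp (bc p i x - bc p j x) ^ d) \<in> spline_space p d"
  by (intro spline_space_pp_power affine_function_diff affine_function_bc assms(2))
    (use assms(1) in \<open>unfold perms3_def insert_iff empty_iff prod.inject,
      elim disjE conjE FalseE; simp add: ps12_subtriangles_def bc_vertex\<close>)

lemma spline_space_chord3:
  assumes "(i, j, k) \<in> perms3" "0 < d"
  shows "(\<lambda>x. pp (bc p i x - bc p j x - bc p k x) ^ d) \<in> spline_space p d"
  by (intro spline_space_pp_power affine_function_diff affine_function_bc assms(2))
    (use assms(1) in \<open>unfold perms3_def insert_iff empty_iff prod.inject,
      elim disjE conjE FalseE; simp add: ps12_subtriangles_def bc_vertex\<close>)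

text \<open>On each subtriangle one coordinate is the smallest at all three vertices, hence
  everywhere on it, and the minimum is that coordinate.\<close>

lemma spline_space_min:
  assumes "(i, j, k) \<in> perms3"
  shows "(\<lambda>x. min (bc p i x) (min (bc p j x) (bc p k x))) \<in> spline_space p 1"
  unfolding spline_space_def mem_Collect_eq
proof (intro conjI ballI)
  have "continuous_on (triangle p) (bc p l)" for l
    using Ck_on_affine[OF affine_function_bc, of 0] by simp
  then show "Ck_on (1 - 1) (triangle p) (\<lambda>x. min (bc p i x) (min (bc p j x) (bc p k x)))"
    by (auto intro!: continuous_intros)
  fix I assume I: "I \<in> ps12_subtriangles"
  then have "\<exists>m\<in>{1,2,3}. \<forall>l\<in>{1,2,3}. \<forall>n\<in>I. 0 \<le> bc p l (p n) - bc p m (p n)"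
    unfolding ps12_subtriangles_def insert_iff empty_iff
    by (elim disjE FalseE; simp add: bc_vertex)
  then obtain m where m: "m \<in> {1,2,3}" "\<And>l n. l \<in> {1,2,3} \<Longrightarrow> n \<in> I \<Longrightarrow> 0 \<le> bc p l (p n) - bc p m (p n)"
    by blast
  have le: "bc p m x \<le> bc p l x" if "l \<in> {1,2,3}" "x \<in> convex hull (p ` I)" for l x
    using affine_function_nonneg_on_hull[OF affine_function_diff[OF affine_function_bc affine_function_bc] _ that(2), of l m]
      m(2)[OF that(1)] by auto
  have "min (bc p i x) (min (bc p j x) (bc p k x)) = bc p m x" if "x \<in> convex hull (p ` I)" for x
    using le[OF _ that, of 1] le[OF _ that, of 2] le[OF _ that, of 3] m(1) assms
    by (auto simp: perms3_def min_def)
  then show "\<exists>q\<in>polys_upto 1. \<forall>x\<in>convex hull (p ` I). min (bc p i x) (min (bc p j x) (bc p k x)) = q x"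
    using polys_upto_affine_power[OF affine_function_bc[of m], of 1] by (intro bexI[of _ "bc p m"]) simp_all
qed

section \<open>The simplex splines of the bases in barycentric form\<close>

lemma ps12_points:
  "midpoint (p 1) (p 2) = p 4" "midpoint (p 2) (p 1) = p 4"
  "midpoint (p 2) (p 3) = p 5" "midpoint (p 3) (p 2) = p 5"
  "midpoint (p 3) (p 1) = p 6" "midpoint (p 1) (p 3) = p 6"
  "(1/3) *\<^sub>R (p 1 + p 2 + p 3) = p 10" "(1/3) *\<^sub>R (p 2 + p 3 + p 1) = p 10"
  "(1/3) *\<^sub>R (p 3 + p 1 + p 2) = p 10"
  using ps12 by (simp_all add: ps12_vertices_def midpoint_sym add_ac)

lemma perm_not_collinear:
  assumes "(i, j, k) \<in> perms3"
  shows "\<not> collinear {p i, p j, p k}"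
  using assms nc by (auto simp: perms3_def insert_commute)

lemma perm_nonneg:
  assumes "(i, j, k) \<in> perms3" "x \<in> triangle p"
  shows "0 \<le> bc p i x" "0 \<le> bc p j x" "0 \<le> bc p k x"
  using assms triangle_iff[of x] by (auto simp: perms3_def)

lemma perm_sum:
  assumes "(i, j, k) \<in> perms3"
  shows "bc p i x + bc p j x + bc p k x = 1"
  using assms bc_sum[of x] by (auto simp: perms3_def)

lemma perm_combine:
  assumes "(i, j, k) \<in> perms3"
  shows "x = bc p i x *\<^sub>R p i + bc p j x *\<^sub>R p j + bc p k x *\<^sub>R p k"
  using assms bc_combine[of x] unfolding perms3_def insert_iff empty_iff prod.inject
  by (elim disjE conjE FalseE; simp add: add_ac)

lemma perm_measure:
  assumes "(i, j, k) \<in> perms3"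
  shows "measure lebesgue (triangle p) = measure lebesgue (convex hull {p i, p j, p k})"
  using assms unfolding perms3_def triangle_def insert_iff empty_iff prod.inject
  by (elim disjE conjE FalseE; simp add: insert_commute)

text \<open>The knots are written with midpoints of \<open>p i\<close>, \<open>p j\<close>,
  \<open>p k\<close>, so that one statement covers every ordering of the vertices;
  \<open>ps12_points\<close> later identifies these midpoints with the points of the split.\<close>

lemma Qspline_corner1:
  assumes "(i, j, k) \<in> perms3" "x \<in> triangle p" "knots p \<mu> = {#p i, midpoint (p i) (p j), midpoint (p i) (p k), p i#}"
  shows "Qspline TYPE(1) p \<mu> x = corner 1 (bc p i x) (bc p j x) (bc p k x)"
  unfolding Qspline_def corner_def power_one_right
  by (rule spline1_200101[OF perm_not_collinear[OF assms(1)] perm_nonneg[OF assms(1,2)]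
        perm_sum[OF assms(1)] perm_combine[OF assms(1)] perm_measure[OF assms(1)] assms(3)])

lemma Qspline_mid1:
  assumes "(i, j, k) \<in> perms3" "x \<in> triangle p" "knots p \<mu> = {#p i, p j, (1/3) *\<^sub>R (p i + p j + p k), midpoint (p i) (p j)#}"
  shows "Qspline TYPE(1) p \<mu> x = mid1 (bc p i x) (bc p j x) (bc p k x)"
  unfolding Qspline_def mid1_def
  by (rule spline1_110100_1[OF perm_not_collinear[OF assms(1)] perm_nonneg[OF assms(1,2)]
        perm_sum[OF assms(1)] perm_combine[OF assms(1)] perm_measure[OF assms(1)] assms(3)])

lemma Qspline_inner1:
  assumes "(i, j, k) \<in> perms3" "x \<in> triangle p" "knots p \<mu> = {#p i, midpoint (p i) (p j), midpoint (p i) (p k), (1/3) *\<^sub>R (p i + p j + p k)#}"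
  shows "Qspline TYPE(1) p \<mu> x = inner1 (bc p i x) (bc p j x) (bc p k x)"
  unfolding Qspline_def inner1_def
  by (rule spline1_100101_1[OF perm_not_collinear[OF assms(1)] perm_nonneg[OF assms(1,2)]
        perm_sum[OF assms(1)] perm_combine[OF assms(1)] perm_measure[OF assms(1)] assms(3)])

lemma Qspline_center1:
  assumes "(i, j, k) \<in> perms3" "x \<in> triangle p" "knots p \<mu> = {#midpoint (p i) (p j), midpoint (p j) (p k), midpoint (p i) (p k), (1/3) *\<^sub>R (p i + p j + p k)#}"
  shows "Qspline TYPE(1) p \<mu> x = center1 (bc p i x) (bc p j x) (bc p k x)"
  unfolding Qspline_def center1_def
  by (rule spline1_000111_1[OF perm_not_collinear[OF assms(1)] perm_nonneg[OF assms(1,2)]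
        perm_sum[OF assms(1)] perm_combine[OF assms(1)] perm_measure[OF assms(1)] assms(3)])

lemma Qspline_corner2:
  assumes "(i, j, k) \<in> perms3" "x \<in> triangle p" "knots p \<mu> = {#p i, midpoint (p i) (p j), midpoint (p i) (p k), p i, p i#}"
  shows "Qspline TYPE(2) p \<mu> x = corner 2 (bc p i x) (bc p j x) (bc p k x)"
  unfolding Qspline_def corner_def
  by (rule spline2_300101[OF perm_not_collinear[OF assms(1)] perm_nonneg[OF assms(1,2)]
        perm_sum[OF assms(1)] perm_combine[OF assms(1)] perm_measure[OF assms(1)] assms(3)])

lemma Qspline_edge2:
  assumes "(i, j, k) \<in> perms3" "x \<in> triangle p" "knots p \<mu> = {#p i, p j, midpoint (p i) (p k), midpoint (p i) (p j), p i#}"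
  shows "Qspline TYPE(2) p \<mu> x = edge 2 (bc p i x) (bc p j x) (bc p k x)"
  unfolding Qspline_def edge_def
  by (rule spline2_210101[OF perm_not_collinear[OF assms(1)] perm_nonneg[OF assms(1,2)]
        perm_sum[OF assms(1)] perm_combine[OF assms(1)] perm_measure[OF assms(1)] assms(3)])

lemma Qspline_face2:
  assumes "(i, j, k) \<in> perms3" "x \<in> triangle p" "knots p \<mu> = {#p i, p j, p k, midpoint (p i) (p j), midpoint (p i) (p k)#}"
  shows "Qspline TYPE(2) p \<mu> x = face 2 (bc p i x) (bc p j x) (bc p k x)"
  unfolding Qspline_def face_def
  by (rule spline2_111101[OF perm_not_collinear[OF assms(1)] perm_nonneg[OF assms(1,2)]
        perm_sum[OF assms(1)] perm_combine[OF assms(1)] perm_measure[OF assms(1)] assms(3)])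

lemma Qspline_mid2:
  assumes "(i, j, k) \<in> perms3" "x \<in> triangle p" "knots p \<mu> = {#p i, p j, midpoint (p j) (p k), midpoint (p i) (p k), midpoint (p i) (p j)#}"
  shows "Qspline TYPE(2) p \<mu> x = mid2 (bc p i x) (bc p j x) (bc p k x)"
  unfolding Qspline_def mid2_def
  by (rule spline2_110111[OF perm_not_collinear[OF assms(1)] perm_nonneg[OF assms(1,2)]
        perm_sum[OF assms(1)] perm_combine[OF assms(1)] perm_measure[OF assms(1)] assms(3)])

lemma Qspline_corner3:
  assumes "(i, j, k) \<in> perms3" "x \<in> triangle p" "knots p \<mu> = {#p i, midpoint (p i) (p j), midpoint (p i) (p k), p i, p i, p i#}"
  shows "Qspline TYPE(3) p \<mu> x = corner 3 (bc p i x) (bc p j x) (bc p k x)"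
  unfolding Qspline_def corner_def
  by (rule spline3_400101[OF perm_not_collinear[OF assms(1)] perm_nonneg[OF assms(1,2)]
        perm_sum[OF assms(1)] perm_combine[OF assms(1)] perm_measure[OF assms(1)] assms(3)])

lemma Qspline_edge3:
  assumes "(i, j, k) \<in> perms3" "x \<in> triangle p" "knots p \<mu> = {#p i, p j, midpoint (p i) (p k), midpoint (p i) (p j), p i, p i#}"
  shows "Qspline TYPE(3) p \<mu> x = edge 3 (bc p i x) (bc p j x) (bc p k x)"
  unfolding Qspline_def edge_def
  by (rule spline3_310101[OF perm_not_collinear[OF assms(1)] perm_nonneg[OF assms(1,2)]
        perm_sum[OF assms(1)] perm_combine[OF assms(1)] perm_measure[OF assms(1)] assms(3)])

lemma Qspline_mid3:
  assumes "(i, j, k) \<in> perms3" "x \<in> triangle p" "knots p \<mu> = {#p i, p j, p k, midpoint (p i) (p j), p i, p j#}"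
  shows "Qspline TYPE(3) p \<mu> x = mid3 (bc p i x) (bc p j x) (bc p k x)"
  unfolding Qspline_def mid3_def
  by (rule spline3_221100[OF perm_not_collinear[OF assms(1)] perm_nonneg[OF assms(1,2)]
        perm_sum[OF assms(1)] perm_combine[OF assms(1)] perm_measure[OF assms(1)] assms(3)])

lemma Qspline_face3:
  assumes "(i, j, k) \<in> perms3" "x \<in> triangle p" "knots p \<mu> = {#p i, p j, p k, midpoint (p i) (p j), midpoint (p i) (p k), p i#}"
  shows "Qspline TYPE(3) p \<mu> x = face 3 (bc p i x) (bc p j x) (bc p k x)"
  unfolding Qspline_def face_def
  by (rule spline3_211101[OF perm_not_collinear[OF assms(1)] perm_nonneg[OF assms(1,2)]
        perm_sum[OF assms(1)] perm_combine[OF assms(1)] perm_measure[OF assms(1)] assms(3)])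

lemma Qspline_center3:
  assumes "(i, j, k) \<in> perms3" "x \<in> triangle p" "knots p \<mu> = {#p i, p j, p k, midpoint (p i) (p j), midpoint (p j) (p k), midpoint (p i) (p k)#}"
  shows "Qspline TYPE(3) p \<mu> x = center3 (bc p i x) (bc p j x) (bc p k x)"
  unfolding Qspline_def center3_def
  by (rule spline3_111111[OF perm_not_collinear[OF assms(1)] perm_nonneg[OF assms(1,2)]
        perm_sum[OF assms(1)] perm_combine[OF assms(1)] perm_measure[OF assms(1)] assms(3)])

lemma Qspline_bernstein3:
  assumes "(i, j, k) \<in> perms3" "x \<in> triangle p" "knots p \<mu> = {#p i, p j, p k, p i, p j, p k#}"
  shows "Qspline TYPE(3) p \<mu> x = bernstein3 (bc p i x) (bc p j x) (bc p k x)"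
  unfolding Qspline_def bernstein3_def
  by (rule spline3_222000[OF perm_not_collinear[OF assms(1)] perm_nonneg[OF assms(1,2)]
        perm_sum[OF assms(1)] perm_combine[OF assms(1)] perm_measure[OF assms(1)] assms(3)])

lemma Qspline_s1:
  assumes x: "x \<in> triangle p"
  shows "Qspline TYPE(1) p [2, 0, 0, 1, 0, 1, 0] x = corner 1 (bc p 1 x) (bc p 2 x) (bc p 3 x)"
    "Qspline TYPE(1) p [0, 2, 0, 1, 1, 0, 0] x = corner 1 (bc p 2 x) (bc p 3 x) (bc p 1 x)"
    "Qspline TYPE(1) p [0, 0, 2, 0, 1, 1, 0] x = corner 1 (bc p 3 x) (bc p 1 x) (bc p 2 x)"
    "Qspline TYPE(1) p [1, 1, 0, 1, 0, 0, 1] x = mid1 (bc p 1 x) (bc p 2 x) (bc p 3 x)"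
    "Qspline TYPE(1) p [0, 1, 1, 0, 1, 0, 1] x = mid1 (bc p 2 x) (bc p 3 x) (bc p 1 x)"
    "Qspline TYPE(1) p [1, 0, 1, 0, 0, 1, 1] x = mid1 (bc p 3 x) (bc p 1 x) (bc p 2 x)"
    "Qspline TYPE(1) p [1, 0, 0, 1, 0, 1, 1] x = inner1 (bc p 1 x) (bc p 2 x) (bc p 3 x)"
    "Qspline TYPE(1) p [0, 1, 0, 1, 1, 0, 1] x = inner1 (bc p 2 x) (bc p 3 x) (bc p 1 x)"
    "Qspline TYPE(1) p [0, 0, 1, 0, 1, 1, 1] x = inner1 (bc p 3 x) (bc p 1 x) (bc p 2 x)"
    "Qspline TYPE(1) p [0, 0, 0, 1, 1, 1, 1] x = center1 (bc p 1 x) (bc p 2 x) (bc p 3 x)"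
  by ((rule Qspline_corner1[OF _ x]; simp add: perms3_def knots_eq ps12_points replicate_mset_numerals),
      (rule Qspline_corner1[OF _ x]; simp add: perms3_def knots_eq ps12_points replicate_mset_numerals),
      (rule Qspline_corner1[OF _ x]; simp add: perms3_def knots_eq ps12_points replicate_mset_numerals),
      (rule Qspline_mid1[OF _ x]; simp add: perms3_def knots_eq ps12_points replicate_mset_numerals),
      (rule Qspline_mid1[OF _ x]; simp add: perms3_def knots_eq ps12_points replicate_mset_numerals),
      (rule Qspline_mid1[OF _ x]; simp add: perms3_def knots_eq ps12_points replicate_mset_numerals),
      (rule Qspline_inner1[OF _ x]; simp add: perms3_def knots_eq ps12_points replicate_mset_numerals),
      (rule Qspline_inner1[OF _ x]; simp add: perms3_def knots_eq ps12_points replicate_mset_numerals),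
      (rule Qspline_inner1[OF _ x]; simp add: perms3_def knots_eq ps12_points replicate_mset_numerals),
      (rule Qspline_center1[OF _ x]; simp add: perms3_def knots_eq ps12_points replicate_mset_numerals))

text \<open>An \<open>edge\<close> spline distinguishes its corner and its side, so all six
  orderings of the vertices occur; for the other two shapes the three rotations suffice.\<close>

lemma Qspline_s2:
  assumes x: "x \<in> triangle p"
  shows "Qspline TYPE(2) p [3, 0, 0, 1, 0, 1, 0] x = corner 2 (bc p 1 x) (bc p 2 x) (bc p 3 x)"
    "Qspline TYPE(2) p [2, 1, 0, 1, 0, 1, 0] x = edge 2 (bc p 1 x) (bc p 2 x) (bc p 3 x)"
    "Qspline TYPE(2) p [1, 1, 0, 1, 1, 1, 0] x = mid2 (bc p 1 x) (bc p 2 x) (bc p 3 x)"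
    "Qspline TYPE(2) p [1, 2, 0, 1, 1, 0, 0] x = edge 2 (bc p 2 x) (bc p 1 x) (bc p 3 x)"
    "Qspline TYPE(2) p [0, 3, 0, 1, 1, 0, 0] x = corner 2 (bc p 2 x) (bc p 3 x) (bc p 1 x)"
    "Qspline TYPE(2) p [0, 2, 1, 1, 1, 0, 0] x = edge 2 (bc p 2 x) (bc p 3 x) (bc p 1 x)"
    "Qspline TYPE(2) p [0, 1, 1, 1, 1, 1, 0] x = mid2 (bc p 2 x) (bc p 3 x) (bc p 1 x)"
    "Qspline TYPE(2) p [0, 1, 2, 0, 1, 1, 0] x = edge 2 (bc p 3 x) (bc p 2 x) (bc p 1 x)"
    "Qspline TYPE(2) p [0, 0, 3, 0, 1, 1, 0] x = corner 2 (bc p 3 x) (bc p 1 x) (bc p 2 x)"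
    "Qspline TYPE(2) p [1, 0, 2, 0, 1, 1, 0] x = edge 2 (bc p 3 x) (bc p 1 x) (bc p 2 x)"
    "Qspline TYPE(2) p [1, 0, 1, 1, 1, 1, 0] x = mid2 (bc p 3 x) (bc p 1 x) (bc p 2 x)"
    "Qspline TYPE(2) p [2, 0, 1, 1, 0, 1, 0] x = edge 2 (bc p 1 x) (bc p 3 x) (bc p 2 x)"
  by ((rule Qspline_corner2[OF _ x]; simp add: perms3_def knots_eq ps12_points replicate_mset_numerals),
      (rule Qspline_edge2[OF _ x]; simp add: perms3_def knots_eq ps12_points replicate_mset_numerals),
      (rule Qspline_mid2[OF _ x]; simp add: perms3_def knots_eq ps12_points replicate_mset_numerals),
      (rule Qspline_edge2[OF _ x]; simp add: perms3_def knots_eq ps12_points replicate_mset_numerals),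
      (rule Qspline_corner2[OF _ x]; simp add: perms3_def knots_eq ps12_points replicate_mset_numerals),
      (rule Qspline_edge2[OF _ x]; simp add: perms3_def knots_eq ps12_points replicate_mset_numerals),
      (rule Qspline_mid2[OF _ x]; simp add: perms3_def knots_eq ps12_points replicate_mset_numerals),
      (rule Qspline_edge2[OF _ x]; simp add: perms3_def knots_eq ps12_points replicate_mset_numerals),
      (rule Qspline_corner2[OF _ x]; simp add: perms3_def knots_eq ps12_points replicate_mset_numerals),
      (rule Qspline_edge2[OF _ x]; simp add: perms3_def knots_eq ps12_points replicate_mset_numerals),
      (rule Qspline_mid2[OF _ x]; simp add: perms3_def knots_eq ps12_points replicate_mset_numerals),
      (rule Qspline_edge2[OF _ x]; simp add: perms3_def knots_eq ps12_points replicate_mset_numerals))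

lemma Qspline_s2':
  assumes x: "x \<in> triangle p"
  shows "Qspline TYPE(2) p [1, 1, 1, 1, 0, 1, 0] x = face 2 (bc p 1 x) (bc p 2 x) (bc p 3 x)"
    "Qspline TYPE(2) p [1, 1, 1, 1, 1, 0, 0] x = face 2 (bc p 2 x) (bc p 3 x) (bc p 1 x)"
    "Qspline TYPE(2) p [1, 1, 1, 0, 1, 1, 0] x = face 2 (bc p 3 x) (bc p 1 x) (bc p 2 x)"
  by ((rule Qspline_face2[OF _ x]; simp add: perms3_def knots_eq ps12_points replicate_mset_numerals),
      (rule Qspline_face2[OF _ x]; simp add: perms3_def knots_eq ps12_points replicate_mset_numerals),
      (rule Qspline_face2[OF _ x]; simp add: perms3_def knots_eq ps12_points replicate_mset_numerals))

lemma Qspline_s3: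
  assumes x: "x \<in> triangle p"
  shows "Qspline TYPE(3) p [4, 0, 0, 1, 0, 1, 0] x = corner 3 (bc p 1 x) (bc p 2 x) (bc p 3 x)"
    "Qspline TYPE(3) p [3, 1, 0, 1, 0, 1, 0] x = edge 3 (bc p 1 x) (bc p 2 x) (bc p 3 x)"
    "Qspline TYPE(3) p [2, 2, 1, 1, 0, 0, 0] x = mid3 (bc p 1 x) (bc p 2 x) (bc p 3 x)"
    "Qspline TYPE(3) p [1, 3, 0, 1, 1, 0, 0] x = edge 3 (bc p 2 x) (bc p 1 x) (bc p 3 x)"
    "Qspline TYPE(3) p [0, 4, 0, 1, 1, 0, 0] x = corner 3 (bc p 2 x) (bc p 3 x) (bc p 1 x)"
    "Qspline TYPE(3) p [0, 3, 1, 1, 1, 0, 0] x = edge 3 (bc p 2 x) (bc p 3 x) (bc p 1 x)"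
    "Qspline TYPE(3) p [1, 2, 2, 0, 1, 0, 0] x = mid3 (bc p 2 x) (bc p 3 x) (bc p 1 x)"
    "Qspline TYPE(3) p [0, 1, 3, 0, 1, 1, 0] x = edge 3 (bc p 3 x) (bc p 2 x) (bc p 1 x)"
    "Qspline TYPE(3) p [0, 0, 4, 0, 1, 1, 0] x = corner 3 (bc p 3 x) (bc p 1 x) (bc p 2 x)"
    "Qspline TYPE(3) p [1, 0, 3, 0, 1, 1, 0] x = edge 3 (bc p 3 x) (bc p 1 x) (bc p 2 x)"
    "Qspline TYPE(3) p [2, 1, 2, 0, 0, 1, 0] x = mid3 (bc p 3 x) (bc p 1 x) (bc p 2 x)"
    "Qspline TYPE(3) p [3, 0, 1, 1, 0, 1, 0] x = edge 3 (bc p 1 x) (bc p 3 x) (bc p 2 x)"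
    "Qspline TYPE(3) p [2, 1, 1, 1, 0, 1, 0] x = face 3 (bc p 1 x) (bc p 2 x) (bc p 3 x)"
    "Qspline TYPE(3) p [1, 2, 1, 1, 1, 0, 0] x = face 3 (bc p 2 x) (bc p 3 x) (bc p 1 x)"
    "Qspline TYPE(3) p [1, 1, 2, 0, 1, 1, 0] x = face 3 (bc p 3 x) (bc p 1 x) (bc p 2 x)"
    "Qspline TYPE(3) p [1, 1, 1, 1, 1, 1, 0] x = center3 (bc p 1 x) (bc p 2 x) (bc p 3 x)"
  by ((rule Qspline_corner3[OF _ x]; simp add: perms3_def knots_eq ps12_points replicate_mset_numerals),
      (rule Qspline_edge3[OF _ x]; simp add: perms3_def knots_eq ps12_points replicate_mset_numerals),
      (rule Qspline_mid3[OF _ x]; simp add: perms3_def knots_eq ps12_points replicate_mset_numerals),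
      (rule Qspline_edge3[OF _ x]; simp add: perms3_def knots_eq ps12_points replicate_mset_numerals),
      (rule Qspline_corner3[OF _ x]; simp add: perms3_def knots_eq ps12_points replicate_mset_numerals),
      (rule Qspline_edge3[OF _ x]; simp add: perms3_def knots_eq ps12_points replicate_mset_numerals),
      (rule Qspline_mid3[OF _ x]; simp add: perms3_def knots_eq ps12_points replicate_mset_numerals),
      (rule Qspline_edge3[OF _ x]; simp add: perms3_def knots_eq ps12_points replicate_mset_numerals),
      (rule Qspline_corner3[OF _ x]; simp add: perms3_def knots_eq ps12_points replicate_mset_numerals),
      (rule Qspline_edge3[OF _ x]; simp add: perms3_def knots_eq ps12_points replicate_mset_numerals),
      (rule Qspline_mid3[OF _ x]; simp add: perms3_def knots_eq ps12_points replicate_mset_numerals),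
      (rule Qspline_edge3[OF _ x]; simp add: perms3_def knots_eq ps12_points replicate_mset_numerals),
      (rule Qspline_face3[OF _ x]; simp add: perms3_def knots_eq ps12_points replicate_mset_numerals),
      (rule Qspline_face3[OF _ x]; simp add: perms3_def knots_eq ps12_points replicate_mset_numerals),
      (rule Qspline_face3[OF _ x]; simp add: perms3_def knots_eq ps12_points replicate_mset_numerals),
      (rule Qspline_center3[OF _ x]; simp add: perms3_def knots_eq ps12_points replicate_mset_numerals))

lemma Qspline_s3':
  assumes x: "x \<in> triangle p"
  shows "Qspline TYPE(3) p [2, 2, 2, 0, 0, 0, 0] x = bernstein3 (bc p 1 x) (bc p 2 x) (bc p 3 x)"
  by ((rule Qspline_bernstein3[OF _ x]; simp add: perms3_def knots_eq ps12_points replicate_mset_numerals))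

section \<open>The quasi-interpolants as explicit sums on the triangle\<close>

lemma quasi_interp_s1:
  assumes "x \<in> triangle p"
  shows "quasi_interp TYPE(1) p s1 dual1 F x =
    dual_functional [p 1] F * (1/4 * corner 1 (bc p 1 x) (bc p 2 x) (bc p 3 x)) +
    dual_functional [p 2] F * (1/4 * corner 1 (bc p 2 x) (bc p 3 x) (bc p 1 x)) +
    dual_functional [p 3] F * (1/4 * corner 1 (bc p 3 x) (bc p 1 x) (bc p 2 x)) +
    dual_functional [p 4] F * (1/3 * mid1 (bc p 1 x) (bc p 2 x) (bc p 3 x)) +
    dual_functional [p 5] F * (1/3 * mid1 (bc p 2 x) (bc p 3 x) (bc p 1 x)) +
    dual_functional [p 6] F * (1/3 * mid1 (bc p 3 x) (bc p 1 x) (bc p 2 x)) +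
    dual_functional [p 7] F * (1/3 * inner1 (bc p 1 x) (bc p 2 x) (bc p 3 x)) +
    dual_functional [p 8] F * (1/3 * inner1 (bc p 2 x) (bc p 3 x) (bc p 1 x)) +
    dual_functional [p 9] F * (1/3 * inner1 (bc p 3 x) (bc p 1 x) (bc p 2 x)) +
    dual_functional [p 10] F * (1/4 * center1 (bc p 1 x) (bc p 2 x) (bc p 3 x))"
  using Qspline_s1[OF assms]
  by (subst quasi_interp_zip) (simp_all add: s1_def dual1_def)

lemma quasi_interp_s2:
  assumes "x \<in> triangle p"
  shows "quasi_interp TYPE(2) p s2 dual2 F x =
    dual_functional [p 1, p 1] F * (1/4 * corner 2 (bc p 1 x) (bc p 2 x) (bc p 3 x)) +
    dual_functional [p 1, p 4] F * (1/2 * edge 2 (bc p 1 x) (bc p 2 x) (bc p 3 x)) +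
    dual_functional [p 4, p 10] F * (3/4 * mid2 (bc p 1 x) (bc p 2 x) (bc p 3 x)) +
    dual_functional [p 2, p 4] F * (1/2 * edge 2 (bc p 2 x) (bc p 1 x) (bc p 3 x)) +
    dual_functional [p 2, p 2] F * (1/4 * corner 2 (bc p 2 x) (bc p 3 x) (bc p 1 x)) +
    dual_functional [p 2, p 5] F * (1/2 * edge 2 (bc p 2 x) (bc p 3 x) (bc p 1 x)) +
    dual_functional [p 5, p 10] F * (3/4 * mid2 (bc p 2 x) (bc p 3 x) (bc p 1 x)) +
    dual_functional [p 3, p 5] F * (1/2 * edge 2 (bc p 3 x) (bc p 2 x) (bc p 1 x)) +
    dual_functional [p 3, p 3] F * (1/4 * corner 2 (bc p 3 x) (bc p 1 x) (bc p 2 x)) +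
    dual_functional [p 3, p 6] F * (1/2 * edge 2 (bc p 3 x) (bc p 1 x) (bc p 2 x)) +
    dual_functional [p 6, p 10] F * (3/4 * mid2 (bc p 3 x) (bc p 1 x) (bc p 2 x)) +
    dual_functional [p 1, p 6] F * (1/2 * edge 2 (bc p 1 x) (bc p 3 x) (bc p 2 x))"
  using Qspline_s2[OF assms]
  by (subst quasi_interp_zip) (simp_all add: s2_def dual2_def)

lemma quasi_interp_s2':
  assumes "x \<in> triangle p"
  shows "quasi_interp TYPE(2) p s2' dual2' F x =
    dual_functional [p 1, p 1] F * (1/4 * corner 2 (bc p 1 x) (bc p 2 x) (bc p 3 x)) +
    dual_functional [p 1, p 4] F * (1/2 * edge 2 (bc p 1 x) (bc p 2 x) (bc p 3 x)) +
    dual_functional [p 1, p 10] F * (3/4 * face 2 (bc p 1 x) (bc p 2 x) (bc p 3 x)) +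
    dual_functional [p 2, p 4] F * (1/2 * edge 2 (bc p 2 x) (bc p 1 x) (bc p 3 x)) +
    dual_functional [p 2, p 2] F * (1/4 * corner 2 (bc p 2 x) (bc p 3 x) (bc p 1 x)) +
    dual_functional [p 2, p 5] F * (1/2 * edge 2 (bc p 2 x) (bc p 3 x) (bc p 1 x)) +
    dual_functional [p 2, p 10] F * (3/4 * face 2 (bc p 2 x) (bc p 3 x) (bc p 1 x)) +
    dual_functional [p 3, p 5] F * (1/2 * edge 2 (bc p 3 x) (bc p 2 x) (bc p 1 x)) +
    dual_functional [p 3, p 3] F * (1/4 * corner 2 (bc p 3 x) (bc p 1 x) (bc p 2 x)) +
    dual_functional [p 3, p 6] F * (1/2 * edge 2 (bc p 3 x) (bc p 1 x) (bc p 2 x)) +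
    dual_functional [p 3, p 10] F * (3/4 * face 2 (bc p 3 x) (bc p 1 x) (bc p 2 x)) +
    dual_functional [p 1, p 6] F * (1/2 * edge 2 (bc p 1 x) (bc p 3 x) (bc p 2 x))"
  using Qspline_s2[OF assms] Qspline_s2'[OF assms]
  by (subst quasi_interp_zip) (simp_all add: s2'_def s2_def dual2'_def dual2_def list_update_numeral del: list_update.simps(2))

lemma quasi_interp_s3:
  assumes "x \<in> triangle p"
  shows "quasi_interp TYPE(3) p s3 dual3 F x =
    dual_functional [p 1, p 1, p 1] F * (1/4 * corner 3 (bc p 1 x) (bc p 2 x) (bc p 3 x)) +
    dual_functional [p 1, p 1, p 4] F * (1/2 * edge 3 (bc p 1 x) (bc p 2 x) (bc p 3 x)) +
    dual_functional [p 1, p 2, p 4] F * (1 * mid3 (bc p 1 x) (bc p 2 x) (bc p 3 x)) +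
    dual_functional [p 2, p 2, p 4] F * (1/2 * edge 3 (bc p 2 x) (bc p 1 x) (bc p 3 x)) +
    dual_functional [p 2, p 2, p 2] F * (1/4 * corner 3 (bc p 2 x) (bc p 3 x) (bc p 1 x)) +
    dual_functional [p 2, p 2, p 5] F * (1/2 * edge 3 (bc p 2 x) (bc p 3 x) (bc p 1 x)) +
    dual_functional [p 2, p 3, p 5] F * (1 * mid3 (bc p 2 x) (bc p 3 x) (bc p 1 x)) +
    dual_functional [p 3, p 3, p 5] F * (1/2 * edge 3 (bc p 3 x) (bc p 2 x) (bc p 1 x)) +
    dual_functional [p 3, p 3, p 3] F * (1/4 * corner 3 (bc p 3 x) (bc p 1 x) (bc p 2 x)) +
    dual_functional [p 3, p 3, p 6] F * (1/2 * edge 3 (bc p 3 x) (bc p 1 x) (bc p 2 x)) +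
    dual_functional [p 1, p 3, p 6] F * (1 * mid3 (bc p 3 x) (bc p 1 x) (bc p 2 x)) +
    dual_functional [p 1, p 1, p 6] F * (1/2 * edge 3 (bc p 1 x) (bc p 3 x) (bc p 2 x)) +
    dual_functional [p 1, p 4, p 6] F * (1 * face 3 (bc p 1 x) (bc p 2 x) (bc p 3 x)) +
    dual_functional [p 2, p 4, p 5] F * (1 * face 3 (bc p 2 x) (bc p 3 x) (bc p 1 x)) +
    dual_functional [p 3, p 5, p 6] F * (1 * face 3 (bc p 3 x) (bc p 1 x) (bc p 2 x)) +
    dual_functional [p 1, p 2, p 3] F * (1/4 * center3 (bc p 1 x) (bc p 2 x) (bc p 3 x))"
  using Qspline_s3[OF assms]
  by (subst quasi_interp_zip) (simp_all add: s3_def dual3_def)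

lemma quasi_interp_s3':
  assumes "x \<in> triangle p"
  shows "quasi_interp TYPE(3) p s3' dual3' F x =
    dual_functional [p 1, p 1, p 1] F * (1/4 * corner 3 (bc p 1 x) (bc p 2 x) (bc p 3 x)) +
    dual_functional [p 1, p 1, p 4] F * (1/2 * edge 3 (bc p 1 x) (bc p 2 x) (bc p 3 x)) +
    dual_functional [p 1, p 2, p 4] F * (1 * mid3 (bc p 1 x) (bc p 2 x) (bc p 3 x)) +
    dual_functional [p 2, p 2, p 4] F * (1/2 * edge 3 (bc p 2 x) (bc p 1 x) (bc p 3 x)) +
    dual_functional [p 2, p 2, p 2] F * (1/4 * corner 3 (bc p 2 x) (bc p 3 x) (bc p 1 x)) +
    dual_functional [p 2, p 2, p 5] F * (1/2 * edge 3 (bc p 2 x) (bc p 3 x) (bc p 1 x)) +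
    dual_functional [p 2, p 3, p 5] F * (1 * mid3 (bc p 2 x) (bc p 3 x) (bc p 1 x)) +
    dual_functional [p 3, p 3, p 5] F * (1/2 * edge 3 (bc p 3 x) (bc p 2 x) (bc p 1 x)) +
    dual_functional [p 3, p 3, p 3] F * (1/4 * corner 3 (bc p 3 x) (bc p 1 x) (bc p 2 x)) +
    dual_functional [p 3, p 3, p 6] F * (1/2 * edge 3 (bc p 3 x) (bc p 1 x) (bc p 2 x)) +
    dual_functional [p 1, p 3, p 6] F * (1 * mid3 (bc p 3 x) (bc p 1 x) (bc p 2 x)) +
    dual_functional [p 1, p 1, p 6] F * (1/2 * edge 3 (bc p 1 x) (bc p 3 x) (bc p 2 x)) +
    dual_functional [p 1, p 1, p 10] F * (3/4 * face 3 (bc p 1 x) (bc p 2 x) (bc p 3 x)) +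
    dual_functional [p 2, p 2, p 10] F * (3/4 * face 3 (bc p 2 x) (bc p 3 x) (bc p 1 x)) +
    dual_functional [p 3, p 3, p 10] F * (3/4 * face 3 (bc p 3 x) (bc p 1 x) (bc p 2 x)) +
    dual_functional [p 1, p 2, p 3] F * (1 * bernstein3 (bc p 1 x) (bc p 2 x) (bc p 3 x))"
  using Qspline_s3[OF assms] Qspline_s3'[OF assms]
  by (subst quasi_interp_zip) (simp_all add: s3'_def s3_def dual3'_def dual3_def list_update_numeral del: list_update.simps(2))

section \<open>Reduction to monomials in the barycentric coordinates\<close>

text \<open>Each coordinate, and 1, is a linear combination of the barycentric coordinates; they are replaced one factor at a time.\<close>

lemma linear_functional_vanishes_on_products:
  fixes L :: "(real^2 \<Rightarrow> real) \<Rightarrow> real"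
  assumes add: "\<And>f g. L (\<lambda>x. f x + g x) = L f + L g" and cmult: "\<And>c f. L (\<lambda>x. c * f x) = c * L f"
  shows "coordinate_product d f \<Longrightarrow>
    (\<And>a b c. a + b + c = d \<Longrightarrow> L (\<lambda>x. (bc p 1 x ^ a * bc p 2 x ^ b * bc p 3 x ^ c) * h x) = 0) \<Longrightarrow>
    L (\<lambda>x. f x * h x) = 0"
proof (induction d f arbitrary: h rule: coordinate_product.induct)
  case one
  then show ?case using one[of 0 0 0] by simp
next
  case (step d f g)
  have "\<exists>c1 c2 c3. \<forall>x. g x = c1 * bc p 1 x + c2 * bc p 2 x + c3 * bc p 3 x"
  proof -
    have "x$m = p 1 $ m * bc p 1 x + p 2 $ m * bc p 2 x + p 3 $ m * bc p 3 x" for x :: "real^2" and m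
      using arg_cong[OF bc_combine[of x], of "\<lambda>y. y$m"] by (simp add: mult.commute)
    moreover have "1 = 1 * bc p 1 x + 1 * bc p 2 x + 1 * bc p 3 x" for x
      using bc_sum[of x] by simp
    ultimately show ?thesis using step.hyps(2) by metis
  qed
  then obtain c1 c2 c3 where g: "g = (\<lambda>x. c1 * bc p 1 x + c2 * bc p 2 x + c3 * bc p 3 x)" by blast
  \<comment> \<open>The factor \<open>g\<close> is handed over to \<open>h\<close>, so that the
    induction hypothesis applies to \<open>f\<close> alone; expanding \<open>g\<close> afterwards
    raises one of the three exponents by 1.\<close>
  have "L (\<lambda>x. f x * (g x * h x)) = 0"
  proof (rule step.IH)
    fix a b c assume abc: "a + b + c = d"
    let ?m = "\<lambda>a b c x. (bc p 1 x ^ a * bc p 2 x ^ b * bc p 3 x ^ c) * h x"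
    have "(\<lambda>x. bc p 1 x ^ a * bc p 2 x ^ b * bc p 3 x ^ c * (g x * h x)) =
        (\<lambda>x. c1 * ?m (Suc a) b c x + (c2 * ?m a (Suc b) c x + c3 * ?m a b (Suc c) x))"
      by (rule ext) (simp add: g algebra_simps)
    moreover have "L (?m (Suc a) b c) = 0" "L (?m a (Suc b) c) = 0" "L (?m a b (Suc c)) = 0"
      using step.prems[of "Suc a" b c] step.prems[of a "Suc b" c] step.prems[of a b "Suc c"] abc
      by simp_all
    ultimately show "L (\<lambda>x. bc p 1 x ^ a * bc p 2 x ^ b * bc p 3 x ^ c * (g x * h x)) = 0"
      by (simp add: add cmult)
  qed
  then show ?case by (simp add: mult_ac)
qed

lemma linear_functional_vanishes_on_polys:
  fixes L :: "(real^2 \<Rightarrow> real) \<Rightarrow> real"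
  assumes add: "\<And>f g. L (\<lambda>x. f x + g x) = L f + L g" and cmult: "\<And>c f. L (\<lambda>x. c * f x) = c * L f"
    and base: "\<And>a b c. a + b + c = d \<Longrightarrow> L (\<lambda>x. bc p 1 x ^ a * bc p 2 x ^ b * bc p 3 x ^ c) = 0"
    and F: "F \<in> polys_upto d"
  shows "L F = 0"
proof -
  obtain e where "\<forall>x. F x = (\<Sum>i\<le>d. \<Sum>j\<le>d - i. e i j * (x$1)^i * (x$2)^j)"
    using F by (auto simp: polys_upto_def)
  then have F: "F = (\<lambda>x. \<Sum>i\<le>d. \<Sum>j\<le>d - i. e i j * ((x$1)^i * (x$2)^j))"
    by (auto simp: mult.assoc)
  have zero: "L (\<lambda>_. 0) = 0" using cmult[of 0 "\<lambda>_. 0"] by simp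
  have sum: "L (\<lambda>x. \<Sum>i\<in>I. f i x) = (\<Sum>i\<in>I. L (f i))" if "finite I" for I and f :: "nat \<Rightarrow> real^2 \<Rightarrow> real"
    using that by (induction I rule: finite_induct) (simp_all add: add zero)
  have "L (\<lambda>x. (x$1)^i * (x$2)^j) = 0" if "i + j \<le> d" for i j
    using linear_functional_vanishes_on_products[where L = L and h = "\<lambda>_. 1",
        OF add cmult coordinate_product_monomial[OF that]] base
    by simp
  then show ?thesis
    unfolding F by (subst sum, simp, subst sum, simp) (simp add: cmult)
qed

text \<open>Affine functions commute with means, so the dual functionals of a monomial are computed
  from the coordinates of the split points.\<close>

lemma bc_average:
  "bc p i ((1/2) *\<^sub>R (a + b)) = (bc p i a + bc p i b) / 2"
  "bc p i ((1/3) *\<^sub>R (a + b + c)) = (bc p i a + bc p i b + bc p i c) / 3"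
proof -
  obtain \<alpha> \<beta> \<gamma> where "bc p i = (\<lambda>x. \<alpha> * x$1 + \<beta> * x$2 + \<gamma>)"
    using affine_function_bc[of i] by (rule affine_functionE)
  then show "bc p i ((1/2) *\<^sub>R (a + b)) = (bc p i a + bc p i b) / 2"
    "bc p i ((1/3) *\<^sub>R (a + b + c)) = (bc p i a + bc p i b + bc p i c) / 3"
    by (simp_all add: field_simps)
qed

lemma quasi_interp_linear:
  "quasi_interp D p B duals (\<lambda>y. f y + g y) x = quasi_interp D p B duals f x + quasi_interp D p B duals g x"
  "quasi_interp D p B duals (\<lambda>y. c * f y) x = c * quasi_interp D p B duals f x"
  unfolding quasi_interp_def dual_functional_def Let_def
  by (simp_all add: sum.distrib distrib_left distrib_right sum_distrib_left sum_distrib_right mult_ac)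

text \<open>At a fixed point \<open>x\<close> the error is a linear functional of \<open>F\<close>,
  so it vanishes on all polynomials once it vanishes on the forms of degree
  \<open>d\<close>.\<close>

lemma reproduces_polys:
  assumes "\<And>a b c. a + b + c = d \<Longrightarrow>
      quasi_interp D p B duals (\<lambda>y. bc p 1 y ^ a * bc p 2 y ^ b * bc p 3 y ^ c) x =
      bc p 1 x ^ a * bc p 2 x ^ b * bc p 3 x ^ c"
    and "F \<in> polys_upto d"
  shows "quasi_interp D p B duals F x = F x"
proof -
  have "quasi_interp D p B duals F x - F x = 0"
    by (rule linear_functional_vanishes_on_polys[OF _ _ _ assms(2),
          where L = "\<lambda>F. quasi_interp D p B duals F x - F x"])
      (simp add: quasi_interp_linear, simp add: quasi_interp_linear algebra_simps, simp add: assms(1))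
  then show ?thesis by simp
qed

section \<open>Membership of the basis functions in the spline space\<close>

lemma spline_space_chord_1:
  assumes "(i, j, k) \<in> perms3"
  shows "(\<lambda>x. pp (bc p i x - bc p j x)) \<in> spline_space p 1"
    and "(\<lambda>x. pp (bc p i x - bc p j x - bc p k x)) \<in> spline_space p 1"
  using spline_space_chord2[OF assms, of 1] spline_space_chord3[OF assms, of 1] by simp_all

lemma spline_space_basis:
  assumes "(i, j, k) \<in> perms3"
  shows "0 < d \<Longrightarrow> (\<lambda>x. corner d (bc p i x) (bc p j x) (bc p k x)) \<in> spline_space p d"
    and "0 < d \<Longrightarrow> (\<lambda>x. edge d (bc p i x) (bc p j x) (bc p k x)) \<in> spline_space p d"
    and "(\<lambda>x. mid1 (bc p i x) (bc p j x) (bc p k x)) \<in> spline_space p 1"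
    and "(\<lambda>x. inner1 (bc p i x) (bc p j x) (bc p k x)) \<in> spline_space p 1"
    and "(\<lambda>x. center1 (bc p i x) (bc p j x) (bc p k x)) \<in> spline_space p 1"
    and "(\<lambda>x. face 2 (bc p i x) (bc p j x) (bc p k x)) \<in> spline_space p 2"
    and "(\<lambda>x. mid2 (bc p i x) (bc p j x) (bc p k x)) \<in> spline_space p 2"
    and "(\<lambda>x. face 3 (bc p i x) (bc p j x) (bc p k x)) \<in> spline_space p 3"
    and "(\<lambda>x. mid3 (bc p i x) (bc p j x) (bc p k x)) \<in> spline_space p 3"
    and "(\<lambda>x. center3 (bc p i x) (bc p j x) (bc p k x)) \<in> spline_space p 3"
    and "(\<lambda>x. bernstein3 (bc p i x) (bc p j x) (bc p k x)) \<in> spline_space p 3"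
proof -
  note ops = spline_space_cmult spline_space_add spline_space_diff spline_space_divide
  note affine = affine_function_bc affine_function_add affine_function_diff affine_function_cmult
  \<comment> \<open>All six orderings are supplied, since the closed forms contain chords for every
    pair and in both orientations.\<close>
  note perms = assms perms3_permute[OF assms]
  note chords = perms[THEN spline_space_chord2] perms[THEN spline_space_chord3]
  note chords1 = perms[THEN spline_space_chord_1(1)] perms[THEN spline_space_chord_1(2)]
  show "(\<lambda>x. corner d (bc p i x) (bc p j x) (bc p k x)) \<in> spline_space p d" if "0 < d" for d
    unfolding corner_def by (intro ops chords that)
  show "(\<lambda>x. edge d (bc p i x) (bc p j x) (bc p k x)) \<in> spline_space p d" if "0 < d" for d
    unfolding edge_def by (intro ops chords that)
  show "(\<lambda>x. mid1 (bc p i x) (bc p j x) (bc p k x)) \<in> spline_space p 1"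
    unfolding mid1_def
    by (intro ops chords1 spline_space_min[OF assms] spline_space_affine affine)
  show "(\<lambda>x. inner1 (bc p i x) (bc p j x) (bc p k x)) \<in> spline_space p 1"
    unfolding inner1_def
    by (intro ops chords1 spline_space_min[OF assms] spline_space_affine affine)
  show "(\<lambda>x. center1 (bc p i x) (bc p j x) (bc p k x)) \<in> spline_space p 1"
    unfolding center1_def
    by (intro ops chords1 spline_space_min[OF assms] spline_space_affine affine)
  show "(\<lambda>x. face 2 (bc p i x) (bc p j x) (bc p k x)) \<in> spline_space p 2"
    unfolding face_def by (intro ops chords spline_space_power2 affine zero_less_numeral)
  show "(\<lambda>x. mid2 (bc p i x) (bc p j x) (bc p k x)) \<in> spline_space p 2"
    unfolding mid2_def by (intro ops chords spline_space_power2 affine zero_less_numeral)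
  show "(\<lambda>x. face 3 (bc p i x) (bc p j x) (bc p k x)) \<in> spline_space p 3"
    unfolding face_def by (intro ops chords spline_space_power3 affine zero_less_numeral)
  \<comment> \<open>The mixed cubic term is written as a product of three affine factors to match
    \<open>spline_space_affine3\<close>.\<close>
  have "(\<lambda>x. 6 * bc p i x * bc p j x * bc p j x - 2 * bc p j x ^ 3 + 2 * pp (bc p j x - bc p i x) ^ 3) \<in> spline_space p 3"
    by (intro ops chords spline_space_affine3 spline_space_power3 affine zero_less_numeral)
  then show "(\<lambda>x. mid3 (bc p i x) (bc p j x) (bc p k x)) \<in> spline_space p 3"
    unfolding mid3_def by (simp add: power2_eq_square mult.assoc)
  show "(\<lambda>x. bernstein3 (bc p i x) (bc p j x) (bc p k x)) \<in> spline_space p 3"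
    unfolding bernstein3_def by (intro spline_space_affine3 affine)
  have "(\<lambda>x. bc p k x * bc p k x * bc p i x) \<in> spline_space p 3"
    by (intro spline_space_affine3 affine)
  then have "(\<lambda>x. bc p k x ^ 2 * bc p i x) \<in> spline_space p 3" by (simp add: power2_eq_square)
  then show "(\<lambda>x. center3 (bc p i x) (bc p j x) (bc p k x)) \<in> spline_space p 3"
    unfolding center3_def
    by (intro ops chords spline_space_power3 affine zero_less_numeral)
qed

text \<open>The explicit sum lies in the space term by term, whatever the values of the functionals,
  and the map agrees with it on the triangle.\<close>

lemma quasi_interp_s1_in_spline_space: "quasi_interp TYPE(1) p s1 dual1 F \<in> spline_space p 1"
  by (rule spline_space_cong[OF _ quasi_interp_s1[symmetric]])
    (intro spline_space_add spline_space_cmult spline_space_basis;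
      simp add: perms3_def)

lemma quasi_interp_s2_in_spline_space: "quasi_interp TYPE(2) p s2 dual2 F \<in> spline_space p 2"
  by (rule spline_space_cong[OF _ quasi_interp_s2[symmetric]])
    (intro spline_space_add spline_space_cmult spline_space_basis;
      simp add: perms3_def)

lemma quasi_interp_s2'_in_spline_space: "quasi_interp TYPE(2) p s2' dual2' F \<in> spline_space p 2"
  by (rule spline_space_cong[OF _ quasi_interp_s2'[symmetric]])
    (intro spline_space_add spline_space_cmult spline_space_basis;
      simp add: perms3_def)

lemma quasi_interp_s3_in_spline_space: "quasi_interp TYPE(3) p s3 dual3 F \<in> spline_space p 3"
  by (rule spline_space_cong[OF _ quasi_interp_s3[symmetric]])
    (intro spline_space_add spline_space_cmult spline_space_basis;
      simp add: perms3_def)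

lemma quasi_interp_s3'_in_spline_space: "quasi_interp TYPE(3) p s3' dual3' F \<in> spline_space p 3"
  by (rule spline_space_cong[OF _ quasi_interp_s3'[symmetric]])
    (intro spline_space_add spline_space_cmult spline_space_basis;
      simp add: perms3_def)

section \<open>Reproduction of the monomials\<close>

text \<open>The closed forms are homogeneous in the coordinates (\<open>center1\<close> contains
  \<open>b1 + b2 + b3\<close> in place of 1), so both sides can be compared as polynomials in
  \<open>B1\<close>, \<open>B2\<close>, \<open>B3\<close> and the truncated terms. In degree 1 the
  two-term differences occur only in cyclic orientation.\<close>

lemma reproduces_monomials_s1:
  assumes x: "x \<in> triangle p" and abc: "a + b + c = 1"
  shows "quasi_interp TYPE(1) p s1 dual1 (\<lambda>y. bc p 1 y ^ a * bc p 2 y ^ b * bc p 3 y ^ c) x =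
    bc p 1 x ^ a * bc p 2 x ^ b * bc p 3 x ^ c"
proof -
  define B1 B2 B3 where "B1 = bc p 1 x" and "B2 = bc p 2 x" and "B3 = bc p 3 x"
  \<comment> \<open>Rotating the vertices produces each three-term chord with its subtrahends in
    both orders; one order is kept, so that equal truncated terms become identical.\<close>
  have commute: "B1 - B3 - B2 = B1 - B2 - B3" "B2 - B3 - B1 = B2 - B1 - B3" "B3 - B2 - B1 = B3 - B1 - B2"
    by simp_all
  have min: "min B2 (min B3 B1) = min B1 (min B2 B3)" "min B3 (min B1 B2) = min B1 (min B2 B3)"
    by (simp_all add: min.commute min.left_commute)
  note Q = quasi_interp_s1[OF x, folded B1_def B2_def B3_def] dual_functional_1
  note numeric = bc_average bc_vertex
  note expand = corner_def mid1_def inner1_def center1_def commute min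
  show ?thesis
  proof (cases rule: sum_eq_1_cases[OF abc])
    case 1
    show ?thesis
      unfolding 1 Q B1_def[symmetric] B2_def[symmetric] B3_def[symmetric] numeric
      by (simp add: power_divide, unfold expand,
          simp add: field_simps power2_eq_square power3_eq_cube)
  next
    case 2
    show ?thesis
      unfolding 2 Q B1_def[symmetric] B2_def[symmetric] B3_def[symmetric] numeric
      by (simp add: power_divide, unfold expand,
          simp add: field_simps power2_eq_square power3_eq_cube)
  next
    case 3
    show ?thesis
      unfolding 3 Q B1_def[symmetric] B2_def[symmetric] B3_def[symmetric] numeric
      by (simp add: power_divide, unfold expand,
          simp add: field_simps power2_eq_square power3_eq_cube)
  qed
qed

lemma reproduces_monomials_s2:
  assumes x: "x \<in> triangle p" and abc: "a + b + c = 2"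
  shows "quasi_interp TYPE(2) p s2 dual2 (\<lambda>y. bc p 1 y ^ a * bc p 2 y ^ b * bc p 3 y ^ c) x =
    bc p 1 x ^ a * bc p 2 x ^ b * bc p 3 x ^ c"
proof -
  define B1 B2 B3 where "B1 = bc p 1 x" and "B2 = bc p 2 x" and "B3 = bc p 3 x"
  have commute: "B1 - B3 - B2 = B1 - B2 - B3" "B2 - B3 - B1 = B2 - B1 - B3" "B3 - B2 - B1 = B3 - B1 - B2"
    by simp_all
  \<comment> \<open>Both orientations of a two-term chord occur; those against the cycle 1, 2, 3 are
    expressed through the others.\<close>
  note orient = pp_minus_power2[of "B1 - B2", unfolded minus_diff_eq] pp_minus_power2[of "B2 - B3", unfolded minus_diff_eq]
      pp_minus_power2[of "B3 - B1", unfolded minus_diff_eq]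
  note Q = quasi_interp_s2[OF x, folded B1_def B2_def B3_def] dual_functional_2
  note numeric = bc_average bc_vertex
  note expand = corner_def edge_def mid2_def face_def commute orient
  show ?thesis
  proof (cases rule: sum_eq_2_cases[OF abc])
    case 1
    show ?thesis
      unfolding 1 Q B1_def[symmetric] B2_def[symmetric] B3_def[symmetric] numeric
      by (simp add: power_divide, unfold expand,
          simp add: field_simps power2_eq_square power3_eq_cube)
  next
    case 2
    show ?thesis
      unfolding 2 Q B1_def[symmetric] B2_def[symmetric] B3_def[symmetric] numeric
      by (simp add: power_divide, unfold expand,
          simp add: field_simps power2_eq_square power3_eq_cube)
  next
    case 3
    show ?thesis
      unfolding 3 Q B1_def[symmetric] B2_def[symmetric] B3_def[symmetric] numeric
      by (simp add: power_divide, unfold expand,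
          simp add: field_simps power2_eq_square power3_eq_cube)
  next
    case 4
    show ?thesis
      unfolding 4 Q B1_def[symmetric] B2_def[symmetric] B3_def[symmetric] numeric
      by (simp add: power_divide, unfold expand,
          simp add: field_simps power2_eq_square power3_eq_cube)
  next
    case 5
    show ?thesis
      unfolding 5 Q B1_def[symmetric] B2_def[symmetric] B3_def[symmetric] numeric
      by (simp add: power_divide, unfold expand,
          simp add: field_simps power2_eq_square power3_eq_cube)
  next
    case 6
    show ?thesis
      unfolding 6 Q B1_def[symmetric] B2_def[symmetric] B3_def[symmetric] numeric
      by (simp add: power_divide, unfold expand,
          simp add: field_simps power2_eq_square power3_eq_cube)
  qed
qed

lemma reproduces_monomials_s2':
  assumes x: "x \<in> triangle p" and abc: "a + b + c = 2"
  shows "quasi_interp TYPE(2) p s2' dual2' (\<lambda>y. bc p 1 y ^ a * bc p 2 y ^ b * bc p 3 y ^ c) x =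
    bc p 1 x ^ a * bc p 2 x ^ b * bc p 3 x ^ c"
proof -
  define B1 B2 B3 where "B1 = bc p 1 x" and "B2 = bc p 2 x" and "B3 = bc p 3 x"
  have commute: "B1 - B3 - B2 = B1 - B2 - B3" "B2 - B3 - B1 = B2 - B1 - B3" "B3 - B2 - B1 = B3 - B1 - B2"
    by simp_all
  note orient = pp_minus_power2[of "B1 - B2", unfolded minus_diff_eq] pp_minus_power2[of "B2 - B3", unfolded minus_diff_eq]
      pp_minus_power2[of "B3 - B1", unfolded minus_diff_eq]
  note Q = quasi_interp_s2'[OF x, folded B1_def B2_def B3_def] dual_functional_2
  note numeric = bc_average bc_vertex
  note expand = corner_def edge_def mid2_def face_def commute orient
  show ?thesis
  proof (cases rule: sum_eq_2_cases[OF abc])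
    case 1
    show ?thesis
      unfolding 1 Q B1_def[symmetric] B2_def[symmetric] B3_def[symmetric] numeric
      by (simp add: power_divide, unfold expand,
          simp add: field_simps power2_eq_square power3_eq_cube)
  next
    case 2
    show ?thesis
      unfolding 2 Q B1_def[symmetric] B2_def[symmetric] B3_def[symmetric] numeric
      by (simp add: power_divide, unfold expand,
          simp add: field_simps power2_eq_square power3_eq_cube)
  next
    case 3
    show ?thesis
      unfolding 3 Q B1_def[symmetric] B2_def[symmetric] B3_def[symmetric] numeric
      by (simp add: power_divide, unfold expand,
          simp add: field_simps power2_eq_square power3_eq_cube)
  next
    case 4
    show ?thesis
      unfolding 4 Q B1_def[symmetric] B2_def[symmetric] B3_def[symmetric] numeric
      by (simp add: power_divide, unfold expand,
          simp add: field_simps power2_eq_square power3_eq_cube)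
  next
    case 5
    show ?thesis
      unfolding 5 Q B1_def[symmetric] B2_def[symmetric] B3_def[symmetric] numeric
      by (simp add: power_divide, unfold expand,
          simp add: field_simps power2_eq_square power3_eq_cube)
  next
    case 6
    show ?thesis
      unfolding 6 Q B1_def[symmetric] B2_def[symmetric] B3_def[symmetric] numeric
      by (simp add: power_divide, unfold expand,
          simp add: field_simps power2_eq_square power3_eq_cube)
  qed
qed

lemma reproduces_monomials_s3:
  assumes x: "x \<in> triangle p" and abc: "a + b + c = 3"
  shows "quasi_interp TYPE(3) p s3 dual3 (\<lambda>y. bc p 1 y ^ a * bc p 2 y ^ b * bc p 3 y ^ c) x =
    bc p 1 x ^ a * bc p 2 x ^ b * bc p 3 x ^ c"
proof -
  define B1 B2 B3 where "B1 = bc p 1 x" and "B2 = bc p 2 x" and "B3 = bc p 3 x"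
  have commute: "B1 - B3 - B2 = B1 - B2 - B3" "B2 - B3 - B1 = B2 - B1 - B3" "B3 - B2 - B1 = B3 - B1 - B2"
    by simp_all
  note orient = pp_minus_power3[of "B1 - B2", unfolded minus_diff_eq] pp_minus_power3[of "B2 - B3", unfolded minus_diff_eq]
      pp_minus_power3[of "B3 - B1", unfolded minus_diff_eq]
  \<comment> \<open>The truncated cubes become opaque constants, so that expanding the cubes in the
    polynomial parts leaves them intact.\<close>
  define U1 U2 U3 V1 V2 V3 where "U1 = pp (B1 - B2) ^ 3" and "U2 = pp (B2 - B3) ^ 3" and "U3 = pp (B3 - B1) ^ 3"
    and "V1 = pp (B1 - B2 - B3) ^ 3" and "V2 = pp (B2 - B1 - B3) ^ 3" and "V3 = pp (B3 - B1 - B2) ^ 3"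
  note atoms = U1_def U2_def U3_def V1_def V2_def V3_def
  note Q = quasi_interp_s3[OF x, folded B1_def B2_def B3_def] dual_functional_3
  note numeric = bc_average bc_vertex
  note expand = corner_def edge_def mid3_def face_def center3_def bernstein3_def commute orient
  show ?thesis
  proof (cases rule: sum_eq_3_cases[OF abc])
    case 1
    show ?thesis
      unfolding 1 Q B1_def[symmetric] B2_def[symmetric] B3_def[symmetric] numeric
      by (simp add: power_divide, unfold expand, fold atoms,
          simp add: field_simps power2_eq_square power3_eq_cube)
  next
    case 2
    show ?thesis
      unfolding 2 Q B1_def[symmetric] B2_def[symmetric] B3_def[symmetric] numeric
      by (simp add: power_divide, unfold expand, fold atoms,
          simp add: field_simps power2_eq_square power3_eq_cube)
  next
    case 3
    show ?thesis
      unfolding 3 Q B1_def[symmetric] B2_def[symmetric] B3_def[symmetric] numeric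
      by (simp add: power_divide, unfold expand, fold atoms,
          simp add: field_simps power2_eq_square power3_eq_cube)
  next
    case 4
    show ?thesis
      unfolding 4 Q B1_def[symmetric] B2_def[symmetric] B3_def[symmetric] numeric
      by (simp add: power_divide, unfold expand, fold atoms,
          simp add: field_simps power2_eq_square power3_eq_cube)
  next
    case 5
    show ?thesis
      unfolding 5 Q B1_def[symmetric] B2_def[symmetric] B3_def[symmetric] numeric
      by (simp add: power_divide, unfold expand, fold atoms,
          simp add: field_simps power2_eq_square power3_eq_cube)
  next
    case 6
    show ?thesis
      unfolding 6 Q B1_def[symmetric] B2_def[symmetric] B3_def[symmetric] numeric
      by (simp add: power_divide, unfold expand, fold atoms,
          simp add: field_simps power2_eq_square power3_eq_cube)
  next
    case 7
    show ?thesis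
      unfolding 7 Q B1_def[symmetric] B2_def[symmetric] B3_def[symmetric] numeric
      by (simp add: power_divide, unfold expand, fold atoms,
          simp add: field_simps power2_eq_square power3_eq_cube)
  next
    case 8
    show ?thesis
      unfolding 8 Q B1_def[symmetric] B2_def[symmetric] B3_def[symmetric] numeric
      by (simp add: power_divide, unfold expand, fold atoms,
          simp add: field_simps power2_eq_square power3_eq_cube)
  next
    case 9
    show ?thesis
      unfolding 9 Q B1_def[symmetric] B2_def[symmetric] B3_def[symmetric] numeric
      by (simp add: power_divide, unfold expand, fold atoms,
          simp add: field_simps power2_eq_square power3_eq_cube)
  next
    case 10
    show ?thesis
      unfolding 10 Q B1_def[symmetric] B2_def[symmetric] B3_def[symmetric] numeric
      by (simp add: power_divide, unfold expand, fold atoms,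
          simp add: field_simps power2_eq_square power3_eq_cube)
  qed
qed

lemma reproduces_monomials_s3':
  assumes x: "x \<in> triangle p" and abc: "a + b + c = 3"
  shows "quasi_interp TYPE(3) p s3' dual3' (\<lambda>y. bc p 1 y ^ a * bc p 2 y ^ b * bc p 3 y ^ c) x =
    bc p 1 x ^ a * bc p 2 x ^ b * bc p 3 x ^ c"
proof -
  define B1 B2 B3 where "B1 = bc p 1 x" and "B2 = bc p 2 x" and "B3 = bc p 3 x"
  have commute: "B1 - B3 - B2 = B1 - B2 - B3" "B2 - B3 - B1 = B2 - B1 - B3" "B3 - B2 - B1 = B3 - B1 - B2"
    by simp_all
  note orient = pp_minus_power3[of "B1 - B2", unfolded minus_diff_eq] pp_minus_power3[of "B2 - B3", unfolded minus_diff_eq]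
      pp_minus_power3[of "B3 - B1", unfolded minus_diff_eq]
  define U1 U2 U3 V1 V2 V3 where "U1 = pp (B1 - B2) ^ 3" and "U2 = pp (B2 - B3) ^ 3" and "U3 = pp (B3 - B1) ^ 3"
    and "V1 = pp (B1 - B2 - B3) ^ 3" and "V2 = pp (B2 - B1 - B3) ^ 3" and "V3 = pp (B3 - B1 - B2) ^ 3"
  note atoms = U1_def U2_def U3_def V1_def V2_def V3_def
  note Q = quasi_interp_s3'[OF x, folded B1_def B2_def B3_def] dual_functional_3
  note numeric = bc_average bc_vertex
  note expand = corner_def edge_def mid3_def face_def center3_def bernstein3_def commute orient
  show ?thesis
  proof (cases rule: sum_eq_3_cases[OF abc])
    case 1
    show ?thesis
      unfolding 1 Q B1_def[symmetric] B2_def[symmetric] B3_def[symmetric] numeric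
      by (simp add: power_divide, unfold expand, fold atoms,
          simp add: field_simps power2_eq_square power3_eq_cube)
  next
    case 2
    show ?thesis
      unfolding 2 Q B1_def[symmetric] B2_def[symmetric] B3_def[symmetric] numeric
      by (simp add: power_divide, unfold expand, fold atoms,
          simp add: field_simps power2_eq_square power3_eq_cube)
  next
    case 3
    show ?thesis
      unfolding 3 Q B1_def[symmetric] B2_def[symmetric] B3_def[symmetric] numeric
      by (simp add: power_divide, unfold expand, fold atoms,
          simp add: field_simps power2_eq_square power3_eq_cube)
  next
    case 4
    show ?thesis
      unfolding 4 Q B1_def[symmetric] B2_def[symmetric] B3_def[symmetric] numeric
      by (simp add: power_divide, unfold expand, fold atoms,
          simp add: field_simps power2_eq_square power3_eq_cube)
  next
    case 5
    show ?thesis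
      unfolding 5 Q B1_def[symmetric] B2_def[symmetric] B3_def[symmetric] numeric
      \<comment> \<open>The polar form of the product of the three coordinates vanishes at every
        dual triple except (1, 2, 3), where it is 1/6; only the Bernstein polynomial
        survives.\<close>
      by (simp add: bernstein3_def)
  next
    case 6
    show ?thesis
      unfolding 6 Q B1_def[symmetric] B2_def[symmetric] B3_def[symmetric] numeric
      by (simp add: power_divide, unfold expand, fold atoms,
          simp add: field_simps power2_eq_square power3_eq_cube)
  next
    case 7
    show ?thesis
      unfolding 7 Q B1_def[symmetric] B2_def[symmetric] B3_def[symmetric] numeric
      by (simp add: power_divide, unfold expand, fold atoms,
          simp add: field_simps power2_eq_square power3_eq_cube)
  next
    case 8
    show ?thesis
      unfolding 8 Q B1_def[symmetric] B2_def[symmetric] B3_def[symmetric] numeric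
      by (simp add: power_divide, unfold expand, fold atoms,
          simp add: field_simps power2_eq_square power3_eq_cube)
  next
    case 9
    show ?thesis
      unfolding 9 Q B1_def[symmetric] B2_def[symmetric] B3_def[symmetric] numeric
      by (simp add: power_divide, unfold expand, fold atoms,
          simp add: field_simps power2_eq_square power3_eq_cube)
  next
    case 10
    show ?thesis
      unfolding 10 Q B1_def[symmetric] B2_def[symmetric] B3_def[symmetric] numeric
      by (simp add: power_divide, unfold expand, fold atoms,
          simp add: field_simps power2_eq_square power3_eq_cube)
  qed
qed

end

theorem theorem4p9:
  fixes p :: "nat \<Rightarrow> real^2"
  assumes "\<not> collinear {p 1, p 2, p 3}"
    and "ps12_vertices p"
  shows "reproducing_quasi_interpolant p 1 (quasi_interp TYPE(1) p s1 dual1) \<and>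
         reproducing_quasi_interpolant p 2 (quasi_interp TYPE(2) p s2 dual2) \<and>
         reproducing_quasi_interpolant p 2 (quasi_interp TYPE(2) p s2' dual2') \<and>
         reproducing_quasi_interpolant p 3 (quasi_interp TYPE(3) p s3 dual3) \<and>
         reproducing_quasi_interpolant p 3 (quasi_interp TYPE(3) p s3' dual3')"
  unfolding reproducing_quasi_interpolant_def
  using quasi_interp_s1_in_spline_space[OF assms] quasi_interp_s2_in_spline_space[OF assms]
    quasi_interp_s2'_in_spline_space[OF assms] quasi_interp_s3_in_spline_space[OF assms]
    quasi_interp_s3'_in_spline_space[OF assms]
    reproduces_polys[OF assms reproduces_monomials_s1[OF assms]]
    reproduces_polys[OF assms reproduces_monomials_s2[OF assms]]
    reproduces_polys[OF assms reproduces_monomials_s2'[OF assms]]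
    reproduces_polys[OF assms reproduces_monomials_s3[OF assms]]
    reproduces_polys[OF assms reproduces_monomials_s3'[OF assms]]
  by blast

end
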